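(* The Clifford torus $T^n=S^1(\sqrt2)\times\cdots\times S^1(\sqrt2)\subset\mathbb{C}^n$ ($n$ factors, each a circle of radius $\sqrt2$ centered at the origin in one complex coordinate line) is Hamiltonian F-stable but Lagrangian F-unstable.
   Context: A self-shrinker is a submanifold $\Sigma^n\subset\mathbb{R}^{n+p}$ with $H=-\frac12x^\perp$ ($H=\mathrm{tr}A$, $A(X,Y)=(\bar\nabla_XY)^\perp$). For $x_0\in\mathbb{R}^{2n}$, $t_0>0$, $F_{x_0,t_0}(\Sigma)=(4\pi t_0)^{-n/2}\int_\Sigma e^{-|x-x_0|^2/(4t_0)}d\mu$. On a Lagrangian submanifold $\Sigma$ of $(\mathbb{C}^n,\bar\omega)$, a variation field $V$ is Lagrangian (resp. Hamiltonian) if the 1-form $i^*(V\lrcorner\bar\omega)$ on $\Sigma$ is closed (resp. exact). A Lagrangian self-shrinker $\Sigma$ is Lagrangian (resp. Hamiltonian) F-stable if for every compactly supported variation $\Sigma_s$, $\Sigma_0=\Sigma$, with Lagrangian (resp. Hamiltonian) variation field, there exist variations $x_s$ of $x_0=0$ and $t_s$ of $t_0=1$ such that $\partial_s^2|_{s=0}F_{x_s,t_s}(\Sigma_s)\ge0$; it is Lagrangian F-unstable if it is not Lagrangian F-stable.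
   Formalization: The formal statement assumes n ≥ 2 (for both parts); for n = 1 the claim fails, since the circle of radius √2 in ℂ is F-stable under all variations and hence not Lagrangian F-unstable. *)

theory Defs
  imports "HOL-Analysis.Analysis"
begin

primrec iter_dirder :: "'a::real_normed_vector list \<Rightarrow> ('a \<Rightarrow> 'b::real_normed_vector) \<Rightarrow> 'a \<Rightarrow> 'b" where
  "iter_dirder [] f = f"
| "iter_dirder (v # vs) f = (\<lambda>x. frechet_derivative (iter_dirder vs f) (at x) v)"

definition smooth_map :: "('a::real_normed_vector \<Rightarrow> 'b::real_normed_vector) \<Rightarrow> bool" where
  "smooth_map f \<longleftrightarrow> (\<forall>vs x. iter_dirder vs f differentiable (at x))"

definition pd :: "'n::finite \<Rightarrow> (real^'n \<Rightarrow> 'b::real_normed_vector) \<Rightarrow> real^'n \<Rightarrow> 'b" where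
  "pd k g \<theta> = frechet_derivative g (at \<theta>) (axis k 1)"

text \<open>2pi-periodicity in every angle variable (i.e. a map on the torus R^n/(2 pi Z)^n).\<close>
definition periodic_map :: "(real^'n::finite \<Rightarrow> 'b) \<Rightarrow> bool" where
  "periodic_map g \<longleftrightarrow> (\<forall>\<theta> k. g (\<theta> + (2 * pi) *\<^sub>R axis k 1) = g \<theta>)"

definition clifford :: "real^'n::finite \<Rightarrow> complex^'n" where
  "clifford \<theta> = (\<chi> k. complex_of_real (sqrt 2) * cis (\<theta> $ k))"

text \<open>Standard symplectic form on C^n, omega = sum dx_k wedge dy_k.\<close>
definition omega :: "complex^'n::finite \<Rightarrow> complex^'n \<Rightarrow> real" where
  "omega u v = (\<Sum>k\<in>UNIV. Im (cnj (u $ k) * v $ k))"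

definition Ffun :: "complex^'n::finite \<Rightarrow> real \<Rightarrow> (real^'n \<Rightarrow> complex^'n) \<Rightarrow> real" where
  "Ffun x0 t0 g = (4 * pi * t0) powr (- (real CARD('n) / 2)) *
     integral (cbox 0 (\<chi> k. 2 * pi))
       (\<lambda>\<theta>. exp (- (norm (g \<theta> - x0))\<^sup>2 / (4 * t0)) *
             sqrt (det (\<chi> i j. pd i g \<theta> \<bullet> pd j g \<theta>)))"

definition torus_variation :: "(real^'n::finite \<Rightarrow> complex^'n) \<Rightarrow> (real \<Rightarrow> real^'n \<Rightarrow> complex^'n) \<Rightarrow> bool" where
  "torus_variation Phi0 \<phi> \<longleftrightarrow>
     smooth_map (\<lambda>p::real \<times> (real^'n). \<phi> (fst p) (snd p)) \<and>
     (\<forall>s. periodic_map (\<phi> s)) \<and> \<phi> 0 = Phi0"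

text \<open>Variation field and the 1-form i^*(V contracted with omega), in angle coordinates.\<close>
definition var_field :: "(real \<Rightarrow> real^'n::finite \<Rightarrow> complex^'n) \<Rightarrow> real^'n \<Rightarrow> complex^'n" where
  "var_field \<phi> \<theta> = vector_derivative (\<lambda>s. \<phi> s \<theta>) (at 0)"

definition var_form :: "(real^'n::finite \<Rightarrow> complex^'n) \<Rightarrow> (real \<Rightarrow> real^'n \<Rightarrow> complex^'n) \<Rightarrow> 'n \<Rightarrow> real^'n \<Rightarrow> real" where
  "var_form Phi0 \<phi> j \<theta> = omega (var_field \<phi> \<theta>) (pd j Phi0 \<theta>)"

definition lagrangian_variation where
  "lagrangian_variation Phi0 \<phi> \<longleftrightarrow>
     (\<forall>j k \<theta>. pd k (var_form Phi0 \<phi> j) \<theta> = pd j (var_form Phi0 \<phi> k) \<theta>)"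

definition hamiltonian_variation where
  "hamiltonian_variation Phi0 \<phi> \<longleftrightarrow>
     (\<exists>h :: real^'n::finite \<Rightarrow> real. smooth_map h \<and> periodic_map h \<and>
        (\<forall>j \<theta>. var_form Phi0 \<phi> j \<theta> = pd j h \<theta>))"

definition F_stable_wrt where
  "F_stable_wrt P Phi0 \<longleftrightarrow>
     (\<forall>\<phi>. torus_variation Phi0 \<phi> \<and> P Phi0 \<phi> \<longrightarrow>
        (\<exists>(x :: real \<Rightarrow> complex^'n::finite) (t :: real \<Rightarrow> real).
            smooth_map x \<and> smooth_map t \<and> x 0 = 0 \<and> t 0 = 1 \<and>
            deriv (deriv (\<lambda>s. Ffun (x s) (t s) (\<phi> s))) 0 \<ge> 0))"

definition hamiltonian_F_stable :: "(real^'n::finite \<Rightarrow> complex^'n) \<Rightarrow> bool" where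
  "hamiltonian_F_stable Phi0 \<longleftrightarrow> F_stable_wrt hamiltonian_variation Phi0"

definition lagrangian_F_stable :: "(real^'n::finite \<Rightarrow> complex^'n) \<Rightarrow> bool" where
  "lagrangian_F_stable Phi0 \<longleftrightarrow> F_stable_wrt lagrangian_variation Phi0"

end

theory Submission
  imports Defs
begin

text \<open>
  Write the variation field as \<open>V\<^sub>k = e\<^bsup>i\<theta>\<^sub>k\<^esup> (u\<^sub>k + i v\<^sub>k)\<close>, so that \<open>u\<close> is its normal part. With
  \<open>y = x'(0)\<close>, \<open>h = t'(0)\<close>, the second derivative of F is a positive multiple of the average over the torus of
  \<open>\<Sum>\<^sub>i\<^sub>k (\<partial>\<^sub>i u\<^sub>k)\<^sup>2 / 2 - \<Sum>\<^sub>k u\<^sub>k\<^sup>2 + \<Sum>\<^sub>k u\<^sub>k (\<surd>2 h + Re (e\<^bsup>-i\<theta>\<^sub>k\<^esup> y\<^sub>k)) - n h\<^sup>2 / 2 - |y|\<^sup>2 / 4\<close>: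
  the tangential part \<open>v\<close> and the second-order terms only contribute divergences.

  In the Hamiltonian case \<open>u\<^sub>k = \<partial>\<^sub>k f\<close>, so only the modes \<open>m\<close> with \<open>m\<^sub>k \<noteq> 0\<close> occur in \<open>u\<^sub>k\<close>, and
  \<open>|m|\<^sup>2 / 2 \<ge> 1\<close> except for \<open>m = \<plusminus>e\<^sub>k\<close>; these exceptional modes are compensated by the translation
  \<open>y\<close> given by the first Fourier coefficients of \<open>u\<^sub>k\<close> (and \<open>h = 0\<close>). In the Lagrangian case, changing the
  radii of two of the circles at opposite rates makes all \<open>u\<^sub>k\<close> constant with sum zero, and the expression
  is negative for every choice of \<open>y\<close> and \<open>h\<close>.
\<close>

section \<open>Integration on the torus\<close>

text \<open>Both |x|^2 = 2n and the induced metric, twice the identity, are constant on the torus.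
  So the Gaussian weight and the area density are constants, and the second variation has constant
  coefficients in the angles; this is what makes Fourier analysis applicable. The self-shrinker
  equation appears as cancellation. In the first logarithmic derivative of the integrand the normal
  part \<open>u\<close> drops out pointwise, and the accelerations of the variation, of
  \<open>x\<close> and of \<open>t\<close> either cancel or integrate to zero. The part quadratic in
  the derivatives of \<open>v\<close> is a null Lagrangian. The compensation of the exceptional
  modes has no slack: the modes at plus and minus \<open>e\<^sub>k\<close> lack half of their
  squared coefficients, and the best translation restores exactly that. Scaling sees only the mean
  of the sum of the \<open>u\<^sub>k\<close>, the mode of a dilation, so destabilizing rates are
  taken with sum zero; nonzero rates of this kind require at least two circles.\<close>

abbreviation torus_box :: "(real^'n::finite) set" where
  "torus_box \<equiv> cbox 0 (\<chi> k. 2 * pi)"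

text \<open>The box and its translate share the slab where the \<open>k\<close>-th coordinate runs
  from \<open>s\<close> to \<open>2 * pi\<close>. The leftover slabs, \<open>[0, s]\<close> below
  and its copy above \<open>2 * pi\<close>, differ by one full period. \<open>?c\<close> is the
  upper corner of the lower one.\<close>

lemma integral_torus_shift:
  fixes g :: "real^'n::finite \<Rightarrow> 'b::banach"
  assumes c: "continuous_on UNIV g" and p: "periodic_map g" and s: "0 \<le> s" "s \<le> 2 * pi"
  shows "integral torus_box (\<lambda>\<theta>. g (\<theta> + s *\<^sub>R axis k 1)) = integral torus_box g"
proof -
  let ?e = "axis k 1 :: real^'n"
  let ?b = "(\<chi> k. 2 * pi) :: real^'n"
  let ?c = "(\<chi> i. if i = k then s else 2 * pi) :: real^'n"
  have ax: "?e $ i = (if i = k then 1 else 0)" for i by (simp add: axis_def)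
  have ie: "x \<bullet> ?e = x $ k" for x by (simp add: inner_axis)
  have all: "(\<forall>i. P i) \<longleftrightarrow> P k \<and> (\<forall>i. i \<noteq> k \<longrightarrow> P i)" for P by metis
  have e: "?e \<in> Basis" by (simp add: axis_in_Basis_iff)
  have int: "g integrable_on cbox x y" for x y
    by (rule integrable_continuous) (use c continuous_on_subset in blast)
  have I1: "integral torus_box g = integral (cbox 0 ?c) g + integral (cbox (s *\<^sub>R ?e) ?b) g"
  proof -
    have "torus_box \<inter> {x. x \<bullet> ?e \<le> s} = cbox 0 ?c"
      using s unfolding set_eq_iff Int_iff mem_Collect_eq mem_box_cart all[where P="\<lambda>i. _ i \<le> _ i \<and> _ i"]
      by (auto simp: ax ie)
    moreover have "torus_box \<inter> {x. x \<bullet> ?e \<ge> s} = cbox (s *\<^sub>R ?e) ?b"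
      using s unfolding set_eq_iff Int_iff mem_Collect_eq mem_box_cart all[where P="\<lambda>i. _ i \<le> _ i \<and> _ i"]
      by (auto simp: ax ie)
    ultimately show ?thesis using integral_split[OF int e, of 0 ?b s] by simp
  qed
  have I2: "integral (cbox (s *\<^sub>R ?e) (?b + s *\<^sub>R ?e)) g
      = integral (cbox (s *\<^sub>R ?e) ?b) g + integral (cbox ((2*pi) *\<^sub>R ?e) (?c + (2*pi) *\<^sub>R ?e)) g"
  proof -
    have "cbox (s *\<^sub>R ?e) (?b + s *\<^sub>R ?e) \<inter> {x. x \<bullet> ?e \<le> 2*pi} = cbox (s *\<^sub>R ?e) ?b"
      using s unfolding set_eq_iff Int_iff mem_Collect_eq mem_box_cart all[where P="\<lambda>i. _ i \<le> _ i \<and> _ i"]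
      by (auto simp: ax ie)
    moreover have "cbox (s *\<^sub>R ?e) (?b + s *\<^sub>R ?e) \<inter> {x. x \<bullet> ?e \<ge> 2*pi} = cbox ((2*pi) *\<^sub>R ?e) (?c + (2*pi) *\<^sub>R ?e)"
      using s unfolding set_eq_iff Int_iff mem_Collect_eq mem_box_cart all[where P="\<lambda>i. _ i \<le> _ i \<and> _ i"]
      by (auto simp: ax ie)
    ultimately show ?thesis using integral_split[OF int e, of "s *\<^sub>R ?e" "?b + s *\<^sub>R ?e" "2*pi"] by simp
  qed
  have "integral (cbox ((2*pi) *\<^sub>R ?e) (?c + (2*pi) *\<^sub>R ?e)) g = integral (cbox 0 ?c) (\<lambda>\<theta>. g (\<theta> + (2*pi) *\<^sub>R ?e))"
    using integral_shift_cbox[of "(2*pi) *\<^sub>R ?e" "(2*pi) *\<^sub>R ?e" "?c + (2*pi) *\<^sub>R ?e" g] by simp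
  also have "\<dots> = integral (cbox 0 ?c) g" using p by (simp add: periodic_map_def)
  finally have I3: "integral (cbox ((2*pi) *\<^sub>R ?e) (?c + (2*pi) *\<^sub>R ?e)) g = integral (cbox 0 ?c) g" .
  have "integral torus_box (\<lambda>\<theta>. g (\<theta> + s *\<^sub>R ?e)) = integral (cbox (s *\<^sub>R ?e) (?b + s *\<^sub>R ?e)) g"
    using integral_shift_cbox[of "s *\<^sub>R ?e" "s *\<^sub>R ?e" "?b + s *\<^sub>R ?e" g] by simp
  then show ?thesis using I1 I2 I3 by simp
qed

text \<open>A relation bundling just what integration by parts on the torus consumes: continuity and
  periodicity of the function and its derivative, with differentiability along one coordinate line
  only. It is closed under sums, products and linear maps, so antiderivatives can be exhibited term
  by term.\<close>

definition has_pd :: "'n::finite \<Rightarrow> (real^'n \<Rightarrow> 'b::real_normed_vector) \<Rightarrow> (real^'n \<Rightarrow> 'b) \<Rightarrow> bool" where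
  "has_pd k g g' \<longleftrightarrow> continuous_on UNIV g \<and> continuous_on UNIV g' \<and> periodic_map g \<and> periodic_map g' \<and>
     (\<forall>\<theta>. ((\<lambda>s. g (\<theta> + s *\<^sub>R axis k 1)) has_vector_derivative g' \<theta>) (at 0))"

lemma has_pd_line:
  assumes "has_pd k g g'"
  shows "((\<lambda>s. g (\<theta> + s *\<^sub>R axis k 1)) has_vector_derivative g' (\<theta> + s *\<^sub>R axis k 1)) (at s)"
proof -
  have "((\<lambda>r. g ((\<theta> + s *\<^sub>R axis k 1) + r *\<^sub>R axis k 1)) has_vector_derivative g' (\<theta> + s *\<^sub>R axis k 1)) (at (s - s))"
    using assms by (simp add: has_pd_def)
  then have "(((\<lambda>r. g ((\<theta> + s *\<^sub>R axis k 1) + r *\<^sub>R axis k 1)) \<circ> (\<lambda>r. r - s)) has_vector_derivative 1 *\<^sub>R g' (\<theta> + s *\<^sub>R axis k 1)) (at s)"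
    by (intro vector_diff_chain_at) (auto intro!: derivative_eq_intros)
  then show ?thesis by (simp add: o_def algebra_simps)
qed

text \<open>Translation invariance replaces Fubini and the fundamental theorem: by
  \<open>integral_torus_shift\<close> the integral of the translates of \<open>g\<close> is constant
  in \<open>s\<close>, while differentiating under the integral sign at \<open>s = 0\<close>
  produces the integral of \<open>g'\<close>.\<close>

lemma integral_pd_zero:
  fixes g :: "real^'n::finite \<Rightarrow> 'b::banach"
  assumes "has_pd k g g'"
  shows "integral torus_box g' = 0"
proof -
  let ?f = "\<lambda>s \<theta>. g (\<theta> + s *\<^sub>R axis k 1)" and ?f' = "\<lambda>s \<theta>. g' (\<theta> + s *\<^sub>R axis k 1)"
  have cg: "continuous_on S g" and cg': "continuous_on S g'" for S
    using assms continuous_on_subset unfolding has_pd_def by blast+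
  \<comment> \<open>The derivative at 0 is taken within \<open>{0..2*pi}\<close>, the range of
    shifts that \<open>integral_torus_shift\<close> covers.\<close>
  have D1: "((\<lambda>s. integral torus_box (?f s)) has_vector_derivative integral torus_box (?f' 0)) (at 0 within {0..2*pi})"
  proof (rule leibniz_rule_vector_derivative)
    show "((\<lambda>s. ?f s \<theta>) has_vector_derivative ?f' s \<theta>) (at s within {0..2*pi})" for s \<theta>
      using has_pd_line[OF assms] has_vector_derivative_at_within by blast
    show "?f s integrable_on torus_box" for s
      by (intro integrable_continuous continuous_on_compose2[OF cg[of UNIV]] continuous_intros) auto
    show "continuous_on ({0..2 * pi} \<times> torus_box) (\<lambda>(s, \<theta>). ?f' s \<theta>)"
      unfolding split_beta
      by (intro continuous_on_compose2[OF cg'[of UNIV]] continuous_intros) auto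
  qed auto
  have D2: "((\<lambda>s. integral torus_box (?f s)) has_vector_derivative 0) (at 0 within {0..2*pi})"
    by (rule has_vector_derivative_transform[OF _ _ has_vector_derivative_const[of "integral torus_box g"]])
       (use assms integral_torus_shift in \<open>auto simp: has_pd_def\<close>)
  have "at 0 within {0..2*pi} \<noteq> bot" by (simp add: at_within_Icc_at_right)
  from vector_derivative_unique_within[OF this D1 D2] show ?thesis by simp
qed

lemma has_pd_bilinear:
  assumes "bounded_bilinear pr" "has_pd k f f'" "has_pd k g g'"
  shows "has_pd k (\<lambda>\<theta>. pr (f \<theta>) (g \<theta>)) (\<lambda>\<theta>. pr (f \<theta>) (g' \<theta>) + pr (f' \<theta>) (g \<theta>))"
proof -
  interpret bounded_bilinear pr by fact
  have "((\<lambda>s. pr (f (\<theta> + s *\<^sub>R axis k 1)) (g (\<theta> + s *\<^sub>R axis k 1))) has_vector_derivative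
     pr (f (\<theta> + 0 *\<^sub>R axis k 1)) (g' \<theta>) + pr (f' \<theta>) (g (\<theta> + 0 *\<^sub>R axis k 1))) (at 0)" for \<theta>
    by (rule has_vector_derivative) (use assms(2,3) in \<open>auto simp: has_pd_def\<close>)
  then show ?thesis using assms
    unfolding has_pd_def by (auto intro!: continuous_on_add continuous_on simp: periodic_map_def)
qed

lemma has_pd_linear:
  assumes "bounded_linear L" "has_pd k f f'"
  shows "has_pd k (\<lambda>\<theta>. L (f \<theta>)) (\<lambda>\<theta>. L (f' \<theta>))"
proof -
  have "((\<lambda>s. L (f (\<theta> + s *\<^sub>R axis k 1))) has_vector_derivative L (f' \<theta>)) (at 0)" for \<theta>
    by (rule bounded_linear.has_vector_derivative) (use assms in \<open>auto simp: has_pd_def\<close>)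
  then show ?thesis
    using assms unfolding has_pd_def
    by (auto simp: periodic_map_def intro: bounded_linear.continuous_on)
qed

lemma has_pd_cong:
  "has_pd k f f' \<Longrightarrow> (\<And>\<theta>. f' \<theta> = g' \<theta>) \<Longrightarrow> has_pd k f g'"
  by (metis ext)

lemma has_pd_const: "has_pd k (\<lambda>_. c) (\<lambda>_. 0)"
  by (auto simp: has_pd_def periodic_map_def)

lemma has_pd_add:
  "has_pd k f f' \<Longrightarrow> has_pd k g g' \<Longrightarrow> has_pd k (\<lambda>\<theta>. f \<theta> + g \<theta>) (\<lambda>\<theta>. f' \<theta> + g' \<theta>)"
  unfolding has_pd_def periodic_map_def
  by (auto intro!: continuous_intros has_vector_derivative_add)

lemma has_pd_diff:
  "has_pd k f f' \<Longrightarrow> has_pd k g g' \<Longrightarrow> has_pd k (\<lambda>\<theta>. f \<theta> - g \<theta>) (\<lambda>\<theta>. f' \<theta> - g' \<theta>)"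
  unfolding has_pd_def periodic_map_def
  by (auto intro!: continuous_intros has_vector_derivative_diff)

lemma integrable_torus: "continuous_on UNIV g \<Longrightarrow> g integrable_on torus_box"
  for g :: "real^'n::finite \<Rightarrow> 'b::banach"
  using continuous_on_subset integrable_continuous by blast

section \<open>Characters \<open>e^(i m . theta)\<close> of the torus and their
  orthogonality\<close>

definition chr :: "int^'n::finite \<Rightarrow> real^'n \<Rightarrow> complex" where
  "chr m \<theta> = cis (\<Sum>k\<in>UNIV. of_int (m $ k) * \<theta> $ k)"

lemma has_pd_chr: "has_pd i (chr m) (\<lambda>\<theta>. \<i> * of_int (m $ i) * chr m \<theta>)"
proof -
  have sh: "chr m (\<theta> + s *\<^sub>R axis j 1) = cis (of_int (m $ j) * s) * chr m \<theta>" for \<theta> s j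
  proof -
    have "(\<Sum>k\<in>UNIV. of_int (m $ k) * (\<theta> + s *\<^sub>R axis j 1) $ k)
        = (\<Sum>k\<in>UNIV. of_int (m $ k) * \<theta> $ k) + (\<Sum>k\<in>UNIV. if k = j then of_int (m $ k) * s else 0)"
      unfolding sum.distrib[symmetric] by (rule sum.cong) (auto simp: axis_def algebra_simps)
    then show ?thesis by (simp add: chr_def cis_mult add.commute)
  qed
  have per: "periodic_map (chr m)"
    by (simp add: periodic_map_def sh mult.commute[of _ "2 * pi"])
  have cont: "continuous_on UNIV (chr m)"
    unfolding chr_def cis_conv_exp by (intro continuous_intros)
  have "((\<lambda>s. chr m (\<theta> + s *\<^sub>R axis i 1)) has_vector_derivative \<i> * of_int (m $ i) * chr m \<theta>) (at 0)" for \<theta>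
  proof -
    have "((\<lambda>s. (\<lambda>z. exp (\<i> * of_int (m $ i) * z) * chr m \<theta>) (of_real s)) has_vector_derivative \<i> * of_int (m $ i) * chr m \<theta>) (at 0)"
      by (rule has_vector_derivative_real_field) (auto intro!: derivative_eq_intros)
    then show ?thesis by (simp add: sh cis_conv_exp mult.assoc)
  qed
  then show ?thesis
    using per cont by (auto simp: has_pd_def periodic_map_def intro!: continuous_intros)
qed

lemma chr_mult: "chr m \<theta> * chr m' \<theta> = chr (m + m') \<theta>"
  by (simp add: chr_def cis_mult sum.distrib[symmetric] algebra_simps)

lemma chr_cnj: "cnj (chr m \<theta>) = chr (- m) \<theta>"
  by (simp add: chr_def cis_cnj sum_negf)

lemma chr_0: "chr 0 \<theta> = 1"
  by (simp add: chr_def)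

lemma cis_eq_chr: "cis (\<theta> $ k) = chr (axis k 1) (\<theta>::real^'n::finite)"
proof -
  have "(\<Sum>j\<in>UNIV. of_int ((axis k 1::int^'n) $ j) * \<theta> $ j) = (\<Sum>j\<in>UNIV. if j = k then \<theta> $ j else 0)"
    by (rule sum.cong) (auto simp: axis_def)
  then show ?thesis by (simp add: chr_def)
qed

abbreviation torus_vol :: "'n::finite itself \<Rightarrow> real" where
  "torus_vol _ \<equiv> measure lborel (torus_box :: (real^'n) set)"

lemma torus_vol_pos: "torus_vol TYPE('n::finite) > 0"
  by (subst content_pos_lt_eq) (auto simp: Basis_vec_def inner_axis)

text \<open>A nontrivial character is, up to the nonzero factor \<open>\<i> * m $ i\<close>, its own
  derivative in some direction \<open>i\<close>, and derivatives integrate to zero.\<close>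

lemma integral_chr:
  "integral torus_box (chr m :: real^'n::finite \<Rightarrow> complex) = (if m = 0 then of_real (torus_vol TYPE('n)) else 0)"
proof (cases "m = 0")
  case True
  then have "chr m = (\<lambda>\<theta>::real^'n. 1)" by (auto simp: chr_0)
  then show ?thesis using True by (simp add: scaleR_conv_of_real)
next
  case False
  then obtain i where i: "m $ i \<noteq> 0" by (auto simp: vec_eq_iff)
  have "integral torus_box (\<lambda>\<theta>. (\<i> * of_int (m $ i)) * chr m \<theta>) = 0"
    using integral_pd_zero[OF has_pd_chr[of i m]] by simp
  then show ?thesis using i False by simp
qed

section \<open>Fourier coefficients and the spectral gap\<close>

lemma periodic_map_shift:
  fixes u :: "real^'n::finite \<Rightarrow> 'b"
  assumes p: "periodic_map u" and "finite A"
  shows "u (\<theta> + (\<Sum>k\<in>A. (2 * pi * of_int (j k)) *\<^sub>R axis k 1)) = u \<theta>"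
  using assms(2)
proof (induction A arbitrary: \<theta>)
  case (insert k A)
  have nat: "u (\<theta> + (2 * pi * real n) *\<^sub>R axis k 1) = u \<theta>" for n \<theta>
  proof (induction n)
    case (Suc n)
    have "u (\<theta> + (2 * pi * real (Suc n)) *\<^sub>R axis k 1) = u ((\<theta> + (2 * pi * real n) *\<^sub>R axis k 1) + (2 * pi) *\<^sub>R axis k 1)"
      by (simp add: algebra_simps)
    then show ?case using Suc p by (simp add: periodic_map_def)
  qed simp
  have int: "u (\<theta> + (2 * pi * of_int (j k)) *\<^sub>R axis k 1) = u \<theta>" for \<theta>
  proof (cases "j k \<ge> 0")
    case True
    then show ?thesis using nat[of \<theta> "nat (j k)"] by simp
  next
    case False
    \<comment> \<open>A negative multiple is undone by the positive one, applied at the already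
      shifted point.\<close>
    then show ?thesis
      using nat[of "\<theta> + (2 * pi * of_int (j k)) *\<^sub>R axis k 1" "nat (- j k)"] by (simp add: algebra_simps)
  qed
  have "u (\<theta> + (\<Sum>k\<in>insert k A. (2 * pi * of_int (j k)) *\<^sub>R axis k 1))
      = u ((\<theta> + (2 * pi * of_int (j k)) *\<^sub>R axis k 1) + (\<Sum>k\<in>A. (2 * pi * of_int (j k)) *\<^sub>R axis k 1))"
    using insert.hyps by (simp add: add.assoc)
  then show ?case using insert.IH int by simp
qed simp

text \<open>The fibres of \<open>clifford\<close> are cosets of the period lattice, so a periodic
  function descends to a function on the image of the torus in complex space. This lets
  Stone-Weierstrass be used there.\<close>

lemma periodic_map_clifford_cong:
  fixes u :: "real^'n::finite \<Rightarrow> 'b"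
  assumes p: "periodic_map u" and eq: "clifford \<theta> = clifford \<theta>'"
  shows "u \<theta> = u \<theta>'"
proof -
  have "cis (\<theta> $ k) = cis (\<theta>' $ k)" for k
    using eq by (simp add: clifford_def vec_eq_iff)
  then have "\<exists>n::int. \<theta> $ k = \<theta>' $ k + 2 * pi * n" for k
    using sin_cos_eq_iff[of "\<theta> $ k" "\<theta>' $ k"] by (simp add: complex_eq_iff)
  then obtain j :: "'n \<Rightarrow> int" where j: "\<And>k. \<theta> $ k = \<theta>' $ k + 2 * pi * j k" by metis
  have "(\<Sum>k\<in>UNIV. (2 * pi * of_int (j k)) *\<^sub>R (axis k 1 :: real^'n)) $ i = 2 * pi * j i" for i
  proof -
    have "(\<Sum>k\<in>UNIV. (2 * pi * of_int (j k)) *\<^sub>R (axis k 1 :: real^'n)) $ i = (\<Sum>k\<in>UNIV. if i = k then 2 * pi * j k else 0)"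
      unfolding sum_component by (rule sum.cong) (auto simp: axis_def)
    then show ?thesis by simp
  qed
  then have "\<theta> = \<theta>' + (\<Sum>k\<in>UNIV. (2 * pi * of_int (j k)) *\<^sub>R axis k 1)"
    using j by (simp add: vec_eq_iff)
  then show ?thesis using periodic_map_shift[OF p, of UNIV \<theta>' j] by simp
qed

section \<open>Trigonometric polynomials and their uniform density\<close>

definition trigpoly :: "(real^'n::finite \<Rightarrow> complex) \<Rightarrow> bool" where
  "trigpoly f \<longleftrightarrow> (\<exists>S a. finite S \<and> (\<forall>\<theta>. f \<theta> = (\<Sum>m\<in>S. a m * chr m \<theta>)))"

lemma trigpoly_chr: "trigpoly (\<lambda>\<theta>. c * chr m \<theta>)"
  unfolding trigpoly_def by (rule exI[of _ "{m}"], rule exI[of _ "\<lambda>_. c"]) simp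

lemma trigpoly_add:
  assumes "trigpoly f" "trigpoly g"
  shows "trigpoly (\<lambda>\<theta>. f \<theta> + g \<theta>)"
proof -
  obtain S a where S: "finite S" "\<And>\<theta>. f \<theta> = (\<Sum>m\<in>S. a m * chr m \<theta>)"
    using assms(1) unfolding trigpoly_def by blast
  obtain T b where T: "finite T" "\<And>\<theta>. g \<theta> = (\<Sum>m\<in>T. b m * chr m \<theta>)"
    using assms(2) unfolding trigpoly_def by blast
  have "f \<theta> + g \<theta> = (\<Sum>m\<in>S \<union> T. ((if m \<in> S then a m else 0) + (if m \<in> T then b m else 0)) * chr m \<theta>)" for \<theta>
  proof -
    have "f \<theta> = (\<Sum>m\<in>S \<union> T. (if m \<in> S then a m else 0) * chr m \<theta>)"
      unfolding S by (rule sum.mono_neutral_cong_left) (use S T in auto)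
    moreover have "g \<theta> = (\<Sum>m\<in>S \<union> T. (if m \<in> T then b m else 0) * chr m \<theta>)"
      unfolding T by (rule sum.mono_neutral_cong_left) (use S T in auto)
    ultimately show ?thesis by (simp add: sum.distrib[symmetric] distrib_right)
  qed
  then show ?thesis unfolding trigpoly_def using S T
    by (intro exI[of _ "S \<union> T"] exI[of _ "\<lambda>m. (if m \<in> S then a m else 0) + (if m \<in> T then b m else 0)"]) auto
qed

lemma trigpoly_sum:
  "(\<And>i. i \<in> I \<Longrightarrow> trigpoly (f i)) \<Longrightarrow> trigpoly (\<lambda>\<theta>. \<Sum>i\<in>I. f i \<theta>)"
proof (induction I rule: infinite_finite_induct)
  case (insert x F)
  then show ?case using trigpoly_add[of "f x" "\<lambda>\<theta>. \<Sum>i\<in>F. f i \<theta>"] by simp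
qed (use trigpoly_chr[of 0 0] in auto)

lemma trigpoly_mult:
  assumes "trigpoly f" "trigpoly g"
  shows "trigpoly (\<lambda>\<theta>. f \<theta> * g \<theta>)"
proof -
  obtain S a where S: "finite S" "\<And>\<theta>. f \<theta> = (\<Sum>m\<in>S. a m * chr m \<theta>)"
    using assms(1) unfolding trigpoly_def by blast
  obtain T b where T: "finite T" "\<And>\<theta>. g \<theta> = (\<Sum>m\<in>T. b m * chr m \<theta>)"
    using assms(2) unfolding trigpoly_def by blast
  have "f \<theta> * g \<theta> = (\<Sum>m\<in>S. \<Sum>m'\<in>T. (a m * b m') * chr (m + m') \<theta>)" for \<theta>
    unfolding S T sum_product by (simp add: chr_mult[symmetric] mult_ac)
  then show ?thesis by (simp add: trigpoly_sum trigpoly_chr)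
qed

text \<open>Every real coordinate of \<open>clifford\<close> combines the two characters with
  frequencies plus and minus \<open>axis k 1\<close>. Trigonometric polynomials form an algebra, so
  induction over the polynomial carries this through.\<close>

lemma trigpoly_real_polynomial_clifford:
  fixes g :: "complex^'n::finite \<Rightarrow> real"
  assumes "real_polynomial_function g"
  shows "trigpoly (\<lambda>\<theta>. of_real (g (clifford \<theta>)))"
  using assms
proof induction
  case (linear f)
  interpret f: bounded_linear f by fact
  have b: "trigpoly (\<lambda>\<theta>::real^'n. of_real (clifford \<theta> \<bullet> b) * c)" if "b \<in> Basis" for b c
  proof -
    from that obtain k z where b: "b = axis k z" by (auto simp: Basis_vec_def)
    have "of_real (clifford \<theta> \<bullet> b) * c = (of_real (sqrt 2 / 2) * cnj z * c) * chr (axis k 1) \<theta>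
        + (of_real (sqrt 2 / 2) * z * c) * chr (- axis k 1) \<theta>" for \<theta>
    proof -
      have "of_real (clifford \<theta> \<bullet> b) = (of_real (Re ((of_real (sqrt 2) * cis (\<theta> $ k)) * cnj z)) :: complex)"
        by (simp add: b inner_axis clifford_def inner_complex_def algebra_simps)
      also have "\<dots> = ((of_real (sqrt 2) * chr (axis k 1) \<theta>) * cnj z + cnj ((of_real (sqrt 2) * chr (axis k 1) \<theta>) * cnj z)) / 2"
        by (subst complex_add_cnj) (simp add: cis_eq_chr)
      finally show ?thesis by (simp add: chr_cnj field_simps)
    qed
    then show ?thesis by (simp only:) (intro trigpoly_add trigpoly_chr)
  qed
  have "of_real (f (clifford \<theta>)) = (\<Sum>b\<in>Basis. of_real (clifford \<theta> \<bullet> b) * complex_of_real (f b))" for \<theta> :: "real^'n"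
  proof -
    have "f (clifford \<theta>) = f (\<Sum>b\<in>Basis. (clifford \<theta> \<bullet> b) *\<^sub>R b)"
      by (simp add: euclidean_representation)
    then show ?thesis by (simp add: f.sum f.scaleR)
  qed
  then show ?case using b by (simp add: trigpoly_sum)
next
  case (const c)
  show ?case using trigpoly_chr[of "of_real c" 0] by (simp add: chr_0)
next
  case (add f g)
  then show ?case by (simp add: trigpoly_add)
next
  case (mult f g)
  then show ?case by (simp add: trigpoly_mult)
qed

lemma continuous_clifford: "continuous_on S clifford"
  unfolding clifford_def cis_conv_exp by (intro continuous_intros)

text \<open>The function is pushed down to the compact image of the torus, approximated there by a
  real polynomial in the ambient coordinates, and the polynomial is pulled back along
  \<open>clifford\<close>.\<close>

lemma trigpoly_dense:
  fixes u :: "real^'n::finite \<Rightarrow> real"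
  assumes c: "continuous_on UNIV u" and p: "periodic_map u" and e: "e > 0"
  obtains T where "trigpoly T" "\<And>\<theta>. \<theta> \<in> torus_box \<Longrightarrow> norm (of_real (u \<theta>) - T \<theta>) < e"
proof -
  let ?S = "clifford ` (torus_box :: (real^'n) set)"
  define f where "f z = u (inv_into torus_box clifford z)" for z
  have f: "f (clifford \<theta>) = u \<theta>" if "\<theta> \<in> torus_box" for \<theta>
    unfolding f_def
    by (rule periodic_map_clifford_cong[OF p]) (use that in \<open>simp add: f_inv_into_f\<close>)
  have S: "compact ?S" by (intro compact_continuous_image continuous_clifford compact_cbox)
  \<comment> \<open>Quotient map argument: the preimage under \<open>f\<close> of a closed set is
    the \<open>clifford\<close>-image of a compact set, hence closed. The arbitrary choice of
    preimages made by \<open>inv_into\<close> thus does no harm.\<close>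
  have "continuous_on ?S f"
    unfolding continuous_on_closed_vimage[OF compact_imp_closed[OF S]]
  proof (intro allI impI)
    fix B :: "real set" assume B: "closed B"
    have "closed (u -` B)" using c B by (simp add: continuous_on_closed_vimage)
    then have "compact (clifford ` (torus_box \<inter> u -` B))"
      by (intro compact_continuous_image continuous_clifford compact_Int_closed compact_cbox)
    moreover have "f -` B \<inter> ?S = clifford ` (torus_box \<inter> u -` B)"
      by (auto simp: f)
    ultimately show "closed (f -` B \<inter> ?S)" by (simp add: compact_imp_closed)
  qed
  then obtain g where g: "real_polynomial_function g" "\<And>x. x \<in> ?S \<Longrightarrow> \<bar>f x - g x\<bar> < e"
    using Stone_Weierstrass_real_polynomial_function[OF S _ e] by blast
  show thesis
  proof (rule that[OF trigpoly_real_polynomial_clifford[OF g(1)]])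
    fix \<theta> :: "real^'n" assume "\<theta> \<in> torus_box"
    then have "\<bar>u \<theta> - g (clifford \<theta>)\<bar> < e" using g(2) f by force
    then show "norm (complex_of_real (u \<theta>) - of_real (g (clifford \<theta>))) < e"
      by (metis norm_of_real of_real_diff)
  qed
qed

text \<open>Not normalized by the volume of the box, which is why \<open>torus_vol\<close> appears
  as a divisor in the estimates below.\<close>

definition fcoeff :: "(real^'n::finite \<Rightarrow> complex) \<Rightarrow> int^'n \<Rightarrow> complex" where
  "fcoeff u m = integral torus_box (\<lambda>\<theta>. u \<theta> * chr (- m) \<theta>)"

lemma continuous_chr: "continuous_on S (chr m)"
  using has_pd_chr[of undefined m] continuous_on_subset unfolding has_pd_def by blast

text \<open>Integration by parts: the derivative of \<open>u\<close> times the conjugate character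
  integrates to zero.\<close>

lemma fcoeff_pd:
  assumes "has_pd i u u'"
  shows "fcoeff u' m = \<i> * of_int (m $ i) * fcoeff u m"
proof -
  have cu: "continuous_on UNIV u" "continuous_on UNIV u'" using assms by (auto simp: has_pd_def)
  have "integral torus_box (\<lambda>\<theta>. u \<theta> * (\<i> * of_int ((- m) $ i) * chr (- m) \<theta>) + u' \<theta> * chr (- m) \<theta>) = 0"
    by (rule integral_pd_zero[OF has_pd_bilinear[OF bounded_bilinear_mult assms has_pd_chr[of i "- m"]]])
  also have "(\<lambda>\<theta>. u \<theta> * (\<i> * of_int ((- m) $ i) * chr (- m) \<theta>) + u' \<theta> * chr (- m) \<theta>)
     = (\<lambda>\<theta>. (- \<i> * of_int (m $ i)) * (u \<theta> * chr (- m) \<theta>) + u' \<theta> * chr (- m) \<theta>)"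
    by (auto simp: algebra_simps)
  also have "integral torus_box \<dots> = (- \<i> * of_int (m $ i)) * fcoeff u m + fcoeff u' m"
    unfolding fcoeff_def
    by (subst integral_add) (auto intro!: integrable_torus continuous_intros cu continuous_chr)
  finally show ?thesis by (simp add: algebra_simps)
qed

text \<open>Completing the square in the coefficients \<open>a\<close>. One identity serves two
  purposes: the choice \<open>a m = fcoeff u m / V\<close> gives Bessel's inequality, and discarding
  the last nonnegative sum for a good approximant gives the reverse bound up to an error.\<close>

lemma integral_norm_diff_trigpoly:
  fixes u :: "real^'n::finite \<Rightarrow> complex"
  assumes c: "continuous_on UNIV u" and S: "finite S"
  defines "V \<equiv> torus_vol TYPE('n)"
  shows "integral torus_box (\<lambda>\<theta>. (norm (u \<theta> - (\<Sum>m\<in>S. a m * chr m \<theta>)))\<^sup>2)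
    = integral torus_box (\<lambda>\<theta>. (norm (u \<theta>))\<^sup>2) - (\<Sum>m\<in>S. (norm (fcoeff u m))\<^sup>2) / V
      + V * (\<Sum>m\<in>S. (norm (a m - fcoeff u m / V))\<^sup>2)"
proof -
  let ?I = "integral torus_box :: (real^'n \<Rightarrow> complex) \<Rightarrow> complex"
  have V: "V > 0" unfolding V_def by (rule torus_vol_pos)
  define T where "T \<theta> = (\<Sum>m\<in>S. a m * chr m \<theta>)" for \<theta>
  have cT: "continuous_on UNIV T" unfolding T_def by (intro continuous_intros continuous_chr)
  note ci = continuous_intros c cT continuous_chr
  have re: "of_real (integral torus_box f) = ?I (\<lambda>\<theta>. of_real (f \<theta>))" if "continuous_on UNIV f" for f :: "real^'n \<Rightarrow> real"
    using integral_linear[OF integrable_torus[OF that], of complex_of_real] by (simp add: o_def bounded_linear_of_real)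
  have uT: "?I (\<lambda>\<theta>. u \<theta> * cnj (T \<theta>)) = (\<Sum>m\<in>S. cnj (a m) * fcoeff u m)"
  proof -
    have "?I (\<lambda>\<theta>. u \<theta> * cnj (T \<theta>)) = ?I (\<lambda>\<theta>. \<Sum>m\<in>S. cnj (a m) * (u \<theta> * chr (- m) \<theta>))"
      by (auto simp: T_def cnj_sum chr_cnj sum_distrib_left algebra_simps)
    also have "\<dots> = (\<Sum>m\<in>S. ?I (\<lambda>\<theta>. cnj (a m) * (u \<theta> * chr (- m) \<theta>)))"
      by (rule integral_sum) (use S in \<open>auto intro!: integrable_torus ci\<close>)
    finally show ?thesis by (simp add: fcoeff_def)
  qed
  have cTu: "?I (\<lambda>\<theta>. T \<theta> * cnj (u \<theta>)) = cnj (\<Sum>m\<in>S. cnj (a m) * fcoeff u m)"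
    unfolding uT[symmetric] integral_cnj by (simp add: mult.commute)
  have TT: "?I (\<lambda>\<theta>. T \<theta> * cnj (T \<theta>)) = of_real V * (\<Sum>m\<in>S. a m * cnj (a m))"
  proof -
    have "?I (\<lambda>\<theta>. T \<theta> * cnj (T \<theta>)) = ?I (\<lambda>\<theta>. \<Sum>m\<in>S. \<Sum>m'\<in>S. (a m * cnj (a m')) * chr (m - m') \<theta>)"
      unfolding T_def cnj_sum sum_product
      by (auto simp: chr_cnj chr_mult[of _ _ "- _", simplified, symmetric] mult_ac)
    also have "\<dots> = (\<Sum>m\<in>S. \<Sum>m'\<in>S. (a m * cnj (a m')) * ?I (chr (m - m')))"
      by (subst integral_sum integral_mult_right | use S in \<open>auto intro!: integrable_torus ci integrable_sum\<close>)+
    also have "\<dots> = (\<Sum>m\<in>S. \<Sum>m'\<in>S. if m' = m then a m * cnj (a m) * of_real V else 0)"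
      by (intro sum.cong) (auto simp: integral_chr V_def)
    finally show ?thesis using S by (simp add: sum_distrib_left mult_ac)
  qed
  have "complex_of_real (integral torus_box (\<lambda>\<theta>. (norm (u \<theta> - T \<theta>))\<^sup>2)) =
     ?I (\<lambda>\<theta>. (u \<theta> * cnj (u \<theta>) - u \<theta> * cnj (T \<theta>)) - (T \<theta> * cnj (u \<theta>) - T \<theta> * cnj (T \<theta>)))"
    by (subst re, intro ci, simp only: complex_norm_square) (simp add: algebra_simps)
  also have "\<dots> = (?I (\<lambda>\<theta>. u \<theta> * cnj (u \<theta>)) - ?I (\<lambda>\<theta>. u \<theta> * cnj (T \<theta>))) - (?I (\<lambda>\<theta>. T \<theta> * cnj (u \<theta>)) - ?I (\<lambda>\<theta>. T \<theta> * cnj (T \<theta>)))"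
    by (subst integral_diff | intro integrable_torus ci | rule refl)+
  also have "?I (\<lambda>\<theta>. u \<theta> * cnj (u \<theta>)) = of_real (integral torus_box (\<lambda>\<theta>. (norm (u \<theta>))\<^sup>2))"
    by (subst re, intro ci, simp only: complex_norm_square)
  finally have 1: "complex_of_real (integral torus_box (\<lambda>\<theta>. (norm (u \<theta> - T \<theta>))\<^sup>2)) =
     of_real (integral torus_box (\<lambda>\<theta>. (norm (u \<theta>))\<^sup>2)) - (\<Sum>m\<in>S. cnj (a m) * fcoeff u m)
     - (cnj (\<Sum>m\<in>S. cnj (a m) * fcoeff u m) - of_real V * (\<Sum>m\<in>S. a m * cnj (a m)))"
    unfolding uT cTu TT by simp
  have 2: "complex_of_real (- ((norm (fcoeff u m))\<^sup>2 / V) + V * (norm (a m - fcoeff u m / V))\<^sup>2)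
     = - cnj (a m) * fcoeff u m - a m * cnj (fcoeff u m) + of_real V * (a m * cnj (a m))" for m
  proof -
    have "complex_of_real (- ((norm (fcoeff u m))\<^sup>2 / V) + V * (norm (a m - fcoeff u m / V))\<^sup>2)
      = - (fcoeff u m * cnj (fcoeff u m) / of_real V)
        + of_real V * ((a m - fcoeff u m / of_real V) * cnj (a m - fcoeff u m / of_real V))"
      unfolding of_real_add of_real_minus of_real_divide of_real_mult complex_norm_square by simp
    also have "\<dots> = - cnj (a m) * fcoeff u m - a m * cnj (fcoeff u m) + of_real V * (a m * cnj (a m))"
      using V by (simp add: field_simps)
    finally show ?thesis .
  qed
  have "complex_of_real (integral torus_box (\<lambda>\<theta>. (norm (u \<theta> - T \<theta>))\<^sup>2)) =
     of_real (integral torus_box (\<lambda>\<theta>. (norm (u \<theta>))\<^sup>2)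
       + (\<Sum>m\<in>S. - ((norm (fcoeff u m))\<^sup>2 / V) + V * (norm (a m - fcoeff u m / V))\<^sup>2))"
    unfolding 1 of_real_add[of "integral _ _"] of_real_sum 2
    by (simp add: sum.distrib sum_negf sum_subtractf sum_distrib_left)
  then show ?thesis
    unfolding of_real_eq_iff T_def by (simp add: sum_subtractf sum_distrib_left sum_divide_distrib)
qed

lemma bessel:
  fixes u :: "real^'n::finite \<Rightarrow> complex"
  assumes "continuous_on UNIV u" "finite S"
  shows "(\<Sum>m\<in>S. (norm (fcoeff u m))\<^sup>2) / torus_vol TYPE('n) \<le> integral torus_box (\<lambda>\<theta>. (norm (u \<theta>))\<^sup>2)"
proof -
  have "0 \<le> integral torus_box (\<lambda>\<theta>. (norm (u \<theta> - (\<Sum>m\<in>S. fcoeff u m / torus_vol TYPE('n) * chr m \<theta>)))\<^sup>2)"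
    by (rule integral_nonneg) (auto intro!: integrable_torus continuous_intros assms continuous_chr
         simp: less_imp_neq[OF torus_vol_pos, symmetric])
  then show ?thesis
    unfolding integral_norm_diff_trigpoly[OF assms, of "\<lambda>m. fcoeff u m / torus_vol TYPE('n)"]
    using torus_vol_pos[where 'n='n] by simp
qed

text \<open>Parseval in a finite form: a uniform approximation within \<open>sqrt (e / V)\<close>
  has squared error at most \<open>e\<close> after integration. Together with \<open>bessel\<close>
  it allows mode-by-mode arguments without convergence of Fourier series.\<close>

lemma integral_norm_le_fourier:
  fixes u :: "real^'n::finite \<Rightarrow> real"
  assumes c: "continuous_on UNIV u" and p: "periodic_map u" and e: "e > 0"
  obtains S where "finite S"
    "integral torus_box (\<lambda>\<theta>. (u \<theta>)\<^sup>2) \<le> (\<Sum>m\<in>S. (norm (fcoeff (\<lambda>\<theta>. of_real (u \<theta>)) m))\<^sup>2) / torus_vol TYPE('n) + e"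
proof -
  let ?V = "torus_vol TYPE('n)"
  let ?u = "\<lambda>\<theta>. complex_of_real (u \<theta>)"
  have V: "?V > 0" by (rule torus_vol_pos)
  obtain T where T: "trigpoly T" "\<And>\<theta>. \<theta> \<in> torus_box \<Longrightarrow> norm (?u \<theta> - T \<theta>) < sqrt (e / ?V)"
    using trigpoly_dense[OF c p, of "sqrt (e / ?V)"] e V by auto
  obtain S a where S: "finite S" "\<And>\<theta>. T \<theta> = (\<Sum>m\<in>S. a m * chr m \<theta>)"
    using T(1) unfolding trigpoly_def by blast
  have cu: "continuous_on UNIV ?u" by (intro continuous_intros c)
  have "integral torus_box (\<lambda>\<theta>. (norm (?u \<theta> - T \<theta>))\<^sup>2) \<le> integral torus_box (\<lambda>\<theta>::real^'n. e / ?V)"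
  proof (rule integral_le)
    show "(\<lambda>\<theta>. (norm (?u \<theta> - T \<theta>))\<^sup>2) integrable_on torus_box"
      unfolding S by (intro integrable_torus continuous_intros cu continuous_chr)
    fix \<theta> :: "real^'n" assume "\<theta> \<in> torus_box"
    then have "(norm (?u \<theta> - T \<theta>))\<^sup>2 \<le> (sqrt (e / ?V))\<^sup>2"
      using T(2)[of \<theta>] by (intro power_mono) auto
    then show "(norm (?u \<theta> - T \<theta>))\<^sup>2 \<le> e / ?V" using e V by simp
  qed auto
  also have "\<dots> = e" using V by simp
  finally have "integral torus_box (\<lambda>\<theta>. (norm (?u \<theta> - T \<theta>))\<^sup>2) \<le> e" .
  moreover have "0 \<le> ?V * (\<Sum>m\<in>S. (norm (a m - fcoeff ?u m / ?V))\<^sup>2)"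
    using V by (intro mult_nonneg_nonneg sum_nonneg) auto
  ultimately have "integral torus_box (\<lambda>\<theta>. (norm (?u \<theta>))\<^sup>2) \<le> (\<Sum>m\<in>S. (norm (fcoeff ?u m))\<^sup>2) / ?V + e"
    unfolding S integral_norm_diff_trigpoly[OF cu S(1)] by linarith
  then show thesis using that[OF S(1)] by simp
qed

lemma int_vec_norm_ge_2:
  fixes m :: "int^'n::finite"
  assumes "m $ k \<noteq> 0" "m \<noteq> axis k 1" "m \<noteq> - axis k 1"
  shows "2 \<le> (\<Sum>i\<in>UNIV. (m $ i)\<^sup>2)"
proof (cases "\<exists>j. j \<noteq> k \<and> m $ j \<noteq> 0")
  case True
  then obtain j where j: "j \<noteq> k" "m $ j \<noteq> 0" by blast
  have "(m $ j)\<^sup>2 \<ge> 1" "(m $ k)\<^sup>2 \<ge> 1" using j assms(1)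
    by (metis int_one_le_iff_zero_less zero_less_power2)+
  then have "2 \<le> (\<Sum>i\<in>{j, k}. (m $ i)\<^sup>2)" using j by simp
  also have "\<dots> \<le> (\<Sum>i\<in>UNIV. (m $ i)\<^sup>2)" by (rule sum_mono2) auto
  finally show ?thesis .
next
  case False
  then have "m $ k \<noteq> 1" "m $ k \<noteq> -1"
    using assms(2,3) by (auto simp: vec_eq_iff axis_def split: if_splits)
  then have "\<bar>m $ k\<bar> \<ge> 2" using assms(1) by linarith
  then have "2 * 2 \<le> \<bar>m $ k\<bar> * \<bar>m $ k\<bar>" by (intro mult_mono) auto
  then have "2 \<le> (\<Sum>i\<in>{k}. (m $ i)\<^sup>2)" by (simp add: power2_eq_square)
  also have "\<dots> \<le> (\<Sum>i\<in>UNIV. (m $ i)\<^sup>2)" by (rule sum_mono2) auto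
  finally show ?thesis .
qed

text \<open>Being a \<open>k\<close>-th derivative, \<open>u\<close> has no frequency with
  \<open>m $ k = 0\<close>. For the others |m|^2 / 2 is at least 1, apart from plus and minus
  \<open>axis k 1\<close>, where it is one half. The cosine and sine integrals pay for these two.
  The derivative integrals are recovered from their coefficients by Bessel.\<close>

lemma torus_spectral_gap:
  fixes u H :: "real^'n::finite \<Rightarrow> real"
  assumes ui: "\<And>i. has_pd i u (u' i)" and H: "has_pd k H u"
  shows "integral torus_box (\<lambda>\<theta>. (u \<theta>)\<^sup>2)
     \<le> ((integral torus_box (\<lambda>\<theta>. u \<theta> * cos (\<theta> $ k)))\<^sup>2 + (integral torus_box (\<lambda>\<theta>. u \<theta> * sin (\<theta> $ k)))\<^sup>2) / torus_vol TYPE('n)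
       + (\<Sum>i\<in>UNIV. integral torus_box (\<lambda>\<theta>. (u' i \<theta>)\<^sup>2)) / 2"
    (is "?L \<le> (?b\<^sup>2 + ?d\<^sup>2) / ?V + ?R / 2")
proof (rule field_le_epsilon)
  fix e :: real assume e: "e > 0"
  let ?u = "\<lambda>\<theta>. complex_of_real (u \<theta>)"
  let ?c = "fcoeff ?u"
  have V: "?V > 0" by (rule torus_vol_pos)
  have c: "continuous_on UNIV u" "\<And>i. continuous_on UNIV (u' i)" and p: "periodic_map u"
    using ui by (auto simp: has_pd_def)
  obtain S where S: "finite S" and L: "?L \<le> (\<Sum>m\<in>S. (norm (?c m))\<^sup>2) / ?V + e"
    using integral_norm_le_fourier[OF c(1) p e] by blast
  have pd_of_real: "has_pd i (\<lambda>\<theta>. complex_of_real (f \<theta>)) (\<lambda>\<theta>. of_real (f' \<theta>))"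
    if "has_pd i f f'" for i f f' using has_pd_linear[OF bounded_linear_of_real that] .
  have c0: "?c m = 0" if "m $ k = 0" for m
    using fcoeff_pd[OF pd_of_real[OF H], of m] that by simp
  \<comment> \<open>As \<open>u\<close> is real, the coefficients at opposite frequencies are
    conjugate, so both exceptional modes have the same modulus; \<open>a\<close> is the
    sign.\<close>
  have rot: "(norm (integral torus_box (\<lambda>\<theta>. ?u \<theta> * cis (a * \<theta> $ k))))\<^sup>2 = ?b\<^sup>2 + ?d\<^sup>2" if "a = 1 \<or> a = -1" for a
  proof -
    have "continuous_on UNIV (\<lambda>\<theta>. ?u \<theta> * cis (a * \<theta> $ k))" unfolding cis_conv_exp by (intro continuous_intros c)
    note I = integrable_torus[OF this]
    have "Re (integral torus_box (\<lambda>\<theta>. ?u \<theta> * cis (a * \<theta> $ k))) = ?b"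
      using integral_linear[OF I bounded_linear_Re] that by (auto simp: o_def)
    moreover have "Im (integral torus_box (\<lambda>\<theta>. ?u \<theta> * cis (a * \<theta> $ k))) = a * ?d"
      using integral_linear[OF I bounded_linear_Im] that by (auto simp: o_def)
    ultimately show ?thesis using that by (auto simp: cmod_power2)
  qed
  have c1: "(norm (?c m))\<^sup>2 = ?b\<^sup>2 + ?d\<^sup>2" if "m = axis k 1 \<or> m = - axis k 1" for m
    using that rot[of 1] rot[of "-1"]
    by (auto simp: fcoeff_def cis_eq_chr[symmetric] chr_cnj[symmetric] cis_cnj)
  \<comment> \<open>The comparison is made for each mode separately; each exceptional mode receives
    the half of its squared coefficient that |m|^2 / 2 fails to supply.\<close>
  have "(\<Sum>m\<in>S. (norm (?c m))\<^sup>2) \<le> (\<Sum>m\<in>S. (\<Sum>i\<in>UNIV. (norm (fcoeff (\<lambda>\<theta>. of_real (u' i \<theta>)) m))\<^sup>2) / 2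
      + (if m = axis k 1 then (?b\<^sup>2 + ?d\<^sup>2) / 2 else 0) + (if m = - axis k 1 then (?b\<^sup>2 + ?d\<^sup>2) / 2 else 0))"
  proof (rule sum_mono)
    fix m assume "m \<in> S"
    have eq: "(\<Sum>i\<in>UNIV. (norm (fcoeff (\<lambda>\<theta>. of_real (u' i \<theta>)) m))\<^sup>2) = of_int (\<Sum>i\<in>UNIV. (m $ i)\<^sup>2) * (norm (?c m))\<^sup>2"
      by (simp add: fcoeff_pd[OF pd_of_real[OF ui]] norm_mult power_mult_distrib sum_distrib_right)
    have ax: "axis k (1::int) \<noteq> - axis k 1" by (auto simp: vec_eq_iff axis_def intro!: exI[of _ k])
    have s1: "(\<Sum>i\<in>UNIV. (m $ i)\<^sup>2) = 1" if "m = axis k 1 \<or> m = - axis k 1"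
    proof -
      have "(\<Sum>i\<in>UNIV. (m $ i)\<^sup>2) = (\<Sum>i\<in>UNIV. if i = k then 1 else 0)"
        by (rule sum.cong) (use that in \<open>auto simp: axis_def\<close>)
      then show ?thesis by simp
    qed
    show "(norm (?c m))\<^sup>2 \<le> (\<Sum>i\<in>UNIV. (norm (fcoeff (\<lambda>\<theta>. of_real (u' i \<theta>)) m))\<^sup>2) / 2
      + (if m = axis k 1 then (?b\<^sup>2 + ?d\<^sup>2) / 2 else 0) + (if m = - axis k 1 then (?b\<^sup>2 + ?d\<^sup>2) / 2 else 0)"
    proof (cases "m = axis k 1 \<or> m = - axis k 1")
      case True
      then show ?thesis unfolding eq using c1[OF True] s1[OF True] ax by auto
    next
      case False
      show ?thesis
      proof (cases "m $ k = 0")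
        case False
        then have "2 \<le> (\<Sum>i\<in>UNIV. (m $ i)\<^sup>2)" using int_vec_norm_ge_2 \<open>\<not> (m = _ \<or> _)\<close> by blast
        then have "2 \<le> real_of_int (\<Sum>i\<in>UNIV. (m $ i)\<^sup>2)" by linarith
        then have "2 * (norm (?c m))\<^sup>2 \<le> of_int (\<Sum>i\<in>UNIV. (m $ i)\<^sup>2) * (norm (?c m))\<^sup>2"
          by (intro mult_right_mono) simp_all
        then show ?thesis unfolding eq using \<open>\<not> (m = _ \<or> _)\<close> by auto
      qed (simp add: c0 eq)
    qed
  qed
  \<comment> \<open>Only an inequality, since \<open>S\<close> may miss one or both of the
    exceptional frequencies.\<close>
  also have "\<dots> \<le> (\<Sum>m\<in>S. \<Sum>i\<in>UNIV. (norm (fcoeff (\<lambda>\<theta>. of_real (u' i \<theta>)) m))\<^sup>2) / 2 + (?b\<^sup>2 + ?d\<^sup>2)"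
    using S by (simp add: sum.distrib sum_divide_distrib[symmetric])
  also have "(\<Sum>m\<in>S. \<Sum>i\<in>UNIV. (norm (fcoeff (\<lambda>\<theta>. of_real (u' i \<theta>)) m))\<^sup>2)
     = (\<Sum>i\<in>UNIV. \<Sum>m\<in>S. (norm (fcoeff (\<lambda>\<theta>. of_real (u' i \<theta>)) m))\<^sup>2)" by (rule sum.swap)
  also have "\<dots> \<le> (\<Sum>i\<in>UNIV. integral torus_box (\<lambda>\<theta>. (u' i \<theta>)\<^sup>2) * ?V)"
  proof (rule sum_mono)
    fix i
    have "continuous_on UNIV (\<lambda>\<theta>. complex_of_real (u' i \<theta>))" by (intro continuous_intros c)
    from bessel[OF this S] V show "(\<Sum>m\<in>S. (norm (fcoeff (\<lambda>\<theta>. of_real (u' i \<theta>)) m))\<^sup>2) \<le> integral torus_box (\<lambda>\<theta>. (u' i \<theta>)\<^sup>2) * ?V"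
      by (simp add: pos_divide_le_eq)
  qed
  finally have "(\<Sum>m\<in>S. (norm (?c m))\<^sup>2) \<le> ?R * ?V / 2 + (?b\<^sup>2 + ?d\<^sup>2)"
    by (simp add: sum_distrib_right)
  then have "(\<Sum>m\<in>S. (norm (?c m))\<^sup>2) / ?V \<le> ?R / 2 + (?b\<^sup>2 + ?d\<^sup>2) / ?V"
    using V by (simp add: field_simps)
  then show "?L \<le> (?b\<^sup>2 + ?d\<^sup>2) / ?V + ?R / 2 + e" using L by linarith
qed

section \<open>Determinants and second-order jets along a parameter\<close>

text \<open>The product rule in the permutation expansion, one row at a time. The outcome is again a
  sum of determinants, with no inverse matrix involved, so the rule can be applied a second time to
  its own result.\<close>

lemma det_has_derivative_rows:
  fixes M :: "real \<Rightarrow> real^'n::finite^'n"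
  assumes "\<And>i j. ((\<lambda>s. M s $ i $ j) has_real_derivative M' $ i $ j) (at x)"
  shows "((\<lambda>s. det (M s)) has_real_derivative (\<Sum>k\<in>UNIV. det (\<chi> i. if i = k then M' $ i else M x $ i))) (at x)"
proof -
  have eq: "(\<Prod>i\<in>UNIV. (if i = k then M' $ i else M x $ i) $ p i) = M' $ k $ p k * (\<Prod>i\<in>UNIV - {k}. M x $ i $ p i)" for k p
    by (subst prod.remove[of _ k]) auto
  have "((\<lambda>s. det (M s)) has_real_derivative
     (\<Sum>p | p permutes (UNIV::'n set). of_int (sign p) * (\<Sum>k\<in>UNIV. M' $ k $ p k * (\<Prod>i\<in>UNIV - {k}. M x $ i $ p i)))) (at x)"
    unfolding det_def
    by (intro DERIV_sum DERIV_cmult has_field_derivative_prod assms)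
  also have "(\<Sum>p | p permutes (UNIV::'n set). of_int (sign p) * (\<Sum>k\<in>UNIV. M' $ k $ p k * (\<Prod>i\<in>UNIV - {k}. M x $ i $ p i)))
     = (\<Sum>k\<in>UNIV. det (\<chi> i. if i = k then M' $ i else M x $ i))"
    unfolding det_def sum_distrib_left vec_lambda_beta eq by (rule sum.swap)
  finally show ?thesis .
qed

lemma continuous_on_det:
  fixes A :: "'a::topological_space \<Rightarrow> real^'n::finite^'n"
  assumes "\<And>i j. continuous_on S (\<lambda>x. A x $ i $ j)"
  shows "continuous_on S (\<lambda>x. det (A x))"
  unfolding det_def by (intro continuous_intros assms)

lemma det_mat: "det (mat c :: real^'n::finite^'n) = c ^ CARD('n)"
  by (subst det_diagonal) (auto simp: mat_def)

text \<open>Cramer's rule for the scalar matrix. The factor \<open>c\<close> on the left avoids the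
  exponent \<open>CARD('n) - 1\<close>; similarly \<open>c\<^sup>2\<close> in the two-row
  version.\<close>

lemma det_mat_row:
  fixes a :: "real^'n::finite"
  assumes "c \<noteq> 0"
  shows "c * det (\<chi> i. if i = k then a else mat c $ i) = a $ k * c ^ CARD('n)"
proof -
  have "(\<Sum>i\<in>UNIV. (a /\<^sub>R c) $ i *s row i (mat c)) = a"
  proof (rule vec_eq_iff[THEN iffD2], rule allI)
    fix j
    have "(\<Sum>i\<in>UNIV. (a /\<^sub>R c) $ i *s row i (mat c)) $ j = (\<Sum>i\<in>UNIV. if i = j then a $ j else 0)"
      unfolding sum_component by (rule sum.cong) (use assms in \<open>auto simp: row_def mat_def\<close>)
    then show "(\<Sum>i\<in>UNIV. (a /\<^sub>R c) $ i *s row i (mat c)) $ j = a $ j" by simp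
  qed
  then have "det (\<chi> i. if i = k then a else row i (mat c)) = (a /\<^sub>R c) $ k * c ^ CARD('n)"
    using cramer_lemma_transpose[of k "a /\<^sub>R c" "mat c"] by (simp only: det_mat)
  moreover have row: "row i (mat c) = mat c $ i" for i :: 'n by (simp add: row_def)
  ultimately show ?thesis using assms unfolding row by (simp add: field_simps)
qed

text \<open>Only the 2 by 2 minor in rows and columns \<open>k\<close>, \<open>l\<close> survives.
  When \<open>a $ k\<close> is nonzero, Cramer's rule for the matrix with row \<open>k\<close>
  already replaced reduces the claim to \<open>det_mat_row\<close>; the remaining case follows by
  additivity in that row.\<close>

lemma det_mat_two_rows:
  fixes a b :: "real^'n::finite"
  assumes c: "c \<noteq> 0" and kl: "k \<noteq> l"
  shows "c\<^sup>2 * det (\<chi> i. if i = l then b else if i = k then a else mat c $ i)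
     = (a $ k * b $ l - a $ l * b $ k) * c ^ CARD('n)"
proof -
  let ?A = "\<lambda>a. (\<chi> i. if i = k then a else mat c $ i) :: real^'n^'n"
  let ?D = "\<lambda>a. det (\<chi> i. if i = l then b else if i = k then a else mat c $ i)"
  have nz: "c\<^sup>2 * ?D a = (a $ k * b $ l - a $ l * b $ k) * c ^ CARD('n)" if a: "a $ k \<noteq> 0" for a
  proof -
    \<comment> \<open>The coefficients of \<open>b\<close> in terms of the rows of
      \<open>?A a\<close>: column \<open>k\<close> fixes the coefficient of row \<open>k\<close>,
      and the other rows are diagonal.\<close>
    define x where "x = (\<chi> i. if i = k then b $ k / a $ k else (b $ i - b $ k / a $ k * a $ i) / c)"
    have "(\<Sum>i\<in>UNIV. x $ i *s row i (?A a)) = b"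
    proof (rule vec_eq_iff[THEN iffD2], rule allI)
      fix j
      have "(\<Sum>i\<in>UNIV. x $ i *s row i (?A a)) $ j
         = x $ k * a $ j + (\<Sum>i\<in>UNIV - {k}. x $ i * row i (?A a) $ j)"
        unfolding sum_component by (subst sum.remove[of _ k]) (auto simp: row_def)
      also have "(\<Sum>i\<in>UNIV - {k}. x $ i * row i (?A a) $ j) = (\<Sum>i\<in>UNIV - {k}. if i = j then x $ j * c else 0)"
        by (rule sum.cong) (auto simp: row_def mat_def)
      also have "x $ k * a $ j + \<dots> = b $ j"
        using a c by (cases "j = k") (auto simp: x_def)
      finally show "(\<Sum>i\<in>UNIV. x $ i *s row i (?A a)) $ j = b $ j" .
    qed
    then have "det (\<chi> i. if i = l then b else row i (?A a)) = x $ l * det (?A a)"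
      using cramer_lemma_transpose[of l x "?A a"] by (simp only:)
    moreover have "(\<chi> i. if i = l then b else row i (?A a)) = (\<chi> i. if i = l then b else if i = k then a else mat c $ i)"
      by (auto simp: vec_eq_iff row_def)
    ultimately have "c\<^sup>2 * ?D a = (c * x $ l) * (c * det (?A a))" by (simp add: power2_eq_square)
    also have "c * x $ l = b $ l - b $ k / a $ k * a $ l" using c kl by (simp add: x_def)
    also have "c * det (?A a) = a $ k * c ^ CARD('n)" using det_mat_row[OF c, of k a] by simp
    also have "(b $ l - b $ k / a $ k * a $ l) * (a $ k * c ^ CARD('n)) = (a $ k * b $ l - a $ l * b $ k) * c ^ CARD('n)"
      using a by (simp add: field_simps)
    finally show ?thesis .
  qed
  show ?thesis
  proof (cases "a $ k = 0")
    case True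
    \<comment> \<open>Row \<open>k\<close> is brought to the outside so that additivity applies.
      Adding \<open>axis k 1\<close> makes the entry nonzero, and both \<open>a + axis k 1\<close>
      and \<open>axis k 1\<close> fall under the previous case.\<close>
    have swap: "(\<chi> i. if i = l then b else if i = k then a else mat c $ i) = (\<chi> i. if i = k then a else if i = l then b else mat c $ i)" for a
      using kl by (auto simp: vec_eq_iff)
    have "?D (a + axis k 1) = ?D a + ?D (axis k 1)"
      unfolding swap by (rule det_row_add)
    moreover have "c\<^sup>2 * ?D (a + axis k 1) = ((a + axis k 1) $ k * b $ l - (a + axis k 1) $ l * b $ k) * c ^ CARD('n)"
      by (rule nz) (simp add: True)
    moreover have "c\<^sup>2 * ?D (axis k 1) = (axis k 1 $ k * b $ l - axis k 1 $ l * b $ k) * c ^ CARD('n)"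
      by (rule nz) simp
    ultimately show ?thesis by (simp add: algebra_simps)
  qed (rule nz)
qed

text \<open>Two derivatives in the parameter with joint continuity of all three functions: the
  conditions for differentiating twice under an integral over a compact \<open>K\<close>. Carrying
  the derivatives explicitly lets the second derivative of the integrand be assembled by
  rules.\<close>

definition jet2 :: "real set \<Rightarrow> 'a::topological_space set \<Rightarrow> (real \<Rightarrow> 'a \<Rightarrow> 'b::real_normed_vector)
    \<Rightarrow> (real \<Rightarrow> 'a \<Rightarrow> 'b) \<Rightarrow> (real \<Rightarrow> 'a \<Rightarrow> 'b) \<Rightarrow> bool" where
  "jet2 U K f f1 f2 \<longleftrightarrow>
     (\<forall>s\<in>U. \<forall>\<theta>\<in>K. ((\<lambda>s. f s \<theta>) has_vector_derivative f1 s \<theta>) (at s) \<and>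
                    ((\<lambda>s. f1 s \<theta>) has_vector_derivative f2 s \<theta>) (at s)) \<and>
     continuous_on (U \<times> K) (\<lambda>p. f (fst p) (snd p)) \<and> continuous_on (U \<times> K) (\<lambda>p. f1 (fst p) (snd p)) \<and>
     continuous_on (U \<times> K) (\<lambda>p. f2 (fst p) (snd p))"

lemma jet2_add:
  "jet2 U K f f1 f2 \<Longrightarrow> jet2 U K g g1 g2 \<Longrightarrow>
   jet2 U K (\<lambda>s \<theta>. f s \<theta> + g s \<theta>) (\<lambda>s \<theta>. f1 s \<theta> + g1 s \<theta>) (\<lambda>s \<theta>. f2 s \<theta> + g2 s \<theta>)"
  by (auto simp: jet2_def intro!: continuous_intros has_vector_derivative_add)

lemma jet2_diff:
  "jet2 U K f f1 f2 \<Longrightarrow> jet2 U K g g1 g2 \<Longrightarrow>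
   jet2 U K (\<lambda>s \<theta>. f s \<theta> - g s \<theta>) (\<lambda>s \<theta>. f1 s \<theta> - g1 s \<theta>) (\<lambda>s \<theta>. f2 s \<theta> - g2 s \<theta>)"
  by (auto simp: jet2_def intro!: continuous_intros has_vector_derivative_diff)

lemma jet2_bilinear:
  assumes "bounded_bilinear pr" "jet2 U K f f1 f2" "jet2 U K g g1 g2"
  shows "jet2 U K (\<lambda>s \<theta>. pr (f s \<theta>) (g s \<theta>)) (\<lambda>s \<theta>. pr (f s \<theta>) (g1 s \<theta>) + pr (f1 s \<theta>) (g s \<theta>))
     (\<lambda>s \<theta>. (pr (f s \<theta>) (g2 s \<theta>) + pr (f1 s \<theta>) (g1 s \<theta>)) + (pr (f1 s \<theta>) (g1 s \<theta>) + pr (f2 s \<theta>) (g s \<theta>)))"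
proof -
  interpret bounded_bilinear pr by fact
  show ?thesis using assms(2,3)
    by (auto simp: jet2_def intro!: continuous_on_add continuous_on has_vector_derivative has_vector_derivative_add)
qed

lemma jet2_compose:
  fixes f :: "real \<Rightarrow> 'a::topological_space \<Rightarrow> real"
  assumes f: "jet2 U K f f1 f2" and fS: "\<And>s \<theta>. s \<in> U \<Longrightarrow> \<theta> \<in> K \<Longrightarrow> f s \<theta> \<in> S"
    and h: "\<And>x. x \<in> S \<Longrightarrow> (h has_real_derivative h1 x) (at x)"
    and h1: "\<And>x. x \<in> S \<Longrightarrow> (h1 has_real_derivative h2 x) (at x)"
    and h2: "continuous_on S h2"
  shows "jet2 U K (\<lambda>s \<theta>. h (f s \<theta>)) (\<lambda>s \<theta>. h1 (f s \<theta>) * f1 s \<theta>)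
     (\<lambda>s \<theta>. h2 (f s \<theta>) * (f1 s \<theta>)\<^sup>2 + h1 (f s \<theta>) * f2 s \<theta>)"
proof -
  have c: "continuous_on S h" "continuous_on S h1"
    using h h1 by (meson DERIV_continuous_on has_field_derivative_at_within)+
  have d: "((\<lambda>s. f s \<theta>) has_real_derivative f1 s \<theta>) (at s)" "((\<lambda>s. f1 s \<theta>) has_real_derivative f2 s \<theta>) (at s)"
    if "s \<in> U" "\<theta> \<in> K" for s \<theta>
    using f that by (auto simp: jet2_def has_real_derivative_iff_has_vector_derivative)
  have hf: "((\<lambda>s. h (f s \<theta>)) has_real_derivative h1 (f s \<theta>) * f1 s \<theta>) (at s)"
       "((\<lambda>s. h1 (f s \<theta>)) has_real_derivative h2 (f s \<theta>) * f1 s \<theta>) (at s)" if "s \<in> U" "\<theta> \<in> K" for s \<theta>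
    using that by (auto intro!: DERIV_chain2[OF h] DERIV_chain2[OF h1] d fS)
  moreover have "((\<lambda>s. h1 (f s \<theta>) * f1 s \<theta>) has_real_derivative h2 (f s \<theta>) * (f1 s \<theta>)\<^sup>2 + h1 (f s \<theta>) * f2 s \<theta>) (at s)"
    if "s \<in> U" "\<theta> \<in> K" for s \<theta>
    using DERIV_mult[OF hf(2) d(2), OF that that] by (simp add: power2_eq_square algebra_simps)
  moreover have "continuous_on (U \<times> K) (\<lambda>p. h (f (fst p) (snd p)))"
       "continuous_on (U \<times> K) (\<lambda>p. h1 (f (fst p) (snd p)))"
       "continuous_on (U \<times> K) (\<lambda>p. h2 (f (fst p) (snd p)))"
    using f by (auto intro!: continuous_on_compose2[OF c(1)] continuous_on_compose2[OF c(2)] continuous_on_compose2[OF h2] fS simp: jet2_def)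
  ultimately show ?thesis using f
    by (auto simp: jet2_def has_real_derivative_iff_has_vector_derivative[symmetric] intro!: continuous_intros)
qed

text \<open>In the double sum \<open>k\<close> is the row differentiated first and \<open>l\<close>
  the row differentiated second; for \<open>l = k\<close> the same row is hit twice and carries
  \<open>M2\<close>. The nested form is the one that \<open>det_has_derivative_rows\<close> yields
  when iterated.\<close>

lemma jet2_det:
  fixes M :: "real \<Rightarrow> 'a::topological_space \<Rightarrow> real^'n::finite^'n"
  assumes M: "\<And>i j. jet2 U K (\<lambda>s \<theta>. M s \<theta> $ i $ j) (\<lambda>s \<theta>. M1 s \<theta> $ i $ j) (\<lambda>s \<theta>. M2 s \<theta> $ i $ j)"
  shows "jet2 U K (\<lambda>s \<theta>. det (M s \<theta>))
     (\<lambda>s \<theta>. \<Sum>k\<in>UNIV. det (\<chi> i. if i = k then M1 s \<theta> $ i else M s \<theta> $ i))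
     (\<lambda>s \<theta>. \<Sum>k\<in>UNIV. \<Sum>l\<in>UNIV. det (\<chi> i. if i = l then (\<chi> i. if i = k then M2 s \<theta> $ i else M1 s \<theta> $ i) $ i
                                   else (\<chi> i. if i = k then M1 s \<theta> $ i else M s \<theta> $ i) $ i))"
proof -
  have d: "((\<lambda>s. M s \<theta> $ i $ j) has_real_derivative M1 s \<theta> $ i $ j) (at s)"
          "((\<lambda>s. M1 s \<theta> $ i $ j) has_real_derivative M2 s \<theta> $ i $ j) (at s)"
    if "s \<in> U" "\<theta> \<in> K" for s \<theta> i j
    using M[of i j] that by (auto simp: jet2_def has_real_derivative_iff_has_vector_derivative)
  have c: "continuous_on (U \<times> K) (\<lambda>p. M (fst p) (snd p) $ i $ j)"
    "continuous_on (U \<times> K) (\<lambda>p. M1 (fst p) (snd p) $ i $ j)"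
    "continuous_on (U \<times> K) (\<lambda>p. M2 (fst p) (snd p) $ i $ j)" for i j
    using M[of i j] by (auto simp: jet2_def)
  have c': "continuous_on (U \<times> K) (\<lambda>p. (if i = k then M1 (fst p) (snd p) $ i else M (fst p) (snd p) $ i) $ j)"
    "continuous_on (U \<times> K) (\<lambda>p. (if i = l then (\<chi> i. if i = k then M2 (fst p) (snd p) $ i else M1 (fst p) (snd p) $ i) $ i
        else (\<chi> i. if i = k then M1 (fst p) (snd p) $ i else M (fst p) (snd p) $ i) $ i) $ j)" for i j k l
    by (cases "i = k"; cases "i = l"; simp add: c)+
  show ?thesis
    unfolding jet2_def has_real_derivative_iff_has_vector_derivative[symmetric]
  proof (intro conjI ballI)
    fix s \<theta> assume s: "s \<in> U" "\<theta> \<in> K"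
    show "((\<lambda>s. det (M s \<theta>)) has_real_derivative (\<Sum>k\<in>UNIV. det (\<chi> i. if i = k then M1 s \<theta> $ i else M s \<theta> $ i))) (at s)"
      by (rule det_has_derivative_rows) (use d s in auto)
    show "((\<lambda>s. \<Sum>k\<in>UNIV. det (\<chi> i. if i = k then M1 s \<theta> $ i else M s \<theta> $ i)) has_real_derivative
      (\<Sum>k\<in>UNIV. \<Sum>l\<in>UNIV. det (\<chi> i. if i = l then (\<chi> i. if i = k then M2 s \<theta> $ i else M1 s \<theta> $ i) $ i
                                   else (\<chi> i. if i = k then M1 s \<theta> $ i else M s \<theta> $ i) $ i))) (at s)"
      by (intro DERIV_sum det_has_derivative_rows) (use d s in auto)
  qed (auto intro!: continuous_on_sum continuous_on_det c' simp: c)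
qed

text \<open>The outer \<open>deriv\<close> looks at \<open>deriv F\<close> near 0, not only at 0, so
  the first derivative is identified on the whole interval before differentiating again. An interval
  is enough, as the formula for \<open>F\<close> holds only while the integrand stays
  nondegenerate.\<close>

lemma deriv2_integral_jet2:
  fixes f :: "real \<Rightarrow> 'a::euclidean_space \<Rightarrow> real"
  assumes j: "jet2 {-d<..<d} (cbox a b) f f1 f2" and d: "d > 0"
    and F: "\<And>s. s \<in> {-d<..<d} \<Longrightarrow> F s = integral (cbox a b) (f s)"
  shows "deriv (deriv F) 0 = integral (cbox a b) (f2 0)"
proof -
  let ?U = "{-d<..<d}"
  have fi: "f s integrable_on cbox a b" "f1 s integrable_on cbox a b" if "s \<in> ?U" for s
  proof -
    have P: "continuous_on (cbox a b) (Pair s)" "Pair s ` cbox a b \<subseteq> ?U \<times> cbox a b"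
      by (intro continuous_intros) (use that in auto)
    have c: "continuous_on (?U \<times> cbox a b) (\<lambda>p. f (fst p) (snd p))" "continuous_on (?U \<times> cbox a b) (\<lambda>p. f1 (fst p) (snd p))"
      using j by (simp_all add: jet2_def)
    have "continuous_on (cbox a b) (f s)" "continuous_on (cbox a b) (f1 s)"
      using continuous_on_compose2[OF c(1) P] continuous_on_compose2[OF c(2) P] by simp_all
    then show "f s integrable_on cbox a b" "f1 s integrable_on cbox a b"
      by (auto intro: integrable_continuous)
  qed
  have lz: "((\<lambda>s. integral (cbox a b) (g s)) has_real_derivative integral (cbox a b) (g1 s)) (at s)"
    if s: "s \<in> ?U"
      and g: "\<And>s \<theta>. s \<in> ?U \<Longrightarrow> \<theta> \<in> cbox a b \<Longrightarrow> ((\<lambda>s. g s \<theta>) has_vector_derivative g1 s \<theta>) (at s)"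
      and gi: "\<And>s. s \<in> ?U \<Longrightarrow> g s integrable_on cbox a b"
      and g1: "continuous_on (?U \<times> cbox a b) (\<lambda>p. g1 (fst p) (snd p))" for s and g g1 :: "real \<Rightarrow> 'a \<Rightarrow> real"
  proof -
    have "((\<lambda>s. integral (cbox a b) (g s)) has_vector_derivative integral (cbox a b) (g1 s)) (at s within ?U)"
    proof (rule leibniz_rule_vector_derivative)
      show "continuous_on (?U \<times> cbox a b) (\<lambda>(x, t). g1 x t)" using g1 by (simp add: split_beta)
    qed (use g gi s in \<open>simp_all add: has_vector_derivative_at_within\<close>)
    then show ?thesis
      using at_within_open[OF s open_greaterThanLessThan]
      by (simp add: has_real_derivative_iff_has_vector_derivative)
  qed
  have D1: "((\<lambda>s. integral (cbox a b) (f s)) has_real_derivative integral (cbox a b) (f1 s)) (at s)" if "s \<in> ?U" for s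
    by (rule lz[OF that]) (use j fi in \<open>simp_all add: jet2_def\<close>)
  have D2: "((\<lambda>s. integral (cbox a b) (f1 s)) has_real_derivative integral (cbox a b) (f2 0)) (at 0)"
    by (rule lz) (use j fi d in \<open>simp_all add: jet2_def\<close>)
  have dF: "deriv F s = integral (cbox a b) (f1 s)" if "s \<in> ?U" for s
  proof (rule DERIV_imp_deriv)
    show "(F has_real_derivative integral (cbox a b) (f1 s)) (at s)"
      by (rule has_field_derivative_transform_within_open[OF D1[OF that], of ?U]) (use that F in auto)
  qed
  show ?thesis
  proof (rule DERIV_imp_deriv)
    show "(deriv F has_real_derivative integral (cbox a b) (f2 0)) (at 0)"
      by (rule has_field_derivative_transform_within_open[OF D2, of ?U]) (use d dF in auto)
  qed
qed

section \<open>Smooth maps\<close>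

text \<open>The direction comes first so that \<open>dird v f\<close> is again a map;
  \<open>iter_dirder\<close> is the iteration of this operator.\<close>

definition dird :: "'a::real_normed_vector \<Rightarrow> ('a \<Rightarrow> 'b::real_normed_vector) \<Rightarrow> 'a \<Rightarrow> 'b" where
  "dird v f = (\<lambda>x. frechet_derivative f (at x) v)"

lemma iter_dirder_append: "iter_dirder (vs @ ws) f = iter_dirder vs (iter_dirder ws f)"
  by (induction vs) auto

lemma smooth_map_dird: "smooth_map f \<Longrightarrow> smooth_map (dird v f)"
  unfolding smooth_map_def
proof (intro allI)
  fix vs x
  assume "\<forall>vs x. iter_dirder vs f differentiable at x"
  then have "iter_dirder (vs @ [v]) f differentiable at x" by blast
  then show "iter_dirder vs (dird v f) differentiable at x"
    by (simp only: iter_dirder_append iter_dirder.simps dird_def)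
qed

lemma smooth_map_differentiable: "smooth_map f \<Longrightarrow> f differentiable (at x)"
  unfolding smooth_map_def by (metis iter_dirder.simps(1))

lemma smooth_map_has_derivative: "smooth_map f \<Longrightarrow> (f has_derivative (\<lambda>v. dird v f x)) (at x)"
  unfolding dird_def using smooth_map_differentiable frechet_derivative_works by (metis eta_contract_eq)

lemma smooth_map_continuous: "smooth_map f \<Longrightarrow> continuous_on S f"
  by (meson smooth_map_differentiable differentiable_imp_continuous_within continuous_at_imp_continuous_on)

lemma dird_eqI: "(f has_derivative f') (at x) \<Longrightarrow> dird v f x = f' v"
  unfolding dird_def by (metis frechet_derivative_at)

lemma smooth_map_line:
  assumes "smooth_map f"
  shows "((\<lambda>s. f (x + s *\<^sub>R v)) has_vector_derivative dird v f (x + s *\<^sub>R v)) (at s)"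
proof -
  have d: "(f has_derivative (\<lambda>w. dird w f (x + s *\<^sub>R v))) (at (x + s *\<^sub>R v))"
    by (rule smooth_map_has_derivative[OF assms])
  have l: "((\<lambda>s. x + s *\<^sub>R v) has_derivative (\<lambda>h. h *\<^sub>R v)) (at s)"
    by (auto intro!: derivative_eq_intros)
  have "dird (h *\<^sub>R v) f (x + s *\<^sub>R v) = h *\<^sub>R dird v f (x + s *\<^sub>R v)" for h
    using has_derivative_linear[OF d] linear_scale by blast
  with has_derivative_compose[OF l d] show ?thesis by (simp add: has_vector_derivative_def)
qed

text \<open>Differentiate \<open>\<integral>\<^sub>0\<^sup>t D\<^sub>b f (x + \<sigma> a + \<tau> b) d\<tau> = f (x + \<sigma> a + t b) - f (x + \<sigma> a)\<close> first in \<open>\<sigma>\<close>, then in \<open>t\<close>.\<close>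

lemma dird_commute:
  fixes f :: "'a::real_normed_vector \<Rightarrow> 'b::banach"
  assumes f: "smooth_map f"
  shows "dird a (dird b f) x = dird b (dird a f) x"
proof -
  note c = smooth_map_continuous[OF smooth_map_dird[OF f]]
    smooth_map_continuous[OF smooth_map_dird[OF smooth_map_dird[OF f]]]
  let ?P = "\<lambda>\<sigma> \<tau>. x + \<sigma> *\<^sub>R a + \<tau> *\<^sub>R b"
  have ftc: "integral {0..t} (\<lambda>\<tau>. dird b f (?P \<sigma> \<tau>)) = f (?P \<sigma> t) - f (?P \<sigma> 0)" if "0 \<le> t" for \<sigma> t
    by (intro integral_unique fundamental_theorem_of_calculus)
       (use that smooth_map_line[OF f] in \<open>auto intro: has_vector_derivative_at_within\<close>)
  have eq: "dird a f (?P 0 t) - dird a f (?P 0 0) = integral {0..t} (\<lambda>\<tau>. dird a (dird b f) (?P 0 \<tau>))" if t: "0 \<le> t" for t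
  proof -
    have line: "((\<lambda>\<sigma>. g (?P \<sigma> \<tau>)) has_vector_derivative dird a g (?P \<sigma> \<tau>)) (at \<sigma>)" if "smooth_map g" for g :: "'a \<Rightarrow> 'b" and \<sigma> \<tau>
      using smooth_map_line[OF that, of "x + \<tau> *\<^sub>R b" a \<sigma>] by (simp add: algebra_simps)
    have "((\<lambda>\<sigma>. integral (cbox 0 t) (\<lambda>\<tau>. dird b f (?P \<sigma> \<tau>))) has_vector_derivative
        integral (cbox 0 t) (\<lambda>\<tau>. dird a (dird b f) (?P 0 \<tau>))) (at 0 within UNIV)"
    proof (rule leibniz_rule_vector_derivative)
      show "((\<lambda>\<sigma>. dird b f (?P \<sigma> \<tau>)) has_vector_derivative dird a (dird b f) (?P \<sigma> \<tau>)) (at \<sigma> within UNIV)" for \<sigma> \<tau>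
        using line[OF smooth_map_dird[OF f]] by simp
      show "(\<lambda>\<tau>. dird b f (?P \<sigma> \<tau>)) integrable_on cbox 0 t" for \<sigma>
        by (intro integrable_continuous continuous_on_compose2[OF c(1)[of UNIV]] continuous_intros) auto
      show "continuous_on (UNIV \<times> cbox 0 t) (\<lambda>(\<sigma>, \<tau>). dird a (dird b f) (?P \<sigma> \<tau>))"
        unfolding split_beta
        by (intro continuous_on_compose2[OF c(2)[of UNIV]] continuous_intros) auto
    qed auto
    moreover have "((\<lambda>\<sigma>. integral (cbox 0 t) (\<lambda>\<tau>. dird b f (?P \<sigma> \<tau>))) has_vector_derivative
        dird a f (?P 0 t) - dird a f (?P 0 0)) (at 0)"
      unfolding box_real ftc[OF t] by (intro has_vector_derivative_diff line f)
    ultimately show ?thesis using vector_derivative_unique_at by fastforce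
  qed
  have "((\<lambda>t. integral {0..t} (\<lambda>\<tau>. dird a (dird b f) (?P 0 \<tau>))) has_vector_derivative dird a (dird b f) (?P 0 0)) (at 0 within {0..1})"
    by (rule integral_has_vector_derivative)
       (auto intro!: continuous_on_compose2[OF c(2)[of UNIV]] continuous_intros)
  then have 1: "((\<lambda>t. dird a f (?P 0 t) - dird a f (?P 0 0)) has_vector_derivative dird a (dird b f) (?P 0 0)) (at 0 within {0..1})"
    by (rule has_vector_derivative_transform[rotated 2]) (use eq in simp_all)
  have 2: "((\<lambda>t. dird a f (?P 0 t) - dird a f (?P 0 0)) has_vector_derivative dird b (dird a f) (?P 0 0)) (at 0 within {0..1})"
    using has_vector_derivative_at_within[OF has_vector_derivative_diff[OF smooth_map_line[OF smooth_map_dird[OF f], of _ "?P 0 0" b 0] has_vector_derivative_const]]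
    by simp
  have "at (0::real) within {0..1} \<noteq> bot" by (simp add: at_within_Icc_at_right)
  from vector_derivative_unique_within[OF this 1 2] show ?thesis by simp
qed

section \<open>Periodic maps depending smoothly on a parameter\<close>

definition tper :: "(real \<times> (real^'n::finite) \<Rightarrow> 'b) \<Rightarrow> bool" where
  "tper f \<longleftrightarrow> (\<forall>s. periodic_map (\<lambda>\<theta>. f (s, \<theta>)))"

text \<open>Translation by a period leaves \<open>f\<close> unchanged, so the chain rule gives two
  expressions for the same derivative.\<close>

lemma tper_dird:
  fixes f :: "real \<times> (real^'n::finite) \<Rightarrow> 'b::real_normed_vector"
  assumes f: "smooth_map f" and p: "tper f"
  shows "tper (dird v f)"
  unfolding tper_def periodic_map_def
proof (intro allI)
  fix s \<theta> k
  let ?c = "(0, (2 * pi) *\<^sub>R axis k 1) :: real \<times> (real^'n)"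
  have "(\<lambda>q. f (q + ?c)) = f"
    using p by (auto simp: tper_def periodic_map_def fun_eq_iff)
  moreover have "((\<lambda>q. f (q + ?c)) has_derivative (\<lambda>v. dird v f ((s, \<theta>) + ?c))) (at (s, \<theta>))"
    by (rule has_derivative_compose[OF _ smooth_map_has_derivative[OF f]])
       (auto intro!: derivative_eq_intros)
  ultimately have "(f has_derivative (\<lambda>v. dird v f ((s, \<theta>) + ?c))) (at (s, \<theta>))" by (simp only:)
  from dird_eqI[OF this, of v] show "dird v f (s, \<theta> + (2 * pi) *\<^sub>R axis k 1) = dird v f (s, \<theta>)" by simp
qed

lemma smooth_has_pd:
  fixes f :: "real \<times> (real^'n::finite) \<Rightarrow> 'b::real_normed_vector"
  assumes "smooth_map f" "tper f"
  shows "has_pd i (\<lambda>\<theta>. f (s, \<theta>)) (\<lambda>\<theta>. dird (0, axis i 1) f (s, \<theta>))"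
proof -
  have "continuous_on UNIV (\<lambda>\<theta>. g (s, \<theta>))" if "smooth_map g" for g :: "_ \<Rightarrow> 'b"
    by (intro continuous_on_compose2[OF smooth_map_continuous[OF that, of UNIV]] continuous_intros) auto
  then show ?thesis
    using assms tper_dird[OF assms] smooth_map_line[OF assms(1), of "(s, _)" "(0, axis i 1)" 0]
    by (auto simp: has_pd_def tper_def smooth_map_dird)
qed

lemma pd_slice:
  assumes "smooth_map f"
  shows "pd i (\<lambda>\<theta>. f (s, \<theta>)) \<theta> = dird (0, axis i 1) f (s, \<theta>)"
proof -
  have "((\<lambda>\<theta>. f (s, \<theta>)) has_derivative (\<lambda>h. dird (0, h) f (s, \<theta>))) (at \<theta>)"
    by (rule has_derivative_compose[OF _ smooth_map_has_derivative[OF assms]])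
       (auto intro!: derivative_eq_intros)
  then show ?thesis using dird_eqI[of "\<lambda>\<theta>. f (s, \<theta>)"] by (simp add: pd_def dird_def)
qed

lemma smooth_jet2:
  fixes f :: "real \<times> 'c::real_normed_vector \<Rightarrow> 'b::real_normed_vector"
  assumes "smooth_map f"
  shows "jet2 U K (\<lambda>s \<theta>. f (s, \<theta>)) (\<lambda>s \<theta>. dird (1, 0) f (s, \<theta>)) (\<lambda>s \<theta>. dird (1, 0) (dird (1, 0) f) (s, \<theta>))"
proof -
  have 1: "((\<lambda>s. g (s, \<theta>)) has_vector_derivative dird (1, 0) g (s, \<theta>)) (at s)" if "smooth_map g" for g :: "_ \<Rightarrow> 'b" and s \<theta>
    using smooth_map_line[OF that, of "(0, \<theta>)" "(1, 0)" s] by simp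
  have 2: "continuous_on (U \<times> K) (\<lambda>p. g (fst p, snd p))" if "smooth_map g" for g :: "_ \<Rightarrow> 'b"
    using smooth_map_continuous[OF that] by simp
  show ?thesis unfolding jet2_def
    by (intro conjI ballI 1 2 smooth_map_dird assms)
qed

lemma smooth_jet2_curve:
  fixes x :: "real \<Rightarrow> 'b::real_normed_vector"
  assumes "smooth_map x"
  shows "jet2 U K (\<lambda>s \<theta>. x s) (\<lambda>s \<theta>. dird 1 x s) (\<lambda>s \<theta>. dird 1 (dird 1 x) s)"
proof -
  have "(g has_vector_derivative dird 1 g s) (at s)" if "smooth_map g" for g :: "real \<Rightarrow> 'b" and s
    using smooth_map_line[OF that, of 0 1 s] by simp
  moreover have "continuous_on (U \<times> K) (\<lambda>p. g (fst p))" if "smooth_map g" for g :: "real \<Rightarrow> 'b"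
    by (intro continuous_on_compose2[OF smooth_map_continuous[OF that, of UNIV]] continuous_intros) auto
  ultimately show ?thesis using assms unfolding jet2_def by (simp add: smooth_map_dird)
qed

section \<open>The second derivative of F at the Clifford torus\<close>

lemma det_jet1_mat:
  fixes A :: "real^'n::finite^'n"
  assumes "c \<noteq> 0"
  shows "(\<Sum>k\<in>UNIV. det (\<chi> i. if i = k then A $ i else mat c $ i)) = c ^ CARD('n) * (\<Sum>k\<in>UNIV. A $ k $ k) / c"
proof -
  have "det (\<chi> i. if i = k then A $ i else mat c $ i) = c ^ CARD('n) * A $ k $ k / c" for k
  proof -
    have "(\<chi> i. if i = k then A $ i else mat c $ i) = (\<chi> i. if i = k then A $ k else mat c $ i)"
      by (auto simp: vec_eq_iff)
    then show ?thesis using det_mat_row[OF assms, of k "A $ k"] assms by (simp add: field_simps)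
  qed
  then show ?thesis by (simp add: sum_distrib_left sum_divide_distrib)
qed

text \<open>The diagonal terms \<open>l = k\<close> contribute the trace of \<open>B\<close>, the
  others the 2 by 2 minors of \<open>A\<close>. Since the minor with \<open>l = k\<close> vanishes,
  the minors may be summed over all pairs, which gives (tr A)^2 - tr(A^2).\<close>

lemma det_jet2_mat:
  fixes A B :: "real^'n::finite^'n"
  assumes c: "c \<noteq> 0"
  shows "(\<Sum>k\<in>UNIV. \<Sum>l\<in>UNIV. det (\<chi> i. if i = l then (\<chi> i. if i = k then B $ i else A $ i) $ i
                                   else (\<chi> i. if i = k then A $ i else mat c $ i) $ i))
    = c ^ CARD('n) * ((\<Sum>k\<in>UNIV. B $ k $ k) / c
        + ((\<Sum>k\<in>UNIV. A $ k $ k)\<^sup>2 - (\<Sum>k\<in>UNIV. \<Sum>l\<in>UNIV. A $ k $ l * A $ l $ k)) / c\<^sup>2)"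
proof -
  have *: "det (\<chi> i. if i = l then (\<chi> i. if i = k then B $ i else A $ i) $ i
                                   else (\<chi> i. if i = k then A $ i else mat c $ i) $ i)
     = c ^ CARD('n) * ((if l = k then B $ k $ k / c else 0) + (A $ k $ k * A $ l $ l - A $ k $ l * A $ l $ k) / c\<^sup>2)"
    (is "det ?M = _") for k l
  proof (cases "l = k")
    case True
    then have "?M = (\<chi> i. if i = k then B $ k else mat c $ i)" by (auto simp: vec_eq_iff)
    then show ?thesis using det_mat_row[OF c, of k "B $ k"] c True by (simp add: field_simps)
  next
    case False
    then have "?M = (\<chi> i. if i = l then A $ l else if i = k then A $ k else mat c $ i)" by (auto simp: vec_eq_iff)
    then have "c\<^sup>2 * det ?M = (A $ k $ k * A $ l $ l - A $ k $ l * A $ l $ k) * c ^ CARD('n)"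
      using det_mat_two_rows[OF c, of k l "A $ l" "A $ k"] False by simp
    then have "det ?M = (A $ k $ k * A $ l $ l - A $ k $ l * A $ l $ k) * c ^ CARD('n) / c\<^sup>2"
      using c by (simp add: eq_divide_eq mult.commute)
    then show ?thesis using False by (simp add: mult.commute)
  qed
  show ?thesis
    unfolding * sum_distrib_left[symmetric]
    by (simp add: sum.distrib sum_subtractf sum_divide_distrib[symmetric] power2_eq_square sum_product)
qed

text \<open>The integrand is the exponential of a sum \<open>L\<close> of logarithms, so its second
  derivative is the integrand times L'' + L'^2. At \<open>t s = 1\<close> and
  \<open>N s \<theta> = 2 * n\<close>, the value of |x|^2 on the torus, the terms in
  \<open>t2\<close> cancel.\<close>

lemma log_integrand_jet:
  fixes t :: "real \<Rightarrow> real" and N D :: "real \<Rightarrow> 'a::topological_space \<Rightarrow> real"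
  assumes t: "jet2 U K (\<lambda>s \<theta>. t s) (\<lambda>s \<theta>. t1 s) (\<lambda>s \<theta>. t2 s)"
    and N: "jet2 U K N N1 N2" and D: "jet2 U K D D1 D2"
    and pos: "\<And>s. s \<in> U \<Longrightarrow> t s > 0" "\<And>s \<theta>. s \<in> U \<Longrightarrow> \<theta> \<in> K \<Longrightarrow> D s \<theta> > 0"
  obtains f f1 f2 where "jet2 U K f f1 f2"
    "\<And>s \<theta>. s \<in> U \<Longrightarrow> \<theta> \<in> K \<Longrightarrow>
       f s \<theta> = (4 * pi * t s) powr (- (n / 2)) * (exp (- N s \<theta> / (4 * t s)) * sqrt (D s \<theta>))"
    "\<And>s \<theta>. s \<in> U \<Longrightarrow> \<theta> \<in> K \<Longrightarrow> t s = 1 \<Longrightarrow> N s \<theta> = 2 * n \<Longrightarrow>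
       f2 s \<theta> = (4 * pi) powr (- (n / 2)) * (exp (- (n / 2)) * sqrt (D s \<theta>)) *
         ((- (n * (t1 s)\<^sup>2 / 2) - N2 s \<theta> / 4 + N1 s \<theta> * t1 s / 2
            + (D2 s \<theta> / D s \<theta> - (D1 s \<theta> / D s \<theta>)\<^sup>2) / 2)
          + (- N1 s \<theta> / 4 + D1 s \<theta> / (2 * D s \<theta>))\<^sup>2)"
proof -
  let ?P = "{0<..} :: real set"
  have A: "jet2 U K (\<lambda>s \<theta>. - (n / 2) * ln (4 * pi * t s)) (\<lambda>s \<theta>. (- (n / 2) / t s) * t1 s)
      (\<lambda>s \<theta>. ((n / 2) / (t s)\<^sup>2) * (t1 s)\<^sup>2 + (- (n / 2) / t s) * t2 s)"
    by (rule jet2_compose[OF t, where S="?P" and h="\<lambda>x. - (n / 2) * ln (4 * pi * x)" and ?h1.0="\<lambda>x. - (n / 2) / x" and ?h2.0="\<lambda>x. (n / 2) / x\<^sup>2"])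
       (use pos in \<open>auto intro!: derivative_eq_intros continuous_intros simp: field_simps power2_eq_square\<close>)
  have B: "jet2 U K (\<lambda>s \<theta>. 1 / (4 * t s)) (\<lambda>s \<theta>. (- 1 / (4 * (t s)\<^sup>2)) * t1 s)
      (\<lambda>s \<theta>. (1 / (2 * (t s) ^ 3)) * (t1 s)\<^sup>2 + (- 1 / (4 * (t s)\<^sup>2)) * t2 s)"
    by (rule jet2_compose[OF t, where S="?P" and h="\<lambda>x. 1 / (4 * x)" and ?h1.0="\<lambda>x. - 1 / (4 * x\<^sup>2)" and ?h2.0="\<lambda>x. 1 / (2 * x ^ 3)"])
       (use pos in \<open>auto intro!: derivative_eq_intros continuous_intros simp: field_simps power2_eq_square power3_eq_cube\<close>)
  have C: "jet2 U K (\<lambda>s \<theta>. ln (D s \<theta>) / 2) (\<lambda>s \<theta>. (1 / (2 * D s \<theta>)) * D1 s \<theta>)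
      (\<lambda>s \<theta>. (- 1 / (2 * (D s \<theta>)\<^sup>2)) * (D1 s \<theta>)\<^sup>2 + (1 / (2 * D s \<theta>)) * D2 s \<theta>)"
    by (rule jet2_compose[OF D, where S="?P" and h="\<lambda>x. ln x / 2" and ?h1.0="\<lambda>x. 1 / (2 * x)" and ?h2.0="\<lambda>x. - 1 / (2 * x\<^sup>2)"])
       (use pos in \<open>auto intro!: derivative_eq_intros continuous_intros simp: field_simps power2_eq_square\<close>)
  note L = jet2_add[OF jet2_diff[OF A jet2_bilinear[OF bounded_bilinear_mult N B]] C]
  note E = jet2_compose[OF L UNIV_I, of exp exp exp, OF DERIV_exp DERIV_exp continuous_on_exp[OF continuous_on_id]]
  have eq: "exp (- (n / 2) * ln (4 * pi * t s) - N s \<theta> * (1 / (4 * t s)) + ln (D s \<theta>) / 2)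
     = (4 * pi * t s) powr (- (n / 2)) * (exp (- N s \<theta> / (4 * t s)) * sqrt (D s \<theta>))" if "s \<in> U" "\<theta> \<in> K" for s \<theta>
  proof -
    have "sqrt (D s \<theta>) = exp (ln (D s \<theta>) / 2)"
      using pos(2)[OF that] by (simp add: powr_half_sqrt[symmetric] powr_def)
    then show ?thesis
      using pos(1)[OF that(1)] by (simp add: powr_def exp_add[symmetric] exp_diff[symmetric] algebra_simps)
  qed
  show thesis
  proof (rule that[OF E])
    fix s \<theta> assume s: "s \<in> U" "\<theta> \<in> K"
    show "exp (- (n / 2) * ln (4 * pi * t s) - N s \<theta> * (1 / (4 * t s)) + ln (D s \<theta>) / 2)
      = (4 * pi * t s) powr (- (n / 2)) * (exp (- N s \<theta> / (4 * t s)) * sqrt (D s \<theta>))" by (rule eq[OF s])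
  next
    fix s \<theta> assume s: "s \<in> U" "\<theta> \<in> K" "t s = 1" "N s \<theta> = 2 * n"
    have D0: "D s \<theta> \<noteq> 0" using pos(2)[OF s(1,2)] by simp
    \<comment> \<open>The two contributions of \<open>t1\<close> cancel because
      \<open>N s \<theta> / 4 = n / 2\<close>: the torus is critical under rescaling, already
      pointwise.\<close>
    have a: "- (n / 2) / t s * t1 s - (N s \<theta> * (- 1 / (4 * (t s)\<^sup>2) * t1 s) + N1 s \<theta> * (1 / (4 * t s))) + 1 / (2 * D s \<theta>) * D1 s \<theta>
       = - N1 s \<theta> / 4 + D1 s \<theta> / (2 * D s \<theta>)"
      using s D0 by (simp add: field_simps)
    have b: "n / 2 / (t s)\<^sup>2 * (t1 s)\<^sup>2 + - (n / 2) / t s * t2 s -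
      (N s \<theta> * (1 / (2 * t s ^ 3) * (t1 s)\<^sup>2 + - 1 / (4 * (t s)\<^sup>2) * t2 s) + N1 s \<theta> * (- 1 / (4 * (t s)\<^sup>2) * t1 s)
        + (N1 s \<theta> * (- 1 / (4 * (t s)\<^sup>2) * t1 s) + N2 s \<theta> * (1 / (4 * t s)))) +
      (- 1 / (2 * (D s \<theta>)\<^sup>2) * (D1 s \<theta>)\<^sup>2 + 1 / (2 * D s \<theta>) * D2 s \<theta>)
      = - (n * (t1 s)\<^sup>2 / 2) - N2 s \<theta> / 4 + N1 s \<theta> * t1 s / 2
            + (D2 s \<theta> / D s \<theta> - (D1 s \<theta> / D s \<theta>)\<^sup>2) / 2"
      using s D0 by (simp add: field_simps power2_eq_square)
    have e: "exp (- (n / 2) * ln (4 * pi * t s) - N s \<theta> * (1 / (4 * t s)) + ln (D s \<theta>) / 2)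
      = (4 * pi) powr (- (n / 2)) * (exp (- (n / 2)) * sqrt (D s \<theta>))"
      unfolding eq[OF s(1,2)] using s by simp
    show "exp (- (n / 2) * ln (4 * pi * t s) - N s \<theta> * (1 / (4 * t s)) + ln (D s \<theta>) / 2) *
      (- (n / 2) / t s * t1 s - (N s \<theta> * (- 1 / (4 * (t s)\<^sup>2) * t1 s) + N1 s \<theta> * (1 / (4 * t s))) + 1 / (2 * D s \<theta>) * D1 s \<theta>)\<^sup>2 +
      exp (- (n / 2) * ln (4 * pi * t s) - N s \<theta> * (1 / (4 * t s)) + ln (D s \<theta>) / 2) *
      (n / 2 / (t s)\<^sup>2 * (t1 s)\<^sup>2 + - (n / 2) / t s * t2 s -
      (N s \<theta> * (1 / (2 * t s ^ 3) * (t1 s)\<^sup>2 + - 1 / (4 * (t s)\<^sup>2) * t2 s) + N1 s \<theta> * (- 1 / (4 * (t s)\<^sup>2) * t1 s)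
        + (N1 s \<theta> * (- 1 / (4 * (t s)\<^sup>2) * t1 s) + N2 s \<theta> * (1 / (4 * t s)))) +
      (- 1 / (2 * (D s \<theta>)\<^sup>2) * (D1 s \<theta>)\<^sup>2 + 1 / (2 * D s \<theta>) * D2 s \<theta>)) =
      (4 * pi) powr (- (n / 2)) * (exp (- (n / 2)) * sqrt (D s \<theta>)) *
         ((- (n * (t1 s)\<^sup>2 / 2) - N2 s \<theta> / 4 + N1 s \<theta> * t1 s / 2
            + (D2 s \<theta> / D s \<theta> - (D1 s \<theta> / D s \<theta>)\<^sup>2) / 2)
          + (- N1 s \<theta> / 4 + D1 s \<theta> / (2 * D s \<theta>))\<^sup>2)"
      unfolding a b e by (simp add: distrib_left add.commute)
  qed
qed

lemma clifford_nth: "clifford \<theta> $ k = of_real (sqrt 2) * chr (axis k 1) \<theta>"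
  by (simp add: clifford_def cis_eq_chr)

lemma norm_chr [simp]: "norm (chr m \<theta>) = 1"
  by (simp add: chr_def)

lemma clifford_inner_self: "clifford \<theta> \<bullet> (clifford \<theta> :: complex^'n::finite) = 2 * CARD('n)"
  by (simp add: inner_vec_def clifford_nth power2_norm_eq_inner[symmetric] norm_mult power_mult_distrib)

text \<open>Used to keep the scale and the Gram determinant positive for small parameters uniformly
  over the torus, so that the logarithms can be differentiated there.\<close>

lemma tube_interval:
  fixes g :: "real \<times> 'a::topological_space \<Rightarrow> real"
  assumes g: "continuous_on UNIV g" and K: "compact K" and pos: "\<And>\<theta>. \<theta> \<in> K \<Longrightarrow> g (0, \<theta>) > 0"
  obtains d where "d > 0" "\<And>s \<theta>. s \<in> {-d<..<d} \<Longrightarrow> \<theta> \<in> K \<Longrightarrow> g (s, \<theta>) > 0"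
proof -
  let ?W = "{p. g p > 0}"
  have "open ?W" by (intro open_Collect_less continuous_intros g)
  moreover have "{0} \<times> K \<subseteq> ?W" using pos by auto
  ultimately obtain U W where U: "open U" "0 \<in> U" "K \<subseteq> W" "U \<times> W \<subseteq> ?W"
    using tube_lemma_right[of euclidean euclidean ?W K 0] K by (auto simp: euclidean_product_topology)
  obtain d where d: "d > 0" "ball 0 d \<subseteq> U" using U open_contains_ball by blast
  show thesis
  proof (rule that[OF d(1)])
    fix s \<theta> assume s: "s \<in> {-d<..<d}" "\<theta> \<in> K"
    then have "s \<in> U" using d(2) by (auto simp: dist_real_def abs_less_iff subset_iff)
    with s U have "(s, \<theta>) \<in> ?W" by blast
    then show "g (s, \<theta>) > 0" by simp
  qed
qed

section \<open>Smoothness of constant and linear maps and of the destabilizing variation\<close>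

lemma dird_const: "dird v (\<lambda>_. c) = (\<lambda>_. 0)"
  by (rule ext, rule trans[OF dird_eqI[OF has_derivative_const]]) simp

lemma smooth_map_const: "smooth_map (\<lambda>_. c)"
proof -
  have "\<exists>d. iter_dirder vs (\<lambda>_. c) = (\<lambda>_. d)" for vs :: "'a list"
    by (induction vs) (auto simp: dird_const[unfolded dird_def])
  then show ?thesis unfolding smooth_map_def by (metis differentiable_const)
qed

lemma smooth_map_linear:
  fixes f :: "'a::real_normed_vector \<Rightarrow> 'b::real_normed_vector"
  assumes "bounded_linear f"
  shows "smooth_map f"
  unfolding smooth_map_def
proof (intro allI)
  fix vs x
  show "iter_dirder vs f differentiable at x"
  \<comment> \<open>The last entry of \<open>vs\<close> is the direction applied first; after it a
    linear map has become constant.\<close>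
  proof (cases vs rule: rev_cases)
    case Nil
    then show ?thesis using assms by (simp add: bounded_linear_imp_differentiable)
  next
    case (snoc ws v)
    have "(\<lambda>x. frechet_derivative f (at x) v) = (\<lambda>_. f v)"
      using dird_eqI[OF bounded_linear_imp_has_derivative[OF assms]] by (auto simp: dird_def)
    moreover have "smooth_map (\<lambda>_::'a. f v)" by (rule smooth_map_const)
    ultimately show ?thesis
      unfolding snoc by (simp add: iter_dirder_append smooth_map_def)
  qed
qed

text \<open>The radius variation embedded in a family closed under directional derivatives, which makes smoothness immediate.\<close>

definition twist :: "('n \<Rightarrow> complex) \<Rightarrow> ('n \<Rightarrow> complex) \<Rightarrow> real \<times> (real^'n::finite) \<Rightarrow> complex^'n" where
  "twist \<alpha> \<beta> p = (\<chi> k. (\<alpha> k + \<beta> k * of_real (fst p)) * cis (snd p $ k))"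

lemma has_derivative_vec_lambda:
  fixes f :: "'n::finite \<Rightarrow> 'a::real_normed_vector \<Rightarrow> complex"
  assumes "\<And>k. (f k has_derivative f' k) (at p)"
  shows "((\<lambda>p. \<chi> k. f k p) has_derivative (\<lambda>q. \<chi> k. f' k q)) (at p)"
proof -
  have ax: "bounded_linear (axis k :: complex \<Rightarrow> complex^'n)" for k
    unfolding linear_conv_bounded_linear[symmetric]
    by (rule linearI) (auto simp: axis_def vec_eq_iff)
  have eq: "(\<chi> k. g k) = (\<Sum>k\<in>UNIV. axis k (g k))" for g :: "'n \<Rightarrow> complex"
    by (simp add: vec_eq_iff sum_component axis_def)
  show ?thesis
    unfolding eq by (intro has_derivative_sum bounded_linear.has_derivative[OF ax] assms)
qed

text \<open>An angular direction multiplies the factor by \<open>\<i>\<close> times its component,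
  the parameter direction extracts \<open>\<beta>\<close>; either way the amplitude remains affine
  in the parameter.\<close>

lemma twist_has_derivative:
  "(twist \<alpha> \<beta> has_derivative (\<lambda>q. twist (\<lambda>k. \<beta> k * of_real (fst q) + \<alpha> k * \<i> * of_real (snd q $ k)) (\<lambda>k. \<beta> k * \<i> * of_real (snd q $ k)) p)) (at p)"
  for p :: "real \<times> (real^'n::finite)"
proof -
  have d: "((\<lambda>p. (\<alpha> k + \<beta> k * of_real (fst p)) * exp (\<i> * of_real (snd p $ k))) has_derivative
      (\<lambda>q. (\<beta> k * of_real (fst q) + \<alpha> k * \<i> * of_real (snd q $ k) + \<beta> k * \<i> * of_real (snd q $ k) * of_real (fst p)) * exp (\<i> * of_real (snd p $ k)))) (at p)" for k
  proof -
    have "bounded_linear (\<lambda>p::real \<times> (real^'n). of_real (snd p $ k) :: complex)"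
      by (intro bounded_linear_compose[OF bounded_linear_of_real] bounded_linear_compose[OF bounded_linear_vec_nth] bounded_linear_snd)
    then have 1: "((\<lambda>p::real \<times> (real^'n). of_real (snd p $ k) :: complex) has_derivative (\<lambda>q. of_real (snd q $ k))) (at p)"
      by (rule bounded_linear_imp_has_derivative)
    have "bounded_linear (\<lambda>p::real \<times> (real^'n). of_real (fst p) :: complex)"
      by (intro bounded_linear_compose[OF bounded_linear_of_real] bounded_linear_fst)
    then have 2: "((\<lambda>p::real \<times> (real^'n). of_real (fst p) :: complex) has_derivative (\<lambda>q. of_real (fst q))) (at p)"
      by (rule bounded_linear_imp_has_derivative)
    have "((\<lambda>z. exp (\<i> * z)) has_derivative (*) (\<i> * exp (\<i> * of_real (snd p $ k)))) (at (of_real (snd p $ k)))"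
      unfolding has_field_derivative_def[symmetric] by (auto intro!: derivative_eq_intros)
    from has_derivative_compose[OF 1 this]
    have 3: "((\<lambda>p. exp (\<i> * of_real (snd p $ k))) has_derivative (\<lambda>q. \<i> * exp (\<i> * of_real (snd p $ k)) * of_real (snd q $ k))) (at p)" .
    show ?thesis
      by (rule has_derivative_eq_rhs[OF has_derivative_mult[OF has_derivative_add[OF has_derivative_const has_derivative_mult_right[OF 2]] 3]])
         (auto simp: algebra_simps)
  qed
  show ?thesis
    unfolding twist_def[abs_def] cis_conv_exp by (rule has_derivative_vec_lambda) (rule d)
qed

lemma smooth_map_twist: "smooth_map (twist \<alpha> \<beta> :: real \<times> (real^'n::finite) \<Rightarrow> complex^'n)"
proof -
  have "\<exists>\<alpha>' \<beta>'. iter_dirder vs (twist \<alpha> \<beta>) = twist \<alpha>' \<beta>'" for vs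
  proof (induction vs)
    case (Cons v vs)
    then obtain \<alpha>' \<beta>' where "iter_dirder vs (twist \<alpha> \<beta>) = twist \<alpha>' \<beta>'" by blast
    then have "iter_dirder (v # vs) (twist \<alpha> \<beta>) = dird v (twist \<alpha>' \<beta>')" by (simp add: dird_def)
    also have "\<dots> = twist (\<lambda>k. \<beta>' k * of_real (fst v) + \<alpha>' k * \<i> * of_real (snd v $ k)) (\<lambda>k. \<beta>' k * \<i> * of_real (snd v $ k))"
      by (rule ext) (rule dird_eqI[OF twist_has_derivative])
    finally show ?case by blast
  qed auto
  moreover have "twist \<alpha>' \<beta>' differentiable at x" for \<alpha>' \<beta>' and x :: "real \<times> (real^'n)"
    using twist_has_derivative differentiableI by blast
  ultimately show ?thesis
    unfolding smooth_map_def by metis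
qed

section \<open>Pointwise algebra of the second variation\<close>

lemma sum_delta_sq:
  fixes a :: "'n::finite \<Rightarrow> 'n \<Rightarrow> real"
  shows "(\<Sum>i\<in>UNIV. \<Sum>k\<in>UNIV. (a i k + (if i = k then b k else 0))\<^sup>2)
    = (\<Sum>i\<in>UNIV. \<Sum>k\<in>UNIV. (a i k)\<^sup>2) + (\<Sum>k\<in>UNIV. 2 * a k k * b k + (b k)\<^sup>2)"
proof -
  have "(\<Sum>i\<in>UNIV. \<Sum>k\<in>UNIV. (a i k + (if i = k then b k else 0))\<^sup>2)
     = (\<Sum>i\<in>UNIV. \<Sum>k\<in>UNIV. (a i k)\<^sup>2 + (if k = i then 2 * a i i * b i + (b i)\<^sup>2 else 0))"
    by (intro sum.cong refl) (auto simp: power2_eq_square algebra_simps)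
  then show ?thesis by (simp add: sum.distrib)
qed

text \<open>Here \<open>u\<close>, \<open>v\<close> are the normal and tangential parts of the
  velocity, \<open>a\<close>, \<open>b\<close> those of \<open>y\<close>, \<open>p\<close> and
  \<open>e\<close> the normal parts of the accelerations of the variation and of \<open>x\<close>;
  \<open>du\<close>, \<open>dv\<close> are angle derivatives, and \<open>dq\<close> those of the
  tangential acceleration. The right side isolates the quadratic form in the normal data from a
  remainder: divergences, a null Lagrangian in \<open>dv\<close>, and the products
  \<open>a i * a j / 2\<close>, whose diagonal terms have nonzero mean.\<close>

lemma second_variation_algebra:
  fixes u v a b e p :: "'n::finite \<Rightarrow> real" and du dv dq :: "'n \<Rightarrow> 'n \<Rightarrow> real" and r h c :: real
  assumes r: "r\<^sup>2 = 2"
  defines "N1 \<equiv> 2 * (r * (\<Sum>k\<in>UNIV. u k - a k))"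
  defines "N2 \<equiv> 2 * (\<Sum>k\<in>UNIV. (u k - a k)\<^sup>2 + (v k - b k)\<^sup>2) + 2 * (r * (\<Sum>k\<in>UNIV. p k - e k))"
  defines "A \<equiv> \<lambda>i j. r * (dv j i + (if j = i then u i else 0)) + r * (dv i j + (if i = j then u j else 0))"
  defines "B \<equiv> \<lambda>i. 2 * (\<Sum>k\<in>UNIV. (du i k + (if i = k then - v k else 0))\<^sup>2 + (dv i k + (if i = k then u k else 0))\<^sup>2)
      + 2 * (r * (dq i i + p i))"
  shows "c - N2 / 4 + N1 * h / 2 + (\<Sum>i\<in>UNIV. B i) / 4 - (\<Sum>i\<in>UNIV. \<Sum>j\<in>UNIV. A i j * A j i) / 8
       + (- N1 / 4 + (\<Sum>i\<in>UNIV. A i i) / 4)\<^sup>2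
     = (c + (\<Sum>i\<in>UNIV. \<Sum>k\<in>UNIV. (du i k)\<^sup>2) / 2 - (\<Sum>k\<in>UNIV. (u k)\<^sup>2) + (\<Sum>k\<in>UNIV. r * h * u k + u k * a k)
          - (\<Sum>k\<in>UNIV. (a k)\<^sup>2 + (b k)\<^sup>2) / 2)
       + ((\<Sum>k\<in>UNIV. r / 2 * e k - r * h * a k + r / 2 * dq k k - (u k * dv k k + du k k * v k))
       + (\<Sum>i\<in>UNIV. \<Sum>j\<in>UNIV. (dv i i * dv j j - dv j i * dv i j) / 2 + (a i * dv j j + (if j = i then b j * v j else 0)) + a i * a j / 2))"
proof -
  define S where "S = (\<Sum>i\<in>UNIV. \<Sum>j\<in>UNIV. dv i j * dv j i)"
  have A2: "(\<Sum>i\<in>UNIV. \<Sum>j\<in>UNIV. A i j * A j i)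
     = 4 * (\<Sum>i\<in>UNIV. \<Sum>j\<in>UNIV. (dv i j)\<^sup>2) + 4 * S + 16 * (\<Sum>k\<in>UNIV. u k * dv k k) + 8 * (\<Sum>k\<in>UNIV. (u k)\<^sup>2)"
  proof -
    have "A i j * A j i = 2 * ((dv j i + dv i j) + (if i = j then 2 * u j else 0))\<^sup>2" for i j
    proof -
      have "A i j = r * ((dv j i + dv i j) + (if i = j then 2 * u j else 0))" for i j
        unfolding A_def by (cases "i = j") (auto simp: algebra_simps)
      moreover have "A j i = A i j" unfolding A_def by auto
      ultimately have "A i j * A j i = r\<^sup>2 * ((dv j i + dv i j) + (if i = j then 2 * u j else 0))\<^sup>2"
        by (simp only: power2_eq_square) (simp only: ac_simps)
      then show ?thesis by (simp only: r)
    qed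
    then have "(\<Sum>i\<in>UNIV. \<Sum>j\<in>UNIV. A i j * A j i)
       = 2 * (\<Sum>i\<in>UNIV. \<Sum>j\<in>UNIV. ((dv j i + dv i j) + (if i = j then 2 * u j else 0))\<^sup>2)"
      by (simp add: sum_distrib_left)
    also have "\<dots> = 2 * ((\<Sum>i\<in>UNIV. \<Sum>j\<in>UNIV. (dv j i + dv i j)\<^sup>2) + (\<Sum>k\<in>UNIV. 2 * (dv k k + dv k k) * (2 * u k) + (2 * u k)\<^sup>2))"
      unfolding sum_delta_sq ..
    also have "(\<Sum>i\<in>UNIV. \<Sum>j\<in>UNIV. (dv j i + dv i j)\<^sup>2)
       = (\<Sum>i\<in>UNIV. \<Sum>j\<in>UNIV. (dv j i)\<^sup>2) + (\<Sum>i\<in>UNIV. \<Sum>j\<in>UNIV. (dv i j)\<^sup>2) + 2 * S"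
      by (simp add: S_def power2_sum sum.distrib sum_distrib_left mult_ac)
    also have "(\<Sum>i\<in>UNIV. \<Sum>j\<in>UNIV. (dv j i)\<^sup>2) = (\<Sum>i\<in>UNIV. \<Sum>j\<in>UNIV. (dv i j)\<^sup>2)"
      by (rule sum.swap)
    finally show ?thesis
      by (simp add: sum.distrib sum_distrib_left power2_eq_square algebra_simps)
  qed
  have A1: "(\<Sum>i\<in>UNIV. A i i) = 2 * r * (\<Sum>i\<in>UNIV. dv i i + u i)"
    by (simp add: A_def sum_distrib_left algebra_simps)
  have B1: "(\<Sum>i\<in>UNIV. B i) = 2 * ((\<Sum>i\<in>UNIV. \<Sum>k\<in>UNIV. (du i k)\<^sup>2) + (\<Sum>k\<in>UNIV. 2 * du k k * (- v k) + (- v k)\<^sup>2))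
     + 2 * ((\<Sum>i\<in>UNIV. \<Sum>k\<in>UNIV. (dv i k)\<^sup>2) + (\<Sum>k\<in>UNIV. 2 * dv k k * u k + (u k)\<^sup>2))
     + 2 * r * (\<Sum>i\<in>UNIV. dq i i + p i)"
    unfolding B_def sum_delta_sq[of du "\<lambda>k. - v k", symmetric] sum_delta_sq[of dv u, symmetric]
    by (simp add: sum.distrib sum_distrib_left[symmetric])
  \<comment> \<open>The trace of \<open>A\<close> contains \<open>u\<close> with the same weight as
    \<open>N1\<close>, so the normal part cancels: this is the shrinker equation.\<close>
  have sq: "(- N1 / 4 + (\<Sum>i\<in>UNIV. A i i) / 4)\<^sup>2 = (\<Sum>i\<in>UNIV. a i + dv i i)\<^sup>2 / 2"
  proof -
    have "- N1 / 4 + (\<Sum>i\<in>UNIV. A i i) / 4 = r / 2 * (\<Sum>i\<in>UNIV. a i + dv i i)"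
      unfolding A1 N1_def by (simp add: sum.distrib sum_subtractf field_simps)
    then have "(- N1 / 4 + (\<Sum>i\<in>UNIV. A i i) / 4)\<^sup>2 = r\<^sup>2 / 2\<^sup>2 * (\<Sum>i\<in>UNIV. a i + dv i i)\<^sup>2"
      by (simp only: power_mult_distrib power_divide)
    then show ?thesis by (simp add: r)
  qed
  have dd: "(\<Sum>i\<in>UNIV. \<Sum>j\<in>UNIV. (dv i i * dv j j - dv j i * dv i j) / 2 + (a i * dv j j + (if j = i then b j * v j else 0)) + a i * a j / 2)
     = ((\<Sum>i\<in>UNIV. dv i i)\<^sup>2 - S) / 2 + (\<Sum>i\<in>UNIV. a i) * (\<Sum>i\<in>UNIV. dv i i) + (\<Sum>k\<in>UNIV. b k * v k) + (\<Sum>i\<in>UNIV. a i)\<^sup>2 / 2"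
    by (simp add: sum.distrib sum_subtractf S_def power2_eq_square sum_product sum_divide_distrib[symmetric] mult.commute)
  have e1: "(\<Sum>k\<in>UNIV. 2 * du k k * (- v k) + (- v k)\<^sup>2) = (\<Sum>k\<in>UNIV. (v k)\<^sup>2) - 2 * (\<Sum>k\<in>UNIV. du k k * v k)"
    by (simp add: sum_subtractf[symmetric] sum_distrib_left mult.assoc)
  have e2: "(\<Sum>k\<in>UNIV. 2 * dv k k * u k + (u k)\<^sup>2) = 2 * (\<Sum>k\<in>UNIV. u k * dv k k) + (\<Sum>k\<in>UNIV. (u k)\<^sup>2)"
    by (simp add: sum.distrib sum_distrib_left mult_ac)
  have e3: "(\<Sum>k\<in>UNIV. (u k - a k)\<^sup>2 + (v k - b k)\<^sup>2) = (\<Sum>k\<in>UNIV. (u k)\<^sup>2) + (\<Sum>k\<in>UNIV. (v k)\<^sup>2)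
      + (\<Sum>k\<in>UNIV. (a k)\<^sup>2 + (b k)\<^sup>2) - 2 * (\<Sum>k\<in>UNIV. u k * a k) - 2 * (\<Sum>k\<in>UNIV. b k * v k)"
    by (simp add: sum.distrib[symmetric] sum_subtractf[symmetric] sum_distrib_left power2_eq_square algebra_simps)
  have e4: "(\<Sum>i\<in>UNIV. a i + dv i i)\<^sup>2 = (\<Sum>i\<in>UNIV. a i)\<^sup>2 + (\<Sum>i\<in>UNIV. dv i i)\<^sup>2 + 2 * (\<Sum>i\<in>UNIV. a i) * (\<Sum>i\<in>UNIV. dv i i)"
    by (simp add: sum.distrib power2_sum)
  have e5: "(\<Sum>k\<in>UNIV. r * h * u k + u k * a k) = r * h * (\<Sum>k\<in>UNIV. u k) + (\<Sum>k\<in>UNIV. u k * a k)"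
    by (simp add: sum.distrib sum_distrib_left)
  have e6: "(\<Sum>k\<in>UNIV. r / 2 * e k - r * h * a k + r / 2 * dq k k - (u k * dv k k + du k k * v k))
     = r / 2 * (\<Sum>k\<in>UNIV. e k) - r * h * (\<Sum>k\<in>UNIV. a k) + r / 2 * (\<Sum>k\<in>UNIV. dq k k)
       - ((\<Sum>k\<in>UNIV. u k * dv k k) + (\<Sum>k\<in>UNIV. du k k * v k))"
    by (simp add: sum.distrib sum_subtractf sum_distrib_left)
  show ?thesis
    unfolding A2 B1 sq dd e1 e2 e4 e5 e6 unfolding N1_def N2_def e3 sum_subtractf
    by (simp add: sum.distrib field_simps)
qed

text \<open>The field in the moving frame: real and imaginary part of \<open>rot X k\<close> are its normal and tangential component in the \<open>k\<close>-th factor.\<close>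

definition rot :: "(real^'n::finite \<Rightarrow> complex^'n) \<Rightarrow> 'n \<Rightarrow> real^'n \<Rightarrow> complex" where
  "rot X k \<theta> = chr (- axis k 1) \<theta> * X \<theta> $ k"

lemma has_pd_rot:
  assumes "has_pd i X X'"
  shows "has_pd i (rot X k) (\<lambda>\<theta>. rot X' k \<theta> - (if i = k then \<i> * rot X k \<theta> else 0))"
proof -
  have "has_pd i (\<lambda>\<theta>. chr (- axis k 1) \<theta> * X \<theta> $ k)
     (\<lambda>\<theta>. chr (- axis k 1) \<theta> * X' \<theta> $ k + \<i> * of_int ((- axis k 1) $ i) * chr (- axis k 1) \<theta> * X \<theta> $ k)"
    by (rule has_pd_bilinear[OF bounded_bilinear_mult has_pd_chr has_pd_linear[OF bounded_linear_vec_nth assms]])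
  then have "has_pd i (rot X k)
     (\<lambda>\<theta>. chr (- axis k 1) \<theta> * X' \<theta> $ k + \<i> * of_int ((- axis k 1) $ i) * chr (- axis k 1) \<theta> * X \<theta> $ k)"
    by (simp add: rot_def[abs_def])
  then show ?thesis by (rule has_pd_cong) (auto simp: rot_def axis_def)
qed

lemma has_pd_rot_const: "has_pd i (rot (\<lambda>_. y) k) (\<lambda>\<theta>. if i = k then - \<i> * rot (\<lambda>_. y) k \<theta> else 0)"
  by (rule has_pd_cong[OF has_pd_rot[OF has_pd_const]]) (simp add: rot_def)

lemma norm_rot: "norm (rot X k \<theta>) = norm (X \<theta> $ k)"
  by (simp add: rot_def norm_mult)

lemma inner_self_rot: "X \<theta> \<bullet> X \<theta> = (\<Sum>k\<in>UNIV. (Re (rot X k \<theta>))\<^sup>2 + (Im (rot X k \<theta>))\<^sup>2)"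
  by (simp add: inner_vec_def power2_norm_eq_inner[symmetric] norm_rot[symmetric] cmod_power2)

lemma inner_complex_Re: "z \<bullet> w = Re (cnj w * z)"
  by (simp add: inner_complex_def)

lemma inner_clifford_rot: "X \<theta> \<bullet> clifford \<theta> = sqrt 2 * (\<Sum>k\<in>UNIV. Re (rot X k \<theta>))"
  by (simp add: inner_vec_def clifford_nth rot_def inner_complex_Re chr_cnj sum_distrib_left mult.assoc)

lemma has_pd_Re: "has_pd i f f' \<Longrightarrow> has_pd i (\<lambda>\<theta>. Re (f \<theta>)) (\<lambda>\<theta>. Re (f' \<theta>))"
  by (rule has_pd_linear[OF bounded_linear_Re])

lemma has_pd_Im: "has_pd i f f' \<Longrightarrow> has_pd i (\<lambda>\<theta>. Im (f \<theta>)) (\<lambda>\<theta>. Im (f' \<theta>))"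
  by (rule has_pd_linear[OF bounded_linear_Im])

lemma has_pd_cmult: "has_pd i f f' \<Longrightarrow> has_pd i (\<lambda>\<theta>. (c::real) * f \<theta>) (\<lambda>\<theta>. c * f' \<theta>)"
  by (rule has_pd_linear[OF bounded_linear_mult_right])

lemmas has_pd_mult = has_pd_bilinear[OF bounded_bilinear_mult]

lemma has_pd_continuous: "has_pd i f f' \<Longrightarrow> continuous_on S f" "has_pd i f f' \<Longrightarrow> continuous_on S f'"
  using continuous_on_subset unfolding has_pd_def by blast+

text \<open>With Y the rotated constant field, (Re Y)^2 minus half of |Y|^2 equals Re (Y^2) / 2,
  which is a derivative. Different factors depend on different angles, so their product is a
  derivative too.\<close>

lemma integral_rot_const_mult:
  fixes y :: "complex^'n::finite"
  shows "integral torus_box (\<lambda>\<theta>. Re (rot (\<lambda>_. y) i \<theta>) * Re (rot (\<lambda>_. y) j \<theta>))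
     = (if i = j then torus_vol TYPE('n) * (norm (y $ i))\<^sup>2 / 2 else 0)"
proof (cases "i = j")
  case True
  let ?Y = "rot (\<lambda>_. y) i"
  have "has_pd i (\<lambda>\<theta>. (- 1 / 4) * Im (?Y \<theta> * ?Y \<theta>)) (\<lambda>\<theta>. (Re (?Y \<theta>))\<^sup>2 - (norm (y $ i))\<^sup>2 / 2)"
  proof (rule has_pd_cong[OF has_pd_cmult[OF has_pd_Im[OF has_pd_mult[OF has_pd_rot_const has_pd_rot_const]]]])
    fix \<theta>
    have "(norm (y $ i))\<^sup>2 = (Re (?Y \<theta>))\<^sup>2 + (Im (?Y \<theta>))\<^sup>2"
      by (simp add: norm_rot[symmetric] cmod_power2 flip: norm_rot[of "\<lambda>_. y" i \<theta>])
    then show "(- 1 / 4) * Im (?Y \<theta> * (if i = i then - \<i> * ?Y \<theta> else 0) + (if i = i then - \<i> * ?Y \<theta> else 0) * ?Y \<theta>)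
       = (Re (?Y \<theta>))\<^sup>2 - (norm (y $ i))\<^sup>2 / 2"
      by (simp add: power2_eq_square field_simps)
  qed
  from integral_pd_zero[OF this]
  have "integral torus_box (\<lambda>\<theta>. (Re (?Y \<theta>))\<^sup>2) - integral torus_box (\<lambda>\<theta>::real^'n. (norm (y $ i))\<^sup>2 / 2) = 0"
    by (subst integral_diff[symmetric])
       (auto intro!: integrable_torus continuous_intros has_pd_continuous(1)[OF has_pd_rot_const])
  then show ?thesis using True by (simp add: power2_eq_square)
next
  case False
  have "has_pd i (\<lambda>\<theta>. (- 1) * (Im (rot (\<lambda>_. y) i \<theta>) * Re (rot (\<lambda>_. y) j \<theta>)))
     (\<lambda>\<theta>. Re (rot (\<lambda>_. y) i \<theta>) * Re (rot (\<lambda>_. y) j \<theta>))"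
    by (rule has_pd_cong[OF has_pd_cmult[OF has_pd_mult[OF has_pd_Im[OF has_pd_rot_const] has_pd_Re[OF has_pd_rot_const]]]])
       (use False in simp)
  from integral_pd_zero[OF this] False show ?thesis by simp
qed

section \<open>The second variation formula\<close>

context
  fixes \<phi> :: "real \<Rightarrow> real^'n::finite \<Rightarrow> complex^'n"
  assumes variation: "torus_variation clifford \<phi>"
begin

text \<open>\<open>V\<close> and \<open>Z\<close> are the velocity and acceleration at parameter 0.
  In \<open>dV\<close> and \<open>dZ\<close> the angle derivative is outermost, the form in which
  \<open>smooth_has_pd\<close> applies, whereas differentiating the Gram matrix puts the parameter
  derivatives outermost; \<open>dP\<close> and \<open>ddP\<close> mediate between the two.
  \<open>P\<close> is kept for all parameters because it is differentiated in them.\<close>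

qualified definition "\<Phi> = (\<lambda>p::real \<times> (real^'n). \<phi> (fst p) (snd p))"
qualified definition "P i = dird (0, axis i 1) \<Phi>"
qualified definition "V \<theta> = dird (1, 0) \<Phi> (0, \<theta>)"
qualified definition "Z \<theta> = dird (1, 0) (dird (1, 0) \<Phi>) (0, \<theta>)"
qualified definition "dV i \<theta> = dird (0, axis i 1) (dird (1, 0) \<Phi>) (0, \<theta>)"
qualified definition "dZ i \<theta> = dird (0, axis i 1) (dird (1, 0) (dird (1, 0) \<Phi>)) (0, \<theta>)"

lemma smooth: "smooth_map \<Phi>"
  using variation by (simp add: torus_variation_def \<Phi>_def)

lemma tper: "tper \<Phi>"
  using variation by (simp add: torus_variation_def tper_def \<Phi>_def)

lemma phi_eq: "\<phi> s = (\<lambda>\<theta>. \<Phi> (s, \<theta>))"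
  unfolding \<Phi>_def by simp

lemma \<Phi>_0: "\<Phi> (0, \<theta>) = clifford \<theta>"
  using variation by (simp add: torus_variation_def \<Phi>_def)

lemma pd_phi: "pd i (\<phi> s) \<theta> = P i (s, \<theta>)"
  by (simp only: phi_eq pd_slice[OF smooth] P_def)

lemma dP: "dird (1, 0) (P i) (0, \<theta>) = dV i \<theta>"
  unfolding P_def dV_def by (rule dird_commute[OF smooth])

lemma ddP: "dird (1, 0) (dird (1, 0) (P i)) (0, \<theta>) = dZ i \<theta>"
proof -
  have "dird (1, 0) (P i) = dird (0, axis i 1) (dird (1, 0) \<Phi>)"
    unfolding P_def by (rule ext) (rule dird_commute[OF smooth])
  then show ?thesis
    unfolding dZ_def by (simp only:) (rule dird_commute[OF smooth_map_dird[OF smooth]])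
qed

lemma has_pd_V: "has_pd i V (dV i)"
  using smooth_has_pd[OF smooth_map_dird[OF smooth, of "(1, 0)"] tper_dird[OF smooth tper], of i 0]
  unfolding V_def dV_def .

lemma has_pd_Z: "has_pd i Z (dZ i)"
  using smooth_has_pd[OF smooth_map_dird[OF smooth_map_dird[OF smooth, of "(1, 0)"], of "(1, 0)"] tper_dird[OF smooth_map_dird[OF smooth] tper_dird[OF smooth tper]], of i 0]
  unfolding Z_def dZ_def .

lemma has_pd_clifford: "has_pd i clifford (\<lambda>\<theta>. P i (0, \<theta>))"
  using smooth_has_pd[OF smooth tper, of i 0] unfolding P_def \<Phi>_0 .

lemma P_0: "P i (0, \<theta>) = axis i (\<i> * of_real (sqrt 2) * chr (axis i 1) \<theta>)"
proof (rule vec_eq_iff[THEN iffD2], rule allI)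
  fix k
  have 1: "has_pd i (\<lambda>\<theta>. clifford \<theta> $ k) (\<lambda>\<theta>. P i (0, \<theta>) $ k)"
    by (rule has_pd_linear[OF bounded_linear_vec_nth has_pd_clifford])
  have 2: "has_pd i (\<lambda>\<theta>. clifford \<theta> $ k) (\<lambda>\<theta>. of_real (sqrt 2) * (\<i> * of_int (axis k 1 $ i) * chr (axis k 1) \<theta>))"
    unfolding clifford_nth by (rule has_pd_linear[OF bounded_linear_mult_right has_pd_chr])
  have "P i (0, \<theta>) $ k = of_real (sqrt 2) * (\<i> * of_int (axis k 1 $ i) * chr (axis k 1) \<theta>)"
    by (rule vector_derivative_unique_at[OF 1[unfolded has_pd_def, THEN conjunct2, THEN conjunct2, THEN conjunct2, THEN conjunct2, rule_format]
        2[unfolded has_pd_def, THEN conjunct2, THEN conjunct2, THEN conjunct2, THEN conjunct2, rule_format]])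
  then show "P i (0, \<theta>) $ k = axis i (\<i> * of_real (sqrt 2) * chr (axis i 1) \<theta>) $ k"
    by (simp add: axis_def)
qed

text \<open>\<open>N1\<close>, \<open>N2\<close> are the derivatives of the squared distance to
  \<open>x s\<close>; \<open>A\<close> is the first derivative of the Gram matrix and
  \<open>B\<close> the diagonal of the second, of which only the trace enters. The prefactor is the
  constant Gaussian weight times the constant area density.\<close>

lemma second_derivative_F:
  fixes x :: "real \<Rightarrow> complex^'n" and t :: "real \<Rightarrow> real"
  assumes x: "smooth_map x" "x 0 = 0" and t: "smooth_map t" "t 0 = 1"
  defines "y \<equiv> dird 1 x 0" and "\<xi> \<equiv> dird 1 (dird 1 x) 0" and "h \<equiv> dird 1 t 0"
  defines "N1 \<equiv> \<lambda>\<theta>. 2 * ((V \<theta> - y) \<bullet> clifford \<theta>)"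
  defines "N2 \<equiv> \<lambda>\<theta>. 2 * ((V \<theta> - y) \<bullet> (V \<theta> - y)) + 2 * ((Z \<theta> - \<xi>) \<bullet> clifford \<theta>)"
  defines "A \<equiv> \<lambda>\<theta> i j. P i (0, \<theta>) \<bullet> dV j \<theta> + dV i \<theta> \<bullet> P j (0, \<theta>)"
  defines "B \<equiv> \<lambda>\<theta> i. 2 * (dV i \<theta> \<bullet> dV i \<theta>) + 2 * (P i (0, \<theta>) \<bullet> dZ i \<theta>)"
  shows "deriv (deriv (\<lambda>s. Ffun (x s) (t s) (\<phi> s))) 0 =
    (4 * pi) powr (- (real CARD('n) / 2)) * (exp (- (real CARD('n) / 2)) * sqrt (2 ^ CARD('n))) *
    integral torus_box (\<lambda>\<theta>. - (real CARD('n) * h\<^sup>2 / 2) - N2 \<theta> / 4 + N1 \<theta> * h / 2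
       + (\<Sum>i\<in>UNIV. B \<theta> i) / 4 - (\<Sum>i\<in>UNIV. \<Sum>j\<in>UNIV. A \<theta> i j * A \<theta> j i) / 8
       + (- N1 \<theta> / 4 + (\<Sum>i\<in>UNIV. A \<theta> i i) / 4)\<^sup>2)"
proof -
  let ?K = "torus_box :: (real^'n) set"
  define M where "M s \<theta> = (\<chi> i j. P i (s, \<theta>) \<bullet> P j (s, \<theta>))" for s \<theta>
  define M1 where "M1 s \<theta> = (\<chi> i j. P i (s, \<theta>) \<bullet> dird (1, 0) (P j) (s, \<theta>) + dird (1, 0) (P i) (s, \<theta>) \<bullet> P j (s, \<theta>))" for s \<theta>
  define M2 where "M2 s \<theta> = (\<chi> i j. (P i (s, \<theta>) \<bullet> dird (1, 0) (dird (1, 0) (P j)) (s, \<theta>) + dird (1, 0) (P i) (s, \<theta>) \<bullet> dird (1, 0) (P j) (s, \<theta>))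
     + (dird (1, 0) (P i) (s, \<theta>) \<bullet> dird (1, 0) (P j) (s, \<theta>) + dird (1, 0) (dird (1, 0) (P i)) (s, \<theta>) \<bullet> P j (s, \<theta>)))" for s \<theta>
  define Nf where "Nf s \<theta> = (\<Phi> (s, \<theta>) - x s) \<bullet> (\<Phi> (s, \<theta>) - x s)" for s \<theta>
  have sP: "smooth_map (P i)" for i unfolding P_def by (rule smooth_map_dird[OF smooth])
  have Mj: "jet2 U K (\<lambda>s \<theta>. M s \<theta> $ i $ j) (\<lambda>s \<theta>. M1 s \<theta> $ i $ j) (\<lambda>s \<theta>. M2 s \<theta> $ i $ j)" for U K i j
    using jet2_bilinear[OF bounded_bilinear_inner smooth_jet2[OF sP[of i]] smooth_jet2[OF sP[of j]], of U K]
    by (simp add: M_def M1_def M2_def)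
  note dj = jet2_det[OF Mj]
  have M0: "M 0 \<theta> = mat 2" for \<theta>
    by (auto simp: M_def P_0 inner_axis_axis mat_def vec_eq_iff power2_norm_eq_inner[symmetric] norm_mult power_mult_distrib)
  \<comment> \<open>Taking the minimum secures the scale and the determinant with one
    interval.\<close>
  obtain d where d: "d > 0" "\<And>s \<theta>. s \<in> {-d<..<d} \<Longrightarrow> \<theta> \<in> ?K \<Longrightarrow> min (t s) (det (M s \<theta>)) > 0"
  proof -
    have "continuous_on UNIV (\<lambda>p. det (M (fst p) (snd p)))"
      using dj[of UNIV UNIV] by (simp add: jet2_def)
    moreover have "continuous_on UNIV (\<lambda>p::real\<times>(real^'n). t (fst p))"
      by (intro continuous_on_compose2[OF smooth_map_continuous[OF t(1), of UNIV]] continuous_intros) auto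
    ultimately have c: "continuous_on UNIV (\<lambda>p. min (t (fst p)) (det (M (fst p) (snd p))))"
      by (intro continuous_intros)
    show thesis
      by (rule tube_interval[OF c compact_cbox[of 0 "\<chi> k. 2 * pi"]]) (use that t M0 det_mat[of 2, where 'n='n] in auto)
  qed
  have ne: "0 \<in> ?K" by (simp add: mem_box_cart)
  have tpos: "t s > 0" if "s \<in> {-d<..<d}" for s using d(2)[OF that ne] by simp
  have dpos: "det (M s \<theta>) > 0" if "s \<in> {-d<..<d}" "\<theta> \<in> ?K" for s \<theta> using d(2)[OF that] by simp
  let ?U = "{-d<..<d}"
  note nj = jet2_diff[OF smooth_jet2[OF smooth] smooth_jet2_curve[OF x(1)], of ?U ?K]
  note Nj = jet2_bilinear[OF bounded_bilinear_inner nj nj, folded Nf_def]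
  let ?D1 = "\<lambda>s \<theta>. \<Sum>k\<in>UNIV. det (\<chi> i. if i = k then M1 s \<theta> $ i else M s \<theta> $ i)"
  let ?D2 = "\<lambda>s \<theta>. \<Sum>k\<in>UNIV. \<Sum>l\<in>UNIV. det (\<chi> i. if i = l then (\<chi> i. if i = k then M2 s \<theta> $ i else M1 s \<theta> $ i) $ i
                                   else (\<chi> i. if i = k then M1 s \<theta> $ i else M s \<theta> $ i) $ i)"
  define Nf1 where "Nf1 s \<theta> = (\<Phi> (s, \<theta>) - x s) \<bullet> (dird (1, 0) \<Phi> (s, \<theta>) - dird 1 x s) + (dird (1, 0) \<Phi> (s, \<theta>) - dird 1 x s) \<bullet> (\<Phi> (s, \<theta>) - x s)" for s \<theta>
  define Nf2 where "Nf2 s \<theta> = (\<Phi> (s, \<theta>) - x s) \<bullet> (dird (1, 0) (dird (1, 0) \<Phi>) (s, \<theta>) - dird 1 (dird 1 x) s)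
     + (dird (1, 0) \<Phi> (s, \<theta>) - dird 1 x s) \<bullet> (dird (1, 0) \<Phi> (s, \<theta>) - dird 1 x s)
     + ((dird (1, 0) \<Phi> (s, \<theta>) - dird 1 x s) \<bullet> (dird (1, 0) \<Phi> (s, \<theta>) - dird 1 x s)
       + (dird (1, 0) (dird (1, 0) \<Phi>) (s, \<theta>) - dird 1 (dird 1 x) s) \<bullet> (\<Phi> (s, \<theta>) - x s))" for s \<theta>
  have NJ: "jet2 ?U ?K Nf Nf1 Nf2"
    using Nj unfolding Nf_def[abs_def] Nf1_def[abs_def] Nf2_def[abs_def] .
  obtain f f1 f2 where f: "jet2 ?U ?K f f1 f2"
    and f0: "\<And>s \<theta>. s \<in> ?U \<Longrightarrow> \<theta> \<in> ?K \<Longrightarrow>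
       f s \<theta> = (4 * pi * t s) powr (- (real CARD('n) / 2)) * (exp (- Nf s \<theta> / (4 * t s)) * sqrt (det (M s \<theta>)))"
    and f2: "\<And>s \<theta>. s \<in> ?U \<Longrightarrow> \<theta> \<in> ?K \<Longrightarrow> t s = 1 \<Longrightarrow> Nf s \<theta> = 2 * real CARD('n) \<Longrightarrow>
       f2 s \<theta> = (4 * pi) powr (- (real CARD('n) / 2)) * (exp (- (real CARD('n) / 2)) * sqrt (det (M s \<theta>))) *
         ((- (real CARD('n) * (dird 1 t s)\<^sup>2 / 2) - Nf2 s \<theta> / 4 + Nf1 s \<theta> * dird 1 t s / 2
            + (?D2 s \<theta> / det (M s \<theta>) - (?D1 s \<theta> / det (M s \<theta>))\<^sup>2) / 2)
          + (- Nf1 s \<theta> / 4 + ?D1 s \<theta> / (2 * det (M s \<theta>)))\<^sup>2)"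
    apply (rule log_integrand_jet[OF smooth_jet2_curve[OF t(1)] NJ dj, of "real CARD('n)"])
      apply (erule tpos)
     apply (erule (1) dpos)
    subgoal premises p for f f1 f2 by (rule that; fact p)
    done
  have F: "Ffun (x s) (t s) (\<phi> s) = integral ?K (f s)" if s: "s \<in> ?U" for s
  proof -
    have "integral ?K (f s) = integral ?K (\<lambda>\<theta>. (4 * pi * t s) powr (- (real CARD('n) / 2)) * (exp (- Nf s \<theta> / (4 * t s)) * sqrt (det (M s \<theta>))))"
      by (rule integral_cong) (rule f0[OF s])
    moreover have "Nf s \<theta> = (norm (\<phi> s \<theta> - x s))\<^sup>2" for \<theta>
      by (simp add: Nf_def power2_norm_eq_inner \<Phi>_def)
    ultimately show ?thesis
      by (simp only: Ffun_def pd_phi M_def integral_mult_right)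
  qed
  have "deriv (deriv (\<lambda>s. Ffun (x s) (t s) (\<phi> s))) 0 = integral ?K (f2 0)"
    by (rule deriv2_integral_jet2[OF f d(1) F])
  also have "\<dots> = integral ?K (\<lambda>\<theta>. (4 * pi) powr (- (real CARD('n) / 2)) * (exp (- (real CARD('n) / 2)) * sqrt (2 ^ CARD('n))) *
    (- (real CARD('n) * h\<^sup>2 / 2) - N2 \<theta> / 4 + N1 \<theta> * h / 2
       + (\<Sum>i\<in>UNIV. B \<theta> i) / 4 - (\<Sum>i\<in>UNIV. \<Sum>j\<in>UNIV. A \<theta> i j * A \<theta> j i) / 8
       + (- N1 \<theta> / 4 + (\<Sum>i\<in>UNIV. A \<theta> i i) / 4)\<^sup>2))"
  proof (rule integral_cong)
    fix \<theta> assume K: "\<theta> \<in> ?K"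
    have N: "Nf 0 \<theta> = 2 * real CARD('n)" by (simp add: Nf_def \<Phi>_0 x(2) clifford_inner_self)
    have N1: "Nf1 0 \<theta> = N1 \<theta>"
      by (simp add: Nf1_def N1_def \<Phi>_0 x(2) V_def y_def inner_commute)
    have N2: "Nf2 0 \<theta> = N2 \<theta>"
      by (simp add: Nf2_def N2_def \<Phi>_0 x(2) V_def Z_def y_def \<xi>_def inner_commute)
    have A: "M1 0 \<theta> $ i $ j = A \<theta> i j" for i j by (simp add: M1_def A_def dP)
    have B: "M2 0 \<theta> $ i $ i = B \<theta> i" for i by (simp add: M2_def B_def dP ddP inner_commute)
    have two: "(2::real) \<noteq> 0" by simp
    have D1: "?D1 0 \<theta> = 2 ^ CARD('n) * (\<Sum>i\<in>UNIV. A \<theta> i i) / 2"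
      unfolding M0 using det_jet1_mat[OF two, of "M1 0 \<theta>", unfolded A] .
    have D2: "?D2 0 \<theta> = 2 ^ CARD('n) * ((\<Sum>i\<in>UNIV. B \<theta> i) / 2
        + ((\<Sum>i\<in>UNIV. A \<theta> i i)\<^sup>2 - (\<Sum>i\<in>UNIV. \<Sum>j\<in>UNIV. A \<theta> i j * A \<theta> j i)) / 2\<^sup>2)"
      unfolding M0 using det_jet2_mat[OF two, of "M2 0 \<theta>" "M1 0 \<theta>", unfolded A B] .
    have D0: "det (M 0 \<theta>) = 2 ^ CARD('n)" by (simp add: M0 det_mat)
    \<comment> \<open>Passing to the logarithm of the determinant removes the squared trace of
      \<open>A\<close>, leaving tr B / 4 - tr(A^2) / 8.\<close>
    have alg: "(c * (b / 2 + (a\<^sup>2 - g) / 2\<^sup>2) / c - (c * a / 2 / c)\<^sup>2) / 2 = b / 4 - g / 8"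
      "c * a / 2 / (2 * c) = a / 4" if "c \<noteq> 0" for a b c g :: real
      using that by (simp_all add: power2_eq_square field_simps)
    show "f2 0 \<theta> = (4 * pi) powr (- (real CARD('n) / 2)) * (exp (- (real CARD('n) / 2)) * sqrt (2 ^ CARD('n))) *
    (- (real CARD('n) * h\<^sup>2 / 2) - N2 \<theta> / 4 + N1 \<theta> * h / 2
       + (\<Sum>i\<in>UNIV. B \<theta> i) / 4 - (\<Sum>i\<in>UNIV. \<Sum>j\<in>UNIV. A \<theta> i j * A \<theta> j i) / 8
       + (- N1 \<theta> / 4 + (\<Sum>i\<in>UNIV. A \<theta> i i) / 4)\<^sup>2)"
    proof -
      have "0 \<in> ?U" using d(1) by simp
      note f20 = f2[OF this K t(2) N, unfolded N1 N2 D1 D2 D0 h_def[symmetric] alg[of "2 ^ CARD('n)", OF power_not_zero[OF two]]]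
      show ?thesis unfolding f20 by (simp only: add_diff_eq)
    qed
  qed
  also have "\<dots> = (4 * pi) powr (- (real CARD('n) / 2)) * (exp (- (real CARD('n) / 2)) * sqrt (2 ^ CARD('n))) *
     integral ?K (\<lambda>\<theta>. - (real CARD('n) * h\<^sup>2 / 2) - N2 \<theta> / 4 + N1 \<theta> * h / 2
       + (\<Sum>i\<in>UNIV. B \<theta> i) / 4 - (\<Sum>i\<in>UNIV. \<Sum>j\<in>UNIV. A \<theta> i j * A \<theta> j i) / 8
       + (- N1 \<theta> / 4 + (\<Sum>i\<in>UNIV. A \<theta> i i) / 4)\<^sup>2)"
    by (rule integral_mult_right)
  finally show ?thesis .
qed

section \<open>Normal and tangential components and the divergence terms\<close>

qualified definition "u k \<theta> = Re (rot V k \<theta>)"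
qualified definition "v k \<theta> = Im (rot V k \<theta>)"
text \<open>The subtracted term is the derivative of the rotating frame; thus \<open>dw i k\<close>
  is the full angle derivative of \<open>rot V k\<close>.\<close>

qualified definition "dw i k \<theta> = rot (dV i) k \<theta> - (if i = k then \<i> * rot V k \<theta> else 0)"
qualified definition "du i k \<theta> = Re (dw i k \<theta>)"
qualified definition "dv i k \<theta> = Im (dw i k \<theta>)"
qualified definition "ddV i j \<theta> = dird (0, axis i 1) (dird (0, axis j 1) (dird (1, 0) \<Phi>)) (0, \<theta>)"

lemma has_pd_dV: "has_pd i (dV j) (ddV i j)"
  using smooth_has_pd[OF smooth_map_dird[OF smooth_map_dird[OF smooth, of "(1, 0)"], of "(0, axis j 1)"]
      tper_dird[OF smooth_map_dird[OF smooth] tper_dird[OF smooth tper]], of i 0]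
  unfolding dV_def[abs_def] ddV_def[abs_def] .

lemma ddV_commute: "ddV i j = ddV j i"
  unfolding ddV_def by (rule ext) (rule dird_commute[OF smooth_map_dird[OF smooth]])

lemma has_pd_w: "has_pd i (rot V k) (dw i k)"
  using has_pd_rot[OF has_pd_V, of i k] unfolding dw_def[abs_def] .

lemma has_pd_u: "has_pd i (u k) (du i k)"
  using has_pd_Re[OF has_pd_w, of i k] unfolding u_def[abs_def] du_def[abs_def] .

lemma has_pd_v: "has_pd i (v k) (dv i k)"
  using has_pd_Im[OF has_pd_w, of i k] unfolding v_def[abs_def] dv_def[abs_def] .

text \<open>The witness is the mixed second derivative of the tangential component. Symmetry is
  inherited from \<open>ddV\<close>; the frame corrections agree because only the angle
  \<open>j\<close> rotates the \<open>j\<close>-th component.\<close>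

lemma has_pd_dv:
  obtains g where "has_pd i (dv j j) g" "has_pd j (dv i j) g"
proof -
  let ?g = "\<lambda>i j \<theta>. (rot (ddV i j) j \<theta> - (if i = j then \<i> * rot (dV j) j \<theta> else 0)) - \<i> * dw i j \<theta>"
  have 1: "has_pd i (dw j j) (?g i j)"
    using has_pd_diff[OF has_pd_rot[OF has_pd_dV] has_pd_linear[OF bounded_linear_mult_right has_pd_w], of i j j \<i> j]
    by (simp add: dw_def[abs_def])
  have 2: "has_pd j (dw i j) (?g i j)"
  proof (cases "i = j")
    case True
    then show ?thesis using 1 by simp
  next
    case False
    have "has_pd j (rot (dV i) j) (\<lambda>\<theta>. rot (ddV j i) j \<theta> - (if j = j then \<i> * rot (dV i) j \<theta> else 0))"
      by (rule has_pd_rot[OF has_pd_dV])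
    then show ?thesis using False by (simp add: dw_def[abs_def] ddV_commute[of j i])
  qed
  show thesis
    using that[of "\<lambda>\<theta>. Im (?g i j \<theta>)"] has_pd_Im[OF 1] has_pd_Im[OF 2] unfolding dv_def[abs_def] by blast
qed

text \<open>A null Lagrangian: the integrand is the \<open>i\<close>-derivative of
  \<open>v i * dv j j\<close> minus the \<open>j\<close>-derivative of \<open>v i * dv i j\<close>,
  the mixed second derivatives cancelling.\<close>

lemma integral_dv: "integral torus_box (\<lambda>\<theta>. dv i i \<theta> * dv j j \<theta> - dv j i \<theta> * dv i j \<theta>) = 0"
proof -
  obtain g where g: "has_pd i (dv j j) g" "has_pd j (dv i j) g" by (rule has_pd_dv)
  note 1 = has_pd_mult[OF has_pd_v[of i i] g(1)] and 2 = has_pd_mult[OF has_pd_v[of j i] g(2)]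
  have "integral torus_box (\<lambda>\<theta>. (v i \<theta> * g \<theta> + dv i i \<theta> * dv j j \<theta>) - (v i \<theta> * g \<theta> + dv j i \<theta> * dv i j \<theta>)) = 0"
    by (subst integral_diff)
       (auto simp: integral_pd_zero[OF 1] integral_pd_zero[OF 2] intro!: integrable_torus has_pd_continuous(2)[OF 1] has_pd_continuous(2)[OF 2])
  then show ?thesis by simp
qed

lemma inner_P_rot: "P i (0, \<theta>) \<bullet> X \<theta> = sqrt 2 * Im (rot X i \<theta>)"
proof -
  have "P i (0, \<theta>) \<bullet> X \<theta> = (\<i> * of_real (sqrt 2) * chr (axis i 1) \<theta>) \<bullet> X \<theta> $ i"
    unfolding P_0 by (metis inner_axis inner_commute)
  also have "\<dots> = Re (cnj (\<i> * of_real (sqrt 2) * chr (axis i 1) \<theta>) * X \<theta> $ i)"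
    by (simp add: inner_complex_def)
  also have "\<dots> = sqrt 2 * Im (rot X i \<theta>)"
    by (simp add: chr_cnj rot_def algebra_simps)
  finally show ?thesis .
qed

text \<open>The coefficient 1/4 of |y|^2 is a net value: |V - y|^2 costs one half, and the square of
  the first logarithmic derivative returns one quarter through the mean of the squares of the normal
  parts of \<open>y\<close>.\<close>

lemma second_variation:
  fixes x :: "real \<Rightarrow> complex^'n" and t :: "real \<Rightarrow> real" and h :: real
  assumes x: "smooth_map x" "x 0 = 0" and t: "smooth_map t" "t 0 = 1"
  defines "y \<equiv> dird 1 x 0" and "h \<equiv> dird 1 t 0"
  obtains c where "c > 0"
    "deriv (deriv (\<lambda>s. Ffun (x s) (t s) (\<phi> s))) 0 = c *
      (integral torus_box (\<lambda>\<theta>. (\<Sum>i\<in>UNIV. \<Sum>k\<in>UNIV. (du i k \<theta>)\<^sup>2) / 2 - (\<Sum>k\<in>UNIV. (u k \<theta>)\<^sup>2)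
          + (\<Sum>k\<in>UNIV. sqrt 2 * h * u k \<theta> + u k \<theta> * Re (rot (\<lambda>_. y) k \<theta>)))
        - torus_vol TYPE('n) * (CARD('n) * h\<^sup>2 / 2 + (norm y)\<^sup>2 / 4))"
proof -
  define \<xi> where "\<xi> = dird 1 (dird 1 x) 0"
  let ?r = "sqrt 2"
  let ?c = "(4 * pi) powr (- (real CARD('n) / 2)) * (exp (- (real CARD('n) / 2)) * sqrt (2 ^ CARD('n)))"
  define a where "a k \<theta> = Re (rot (\<lambda>_. y) k \<theta>)" for k \<theta>
  define b where "b k \<theta> = Im (rot (\<lambda>_. y) k \<theta>)" for k \<theta>
  define e where "e k \<theta> = Re (rot (\<lambda>_. \<xi>) k \<theta>)" for k \<theta>
  define p where "p k \<theta> = Re (rot Z k \<theta>)" for k \<theta>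
  define dq where "dq i k \<theta> = Im (rot (dZ i) k \<theta> - (if i = k then \<i> * rot Z k \<theta> else 0))" for i k \<theta>
  define Q where "Q \<theta> = (\<Sum>i\<in>UNIV. \<Sum>k\<in>UNIV. (du i k \<theta>)\<^sup>2) / 2 - (\<Sum>k\<in>UNIV. (u k \<theta>)\<^sup>2)
          + (\<Sum>k\<in>UNIV. ?r * h * u k \<theta> + u k \<theta> * a k \<theta>)" for \<theta>
  \<comment> \<open>\<open>f1\<close> and \<open>f2\<close> are the single and double sum parts of
    the remainder in \<open>second_variation_algebra\<close>.\<close>
  define f1 where "f1 k \<theta> = ?r / 2 * e k \<theta> - ?r * h * a k \<theta> + ?r / 2 * dq k k \<theta> - (u k \<theta> * dv k k \<theta> + du k k \<theta> * v k \<theta>)" for k \<theta>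
  define f2 where "f2 i j \<theta> = (dv i i \<theta> * dv j j \<theta> - dv j i \<theta> * dv i j \<theta>) / 2
     + (a i \<theta> * dv j j \<theta> + (if j = i then b j \<theta> * v j \<theta> else 0)) + a i \<theta> * a j \<theta> / 2" for i j \<theta>
  have pa: "has_pd i (a k) (\<lambda>\<theta>. if i = k then b k \<theta> else 0)" for i k
    using has_pd_Re[OF has_pd_rot_const[of i y k]] unfolding a_def[abs_def]
    by (rule has_pd_cong) (simp add: b_def)
  have pb: "has_pd i (b k) (\<lambda>\<theta>. if i = k then - a k \<theta> else 0)" for i k
    using has_pd_Im[OF has_pd_rot_const[of i y k]] unfolding b_def[abs_def]
    by (rule has_pd_cong) (simp add: a_def)
  have pe: "has_pd k (\<lambda>\<theta>. Im (rot (\<lambda>_. \<xi>) k \<theta>)) (\<lambda>\<theta>. - e k \<theta>)" for k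
    by (rule has_pd_cong[OF has_pd_Im[OF has_pd_rot_const]]) (simp add: e_def)
  have pq: "has_pd i (\<lambda>\<theta>. Im (rot Z k \<theta>)) (dq i k)" for i k
    using has_pd_Im[OF has_pd_rot[OF has_pd_Z]] unfolding dq_def[abs_def] .
  note c = has_pd_continuous(1)[OF has_pd_u] has_pd_continuous(1)[OF has_pd_v] has_pd_continuous(2)[OF has_pd_u]
    has_pd_continuous(2)[OF has_pd_v] has_pd_continuous(1)[OF pa] has_pd_continuous(1)[OF pb]
  \<comment> \<open>The antiderivative is explicit: \<open>e\<close> and \<open>a\<close> are minus
    the \<open>k\<close>-derivatives of the tangential parts of their constant fields, and the last
    term is the derivative of \<open>u k * v k\<close>.\<close>
  have f1: "has_pd k (\<lambda>\<theta>. (((- ?r / 2) * Im (rot (\<lambda>_. \<xi>) k \<theta>) + (?r * h) * b k \<theta>) + ?r / 2 * Im (rot Z k \<theta>)) - u k \<theta> * v k \<theta>) (f1 k)" for k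
    by (rule has_pd_cong[OF has_pd_diff[OF has_pd_add[OF has_pd_add[OF has_pd_cmult[OF pe] has_pd_cmult[OF pb]] has_pd_cmult[OF pq]]
       has_pd_mult[OF has_pd_u has_pd_v]]]) (simp add: f1_def)
  have If1: "integral torus_box (f1 k) = 0" for k by (rule integral_pd_zero[OF f1])
  have cf2: "continuous_on UNIV (f2 i j)" for i j
    unfolding f2_def[abs_def] by (cases "i = j") (auto intro!: continuous_intros c)
  have If2: "integral torus_box (f2 i j) = (if i = j then torus_vol TYPE('n) * (norm (y $ i))\<^sup>2 / 4 else 0)" for i j
  proof -
    have P: "has_pd j (\<lambda>\<theta>. a i \<theta> * v j \<theta>) (\<lambda>\<theta>. a i \<theta> * dv j j \<theta> + (if j = i then b j \<theta> * v j \<theta> else 0))"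
      by (rule has_pd_cong[OF has_pd_mult[OF pa has_pd_v]]) auto
    have "integral torus_box (f2 i j) = integral torus_box (\<lambda>\<theta>. (dv i i \<theta> * dv j j \<theta> - dv j i \<theta> * dv i j \<theta>) / 2)
       + integral torus_box (\<lambda>\<theta>. a i \<theta> * dv j j \<theta> + (if j = i then b j \<theta> * v j \<theta> else 0)) + integral torus_box (\<lambda>\<theta>. a i \<theta> * a j \<theta> / 2)"
      unfolding f2_def[abs_def]
      by (subst integral_add, (intro integrable_torus continuous_intros c has_pd_continuous(2)[OF P] | simp)+)+
    also have "integral torus_box (\<lambda>\<theta>. a i \<theta> * a j \<theta> / 2) = (if i = j then torus_vol TYPE('n) * (norm (y $ i))\<^sup>2 / 4 else 0)"
      using integral_rot_const_mult[of y i j] by (simp add: a_def)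
    finally show ?thesis by (simp add: integral_dv integral_pd_zero[OF P])
  qed
  have cQ: "continuous_on UNIV Q" unfolding Q_def[abs_def] by (intro continuous_intros c) auto
  let ?k = "- (CARD('n) * h\<^sup>2 / 2) - (norm y)\<^sup>2 / 2"
  have ny: "(\<Sum>k\<in>UNIV. (norm (y $ k))\<^sup>2) = (norm y)\<^sup>2"
    by (simp add: power2_norm_eq_inner inner_vec_def)
  have "deriv (deriv (\<lambda>s. Ffun (x s) (t s) (\<phi> s))) 0 = ?c *
     integral torus_box (\<lambda>\<theta>. (?k + Q \<theta>) + ((\<Sum>k\<in>UNIV. f1 k \<theta>) + (\<Sum>i\<in>UNIV. \<Sum>j\<in>UNIV. f2 i j \<theta>)))"
  proof -
    have "- (real CARD('n) * h\<^sup>2 / 2)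
        - (2 * ((V \<theta> - y) \<bullet> (V \<theta> - y)) + 2 * ((Z \<theta> - \<xi>) \<bullet> clifford \<theta>)) / 4
        + 2 * ((V \<theta> - y) \<bullet> clifford \<theta>) * h / 2
        + (\<Sum>i\<in>UNIV. 2 * (dV i \<theta> \<bullet> dV i \<theta>) + 2 * (P i (0, \<theta>) \<bullet> dZ i \<theta>)) / 4
        - (\<Sum>i\<in>UNIV. \<Sum>j\<in>UNIV. (P i (0, \<theta>) \<bullet> dV j \<theta> + dV i \<theta> \<bullet> P j (0, \<theta>)) * (P j (0, \<theta>) \<bullet> dV i \<theta> + dV j \<theta> \<bullet> P i (0, \<theta>))) / 8
        + (- (2 * ((V \<theta> - y) \<bullet> clifford \<theta>)) / 4 + (\<Sum>i\<in>UNIV. P i (0, \<theta>) \<bullet> dV i \<theta> + dV i \<theta> \<bullet> P i (0, \<theta>)) / 4)\<^sup>2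
      = (?k + Q \<theta>) + ((\<Sum>k\<in>UNIV. f1 k \<theta>) + (\<Sum>i\<in>UNIV. \<Sum>j\<in>UNIV. f2 i j \<theta>))" for \<theta>
    proof -
      have rd: "rot (\<lambda>\<theta>. X \<theta> - z) k \<theta> = rot X k \<theta> - rot (\<lambda>_. z) k \<theta>" for X z k
        by (simp add: rot_def algebra_simps)
      have i1: "(V \<theta> - y) \<bullet> clifford \<theta> = ?r * (\<Sum>k\<in>UNIV. u k \<theta> - a k \<theta>)"
        using inner_clifford_rot[of "\<lambda>\<theta>. V \<theta> - y" \<theta>] by (simp add: rd u_def a_def)
      have i2: "(V \<theta> - y) \<bullet> (V \<theta> - y) = (\<Sum>k\<in>UNIV. (u k \<theta> - a k \<theta>)\<^sup>2 + (v k \<theta> - b k \<theta>)\<^sup>2)"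
        using inner_self_rot[of "\<lambda>\<theta>. V \<theta> - y" \<theta>] by (simp add: rd u_def a_def v_def b_def)
      have i3: "(Z \<theta> - \<xi>) \<bullet> clifford \<theta> = ?r * (\<Sum>k\<in>UNIV. p k \<theta> - e k \<theta>)"
        using inner_clifford_rot[of "\<lambda>\<theta>. Z \<theta> - \<xi>" \<theta>] by (simp add: rd p_def e_def)
      have re: "Re (rot (dV i) k \<theta>) = du i k \<theta> + (if i = k then - v k \<theta> else 0)"
        and im: "Im (rot (dV i) k \<theta>) = dv i k \<theta> + (if i = k then u k \<theta> else 0)" for i k
        by (auto simp: du_def dv_def dw_def u_def v_def)
      have i4: "P i (0, \<theta>) \<bullet> dV j \<theta> = ?r * (dv j i \<theta> + (if j = i then u i \<theta> else 0))" for i j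
        unfolding inner_P_rot im ..
      have i4': "dV i \<theta> \<bullet> P j (0, \<theta>) = ?r * (dv i j \<theta> + (if i = j then u j \<theta> else 0))" for i j
        unfolding inner_commute[of "dV i \<theta>"] i4 ..
      have i5: "dV i \<theta> \<bullet> dV i \<theta> = (\<Sum>k\<in>UNIV. (du i k \<theta> + (if i = k then - v k \<theta> else 0))\<^sup>2 + (dv i k \<theta> + (if i = k then u k \<theta> else 0))\<^sup>2)" for i
        unfolding inner_self_rot re im ..
      have i6: "P i (0, \<theta>) \<bullet> dZ i \<theta> = ?r * (dq i i \<theta> + p i \<theta>)" for i
        unfolding inner_P_rot by (simp add: dq_def p_def)
      have yy: "(norm y)\<^sup>2 = (\<Sum>k\<in>UNIV. (a k \<theta>)\<^sup>2 + (b k \<theta>)\<^sup>2)"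
        using inner_self_rot[of "\<lambda>_. y" \<theta>] by (simp add: power2_norm_eq_inner a_def b_def)
      have r2: "?r\<^sup>2 = 2" by simp
      show ?thesis
        unfolding i1 i2 i3 i4 i4' i5 i6 yy
        by (rule trans[OF second_variation_algebra[OF r2, where u="\<lambda>k. u k \<theta>" and a="\<lambda>k. a k \<theta>" and v="\<lambda>k. v k \<theta>"
              and b="\<lambda>k. b k \<theta>" and p="\<lambda>k. p k \<theta>" and e="\<lambda>k. e k \<theta>" and dv="\<lambda>i k. dv i k \<theta>" and du="\<lambda>i k. du i k \<theta>"
              and dq="\<lambda>i k. dq i k \<theta>" and h=h]])
           (simp add: Q_def f1_def f2_def)
    qed
    then show ?thesis
      unfolding second_derivative_F[OF x t] \<xi>_def y_def h_def by (simp only:)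
  qed
  also have "integral torus_box (\<lambda>\<theta>. (?k + Q \<theta>) + ((\<Sum>k\<in>UNIV. f1 k \<theta>) + (\<Sum>i\<in>UNIV. \<Sum>j\<in>UNIV. f2 i j \<theta>)))
     = (torus_vol TYPE('n) * ?k + integral torus_box Q) + ((\<Sum>k\<in>UNIV. integral torus_box (f1 k)) + (\<Sum>i\<in>UNIV. \<Sum>j\<in>UNIV. integral torus_box (f2 i j)))"
  proof -
    have int: "Q integrable_on torus_box" "f1 k integrable_on torus_box" "f2 i j integrable_on torus_box" for i j k
      by (auto intro!: integrable_torus cQ cf2 has_pd_continuous(2)[OF f1])
    have s1: "integral torus_box (\<lambda>\<theta>. \<Sum>k\<in>UNIV. f1 k \<theta>) = (\<Sum>k\<in>UNIV. integral torus_box (f1 k))"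
      by (rule integral_sum) (auto intro: int)
    have s2: "integral torus_box (\<lambda>\<theta>. \<Sum>i\<in>UNIV. \<Sum>j\<in>UNIV. f2 i j \<theta>) = (\<Sum>i\<in>UNIV. \<Sum>j\<in>UNIV. integral torus_box (f2 i j))"
      by (subst integral_sum, simp, intro integrable_sum int, simp)
         (intro sum.cong refl integral_sum int, simp)
    have s3: "integral torus_box (\<lambda>\<theta>. ?k + Q \<theta>) = torus_vol TYPE('n) * ?k + integral torus_box Q"
      by (subst integral_add) (auto intro: int)
    show ?thesis
      by (subst integral_add, intro integrable_add integrable_const int, intro integrable_add integrable_sum int finite, subst integral_add)
         (auto simp: s1 s2 s3 intro!: integrable_sum int)
  qed
  also have "\<dots> = integral torus_box Q - torus_vol TYPE('n) * (CARD('n) * h\<^sup>2 / 2 + (norm y)\<^sup>2 / 4)"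
  proof -
    have "(\<Sum>i\<in>UNIV. \<Sum>j\<in>UNIV. integral torus_box (f2 i j)) = torus_vol TYPE('n) * (norm y)\<^sup>2 / 4"
      unfolding If2 by (simp add: sum_divide_distrib[symmetric] sum_distrib_left[symmetric] ny)
    moreover have "(A * (- z - n / 2) + q) + (0 + A * n / 4) = q - A * (z + n / 4)" for A z n q :: real
      by (simp add: algebra_simps)
    ultimately show ?thesis by (simp only: If1 sum.neutral_const)
  qed
  finally show thesis
    by (intro that[of ?c]) (simp_all add: Q_def[abs_def] a_def)
qed

text \<open>The tangent vector \<open>P j\<close> is \<open>\<i>\<close> times the radial direction,
  scaled by the radius, so pairing with it under \<open>omega\<close> reads off the normal part in
  the \<open>j\<close>-th factor.\<close>

lemma var_form_eq: "var_form clifford \<phi> j \<theta> = sqrt 2 * u j \<theta>"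
proof -
  have "((\<lambda>s. \<Phi> (s, \<theta>)) has_vector_derivative dird (1, 0) \<Phi> (0, \<theta>)) (at 0)"
    using smooth_jet2[OF smooth, of UNIV UNIV] by (simp add: jet2_def)
  then have "var_field \<phi> \<theta> = V \<theta>"
    unfolding var_field_def V_def \<Phi>_def by (simp add: vector_derivative_at)
  moreover have "pd j clifford \<theta> = P j (0, \<theta>)"
    using pd_phi[of j 0 \<theta>] variation by (simp add: torus_variation_def)
  moreover have "omega (V \<theta>) (P j (0, \<theta>)) = (\<Sum>k\<in>UNIV. if k = j then sqrt 2 * u j \<theta> else 0)"
    unfolding omega_def P_0
  proof (rule sum.cong)
    fix k
    have "Im (cnj (V \<theta> $ j) * (\<i> * of_real (sqrt 2) * chr (axis j 1) \<theta>)) = sqrt 2 * Re (cnj (chr (axis j 1) \<theta>) * V \<theta> $ j)"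
      by (simp add: algebra_simps)
    then show "Im (cnj (V \<theta> $ k) * axis j (\<i> * of_real (sqrt 2) * chr (axis j 1) \<theta>) $ k) = (if k = j then sqrt 2 * u j \<theta> else 0)"
      by (auto simp: axis_def u_def rot_def chr_cnj)
  qed simp
  ultimately show ?thesis by (simp add: var_form_def)
qed

text \<open>Exactness turns each \<open>u k\<close> into a genuine \<open>k\<close>-th derivative of
  a periodic function, the hypothesis on which the spectral gap rests. Division by
  \<open>sqrt 2\<close> removes the radius from the form.\<close>

lemma hamiltonian_potential:
  assumes "hamiltonian_variation clifford \<phi>"
  obtains g where "\<And>k. has_pd k g (u k)"
proof -
  obtain g :: "real^'n \<Rightarrow> real" where g: "smooth_map g" "periodic_map g" "\<And>j \<theta>. sqrt 2 * u j \<theta> = pd j g \<theta>"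
    using assms unfolding hamiltonian_variation_def var_form_eq by blast
  have "has_pd k g (\<lambda>\<theta>. sqrt 2 * u k \<theta>)" for k
  proof -
    have "((\<lambda>s. g (\<theta> + s *\<^sub>R axis k 1)) has_vector_derivative sqrt 2 * u k \<theta>) (at 0)" for \<theta>
      using smooth_map_line[OF g(1), of \<theta> "axis k 1" 0] by (simp add: g(3) dird_def pd_def)
    moreover have "continuous_on UNIV (\<lambda>\<theta>. sqrt 2 * u k \<theta>)" "periodic_map (u k)"
      using has_pd_u[of k k] by (auto simp: has_pd_def intro!: continuous_intros)
    ultimately show ?thesis
      using g(2) smooth_map_continuous[OF g(1), of UNIV] unfolding has_pd_def periodic_map_def by simp
  qed
  from has_pd_cmult[OF this, where c="1 / sqrt 2"] show thesis
    by (intro that[of "\<lambda>\<theta>. 1 / sqrt 2 * g \<theta>"]) simp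
qed

lemma hamiltonian_stable:
  assumes "hamiltonian_variation clifford \<phi>"
  shows "\<exists>(x :: real \<Rightarrow> complex^'n) (t :: real \<Rightarrow> real).
    smooth_map x \<and> smooth_map t \<and> x 0 = 0 \<and> t 0 = 1 \<and> deriv (deriv (\<lambda>s. Ffun (x s) (t s) (\<phi> s))) 0 \<ge> 0"
proof -
  let ?V = "torus_vol TYPE('n)"
  let ?I = "integral torus_box :: (real^'n \<Rightarrow> real) \<Rightarrow> real"
  obtain g where g: "\<And>k. has_pd k g (u k)" using hamiltonian_potential[OF assms] by blast
  have V: "?V > 0" by (rule torus_vol_pos)
  define \<beta> where "\<beta> k = ?I (\<lambda>\<theta>. u k \<theta> * cos (\<theta> $ k))" for k
  define \<delta> where "\<delta> k = ?I (\<lambda>\<theta>. u k \<theta> * sin (\<theta> $ k))" for k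
  \<comment> \<open>The maximizer of \<open>\<beta> k * Re (y $ k) + \<delta> k * Im (y $ k) - V *
    (norm (y $ k))\<^sup>2 / 4\<close> in each component.\<close>
  define y :: "complex^'n" where "y = (\<chi> k. Complex (2 * \<beta> k / ?V) (2 * \<delta> k / ?V))"
  define x where "x s = s *\<^sub>R y" for s :: real
  have bl: "bounded_linear x" unfolding x_def[abs_def] by (rule bounded_linear_scaleR_left)
  have x: "smooth_map x" "x 0 = 0" "dird 1 x 0 = y"
    using smooth_map_linear[OF bl] dird_eqI[OF bounded_linear_imp_has_derivative[OF bl], of 1 0] by (auto simp: x_def)
  obtain c where c: "c > 0" and D: "deriv (deriv (\<lambda>s. Ffun (x s) 1 (\<phi> s))) 0 = c *
      (?I (\<lambda>\<theta>. (\<Sum>i\<in>UNIV. \<Sum>k\<in>UNIV. (du i k \<theta>)\<^sup>2) / 2 - (\<Sum>k\<in>UNIV. (u k \<theta>)\<^sup>2)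
          + (\<Sum>k\<in>UNIV. u k \<theta> * Re (rot (\<lambda>_. y) k \<theta>))) - ?V * (norm y)\<^sup>2 / 4)"
    using second_variation[OF x(1,2) smooth_map_const[of 1] refl] unfolding x(3) dird_const by auto
  note cu = has_pd_continuous(1)[OF has_pd_u] has_pd_continuous(2)[OF has_pd_u] has_pd_continuous(1)[OF has_pd_rot_const]
  have ints: "(\<lambda>\<theta>. (du i k \<theta>)\<^sup>2) integrable_on torus_box" "(\<lambda>\<theta>. (u k \<theta>)\<^sup>2) integrable_on torus_box"
     "(\<lambda>\<theta>. u k \<theta> * cos (\<theta> $ k)) integrable_on torus_box" "(\<lambda>\<theta>. u k \<theta> * sin (\<theta> $ k)) integrable_on torus_box"
     "(\<lambda>\<theta>. u k \<theta> * Re (rot (\<lambda>_. y) k \<theta>)) integrable_on torus_box" for i k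
    by (auto intro!: integrable_torus continuous_intros cu)
  have uY: "?I (\<lambda>\<theta>. u k \<theta> * Re (rot (\<lambda>_. y) k \<theta>)) = 2 * ((\<beta> k)\<^sup>2 + (\<delta> k)\<^sup>2) / ?V" for k
  proof -
    have "Re (rot (\<lambda>_. y) k \<theta>) = cos (\<theta> $ k) * (2 * \<beta> k / ?V) + sin (\<theta> $ k) * (2 * \<delta> k / ?V)" for \<theta>
      by (simp add: rot_def y_def chr_cnj[symmetric] cis_eq_chr[symmetric])
    then have "?I (\<lambda>\<theta>. u k \<theta> * Re (rot (\<lambda>_. y) k \<theta>))
       = ?I (\<lambda>\<theta>. (u k \<theta> * cos (\<theta> $ k)) * (2 * \<beta> k / ?V) + (u k \<theta> * sin (\<theta> $ k)) * (2 * \<delta> k / ?V))"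
      by (simp add: algebra_simps)
    also have "\<dots> = \<beta> k * (2 * \<beta> k / ?V) + \<delta> k * (2 * \<delta> k / ?V)"
      unfolding \<beta>_def \<delta>_def
      by (subst integral_add) (intro integrable_on_mult_left ints | simp only: integral_mult_left)+
    finally show ?thesis by (simp add: power2_eq_square add_divide_distrib mult_ac)
  qed
  have ny: "?V * (norm y)\<^sup>2 / 4 = (\<Sum>k\<in>UNIV. ((\<beta> k)\<^sup>2 + (\<delta> k)\<^sup>2) / ?V)"
  proof -
    have "(norm y)\<^sup>2 = (\<Sum>k\<in>UNIV. (norm (y $ k))\<^sup>2)" by (simp add: power2_norm_eq_inner inner_vec_def)
    also have "\<dots> = (\<Sum>k\<in>UNIV. (2 * \<beta> k / ?V)\<^sup>2 + (2 * \<delta> k / ?V)\<^sup>2)" by (simp add: y_def cmod_power2)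
    finally have "?V * (norm y)\<^sup>2 / 4 = (\<Sum>k\<in>UNIV. ?V * ((2 * \<beta> k / ?V)\<^sup>2 + (2 * \<delta> k / ?V)\<^sup>2) / 4)"
      by (simp only: sum_distrib_left sum_divide_distrib)
    moreover have "A * ((2 * p / A)\<^sup>2 + (2 * q / A)\<^sup>2) / 4 = (p\<^sup>2 + q\<^sup>2) / A" if "A > 0" for A p q :: real
      using that by (simp add: power2_eq_square field_simps)
    ultimately show ?thesis using V by (simp only:)
  qed
  have "?I (\<lambda>\<theta>. (\<Sum>i\<in>UNIV. \<Sum>k\<in>UNIV. (du i k \<theta>)\<^sup>2) / 2 - (\<Sum>k\<in>UNIV. (u k \<theta>)\<^sup>2) + (\<Sum>k\<in>UNIV. u k \<theta> * Re (rot (\<lambda>_. y) k \<theta>)))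
     = ?I (\<lambda>\<theta>. \<Sum>k\<in>UNIV. (\<Sum>i\<in>UNIV. (du i k \<theta>)\<^sup>2) / 2 - (u k \<theta>)\<^sup>2 + u k \<theta> * Re (rot (\<lambda>_. y) k \<theta>))"
  proof -
    have "(\<Sum>i\<in>UNIV. \<Sum>k\<in>UNIV. (du i k \<theta>)\<^sup>2) = (\<Sum>k\<in>UNIV. \<Sum>i\<in>UNIV. (du i k \<theta>)\<^sup>2)" for \<theta> by (rule sum.swap)
    then show ?thesis by (simp add: sum.distrib sum_subtractf sum_divide_distrib)
  qed
  also have "\<dots> = (\<Sum>k\<in>UNIV. ?I (\<lambda>\<theta>. (\<Sum>i\<in>UNIV. (du i k \<theta>)\<^sup>2) / 2 - (u k \<theta>)\<^sup>2 + u k \<theta> * Re (rot (\<lambda>_. y) k \<theta>)))"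
    by (rule integral_sum) (auto intro!: integrable_torus continuous_intros cu)
  also have "\<dots> = (\<Sum>k\<in>UNIV. (\<Sum>i\<in>UNIV. ?I (\<lambda>\<theta>. (du i k \<theta>)\<^sup>2)) / 2 - ?I (\<lambda>\<theta>. (u k \<theta>)\<^sup>2) + 2 * ((\<beta> k)\<^sup>2 + (\<delta> k)\<^sup>2) / ?V)"
  proof (rule sum.cong)
    fix k
    have sd: "(\<lambda>\<theta>. (\<Sum>i\<in>UNIV. (du i k \<theta>)\<^sup>2) / 2) integrable_on torus_box"
      by (auto intro!: integrable_torus continuous_intros cu)
    have "?I (\<lambda>\<theta>. \<Sum>i\<in>UNIV. (du i k \<theta>)\<^sup>2) = (\<Sum>i\<in>UNIV. ?I (\<lambda>\<theta>. (du i k \<theta>)\<^sup>2))"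
      by (rule integral_sum) (auto intro: ints)
    then show "?I (\<lambda>\<theta>. (\<Sum>i\<in>UNIV. (du i k \<theta>)\<^sup>2) / 2 - (u k \<theta>)\<^sup>2 + u k \<theta> * Re (rot (\<lambda>_. y) k \<theta>))
      = (\<Sum>i\<in>UNIV. ?I (\<lambda>\<theta>. (du i k \<theta>)\<^sup>2)) / 2 - ?I (\<lambda>\<theta>. (u k \<theta>)\<^sup>2) + 2 * ((\<beta> k)\<^sup>2 + (\<delta> k)\<^sup>2) / ?V"
      by (simp add: integral_add integral_diff integrable_diff sd ints uY)
  qed simp
  \<comment> \<open>Of the two copies gained from the linear term, the spectral gap consumes one;
    the other equals the penalty for \<open>y\<close> computed in \<open>ny\<close>.\<close>
  also have "\<dots> \<ge> (\<Sum>k\<in>UNIV. ((\<beta> k)\<^sup>2 + (\<delta> k)\<^sup>2) / ?V)"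
  proof (rule sum_mono)
    fix k
    show "((\<beta> k)\<^sup>2 + (\<delta> k)\<^sup>2) / ?V \<le> (\<Sum>i\<in>UNIV. ?I (\<lambda>\<theta>. (du i k \<theta>)\<^sup>2)) / 2 - ?I (\<lambda>\<theta>. (u k \<theta>)\<^sup>2) + 2 * ((\<beta> k)\<^sup>2 + (\<delta> k)\<^sup>2) / ?V"
      using torus_spectral_gap[OF has_pd_u g, of k, folded \<beta>_def \<delta>_def]
      by (simp only: times_divide_eq_right[symmetric])
  qed
  finally have "deriv (deriv (\<lambda>s. Ffun (x s) 1 (\<phi> s))) 0 \<ge> 0"
    unfolding D ny using c by simp
  then show ?thesis
    using x by (intro exI[of _ x] exI[of _ "\<lambda>_. 1"]) (auto simp: smooth_map_const)
qed

section \<open>Lagrangian instability\<close>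

lemma u_twist:
  assumes tw: "\<And>s \<theta>. \<phi> s \<theta> = twist (\<lambda>_. of_real (sqrt 2)) (\<lambda>i. of_real (a i)) (s, \<theta>)"
  shows "u i \<theta> = a i"
proof -
  have *: "\<Phi> = twist (\<lambda>_. of_real (sqrt 2)) (\<lambda>i. of_real (a i))" by (auto simp: \<Phi>_def tw)
  have V: "V \<theta> = twist (\<lambda>i. of_real (a i)) (\<lambda>_. 0) (0, \<theta>)"
    unfolding V_def * by (rule trans[OF dird_eqI[OF twist_has_derivative]]) simp
  have "chr (- axis i 1) \<theta> * chr (axis i 1) \<theta> = 1" by (simp add: chr_mult chr_0)
  then have "rot V i \<theta> = of_real (a i)" by (simp add: rot_def V twist_def cis_eq_chr)
  then show ?thesis by (simp add: u_def)
qed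

lemma lagrangian_variation_twist:
  assumes tw: "\<And>s \<theta>. \<phi> s \<theta> = twist (\<lambda>_. of_real (sqrt 2)) (\<lambda>i. of_real (a i)) (s, \<theta>)"
  shows "lagrangian_variation clifford \<phi>"
  unfolding lagrangian_variation_def
proof (intro allI)
  have "var_form clifford \<phi> j = (\<lambda>_. sqrt 2 * a j)" for j by (rule ext) (simp add: var_form_eq u_twist[OF tw])
  moreover have "pd i (\<lambda>_. c::real) = (\<lambda>_. 0)" for i :: 'n and c
    unfolding pd_def using dird_const[of "axis i 1" c] by (simp add: dird_def)
  ultimately show "pd i (var_form clifford \<phi> j) \<theta> = pd j (var_form clifford \<phi> i) \<theta>" for i j \<theta> by simp
qed

text \<open>Scaling couples only to the sum of the \<open>a k\<close>, which is zero, and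
  translation only to the first Fourier modes, which a constant field lacks. So \<open>x\<close> and
  \<open>t\<close> contribute nothing but their own nonpositive squares, and the squares of the
  rates remain with a minus sign.\<close>

lemma lagrangian_unstable:
  assumes tw: "\<And>s \<theta>. \<phi> s \<theta> = twist (\<lambda>_. of_real (sqrt 2)) (\<lambda>i. of_real (a i)) (s, \<theta>)" and sa: "(\<Sum>k\<in>UNIV. a k) = 0" and a: "a l \<noteq> 0"
    and x: "smooth_map x" "x 0 = 0" and t: "smooth_map t" "t 0 = 1"
  shows "deriv (deriv (\<lambda>s. Ffun (x s) (t s) (\<phi> s))) 0 < 0"
proof -
  note u = u_twist[OF tw]
  let ?V = "torus_vol TYPE('n)"
  have V: "?V > 0" by (rule torus_vol_pos)
  define y where "y = dird 1 x 0"
  define h where "h = dird 1 t 0"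
  obtain c where c: "c > 0" and D: "deriv (deriv (\<lambda>s. Ffun (x s) (t s) (\<phi> s))) 0 = c *
      (integral torus_box (\<lambda>\<theta>. (\<Sum>i\<in>UNIV. \<Sum>k\<in>UNIV. (du i k \<theta>)\<^sup>2) / 2 - (\<Sum>k\<in>UNIV. (u k \<theta>)\<^sup>2)
          + (\<Sum>k\<in>UNIV. sqrt 2 * h * u k \<theta> + u k \<theta> * Re (rot (\<lambda>_. y) k \<theta>)))
        - ?V * (CARD('n) * h\<^sup>2 / 2 + (norm y)\<^sup>2 / 4))"
    using second_variation[OF x t] unfolding y_def h_def by blast
  have du: "du i k \<theta> = 0" for i k \<theta>
  proof -
    have "((\<lambda>s::real. a k) has_vector_derivative du i k \<theta>) (at 0)"
      using has_pd_u[of i k] by (simp add: has_pd_def u)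
    then show ?thesis by (rule vector_derivative_unique_at[OF _ has_vector_derivative_const])
  qed
  have Y: "integral torus_box (\<lambda>\<theta>. Re (rot (\<lambda>_. y) k \<theta>)) = 0" for k
  proof -
    have "has_pd k (\<lambda>\<theta>. (-1) * Im (rot (\<lambda>_. y) k \<theta>)) (\<lambda>\<theta>. Re (rot (\<lambda>_. y) k \<theta>))"
      by (rule has_pd_cong[OF has_pd_cmult[OF has_pd_Im[OF has_pd_rot_const]]]) simp
    then show ?thesis by (rule integral_pd_zero)
  qed
  have iY: "(\<lambda>\<theta>. a k * Re (rot (\<lambda>_. y) k \<theta>)) integrable_on torus_box" for k
    by (intro integrable_torus continuous_intros has_pd_continuous(1)[OF has_pd_rot_const])
  have "integral torus_box (\<lambda>\<theta>. (\<Sum>i\<in>UNIV. \<Sum>k\<in>UNIV. (du i k \<theta>)\<^sup>2) / 2 - (\<Sum>k\<in>UNIV. (u k \<theta>)\<^sup>2)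
          + (\<Sum>k\<in>UNIV. sqrt 2 * h * u k \<theta> + u k \<theta> * Re (rot (\<lambda>_. y) k \<theta>)))
     = integral torus_box (\<lambda>\<theta>. - (\<Sum>k\<in>UNIV. (a k)\<^sup>2) + (\<Sum>k\<in>UNIV. a k * Re (rot (\<lambda>_. y) k \<theta>)))"
    by (simp add: du u sum.distrib sum_distrib_left[symmetric] sa)
  also have "\<dots> = - ?V * (\<Sum>k\<in>UNIV. (a k)\<^sup>2) + (\<Sum>k\<in>UNIV. integral torus_box (\<lambda>\<theta>. a k * Re (rot (\<lambda>_. y) k \<theta>)))"
  proof -
    have "integral torus_box (\<lambda>\<theta>. \<Sum>k\<in>UNIV. a k * Re (rot (\<lambda>_. y) k \<theta>)) = (\<Sum>k\<in>UNIV. integral torus_box (\<lambda>\<theta>. a k * Re (rot (\<lambda>_. y) k \<theta>)))"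
      by (rule integral_sum) (use iY in auto)
    then show ?thesis by (subst integral_add) (auto intro!: integrable_sum iY simp del: integral_mult_right)
  qed
  also have "\<dots> = - ?V * (\<Sum>k\<in>UNIV. (a k)\<^sup>2)" by (simp add: Y)
  finally have D': "deriv (deriv (\<lambda>s. Ffun (x s) (t s) (\<phi> s))) 0
     = - (c * (?V * ((\<Sum>k\<in>UNIV. (a k)\<^sup>2) + (CARD('n) * h\<^sup>2 / 2 + (norm y)\<^sup>2 / 4))))"
    unfolding D by (simp add: algebra_simps)
  have "(\<Sum>k\<in>UNIV. (a k)\<^sup>2) > 0" by (rule sum_pos2[of _ l]) (use a in auto)
  then show ?thesis
    unfolding D' using c V by (simp add: add_pos_nonneg)
qed

end

lemma clifford_hamiltonian_F_stable: "hamiltonian_F_stable (clifford :: real^'n::finite \<Rightarrow> complex^'n)"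
  unfolding hamiltonian_F_stable_def F_stable_wrt_def
proof (intro allI impI)
  fix \<phi> :: "real \<Rightarrow> real^'n \<Rightarrow> complex^'n"
  assume *: "torus_variation clifford \<phi> \<and> hamiltonian_variation clifford \<phi>"
  show "\<exists>(x :: real \<Rightarrow> complex^'n) (t :: real \<Rightarrow> real).
    smooth_map x \<and> smooth_map t \<and> x 0 = 0 \<and> t 0 = 1 \<and> deriv (deriv (\<lambda>s. Ffun (x s) (t s) (\<phi> s))) 0 \<ge> 0"
    using * by (intro hamiltonian_stable) simp_all
qed

lemma clifford_not_lagrangian_F_stable:
  assumes "CARD('n::finite) \<ge> 2"
  shows "\<not> lagrangian_F_stable (clifford :: real^'n \<Rightarrow> complex^'n)"
proof -
  have "\<not> card (UNIV :: 'n set) \<le> Suc 0" using assms by simp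
  then obtain k l :: 'n where kl: "k \<noteq> l" by (auto simp: card_le_Suc0_iff_eq)
  \<comment> \<open>Opposite rates on two circles: nonzero, yet with sum zero.\<close>
  define a :: "'n \<Rightarrow> real" where "a i = (if i = k then 1 else 0) - (if i = l then 1 else 0)" for i
  define \<phi> :: "real \<Rightarrow> real^'n \<Rightarrow> complex^'n"
    where "\<phi> s \<theta> = twist (\<lambda>_. of_real (sqrt 2)) (\<lambda>i. of_real (a i)) (s, \<theta>)" for s \<theta>
  have tv: "torus_variation clifford \<phi>"
    unfolding torus_variation_def
  proof (intro conjI allI)
    show "smooth_map (\<lambda>p. \<phi> (fst p) (snd p))"
      using smooth_map_twist by (simp add: \<phi>_def)
    have "cis (t + 2 * pi) = cis t" for t by (simp add: cis_mult[symmetric])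
    then show "periodic_map (\<phi> s)" for s
      by (auto simp: periodic_map_def \<phi>_def twist_def vec_eq_iff axis_def)
    show "\<phi> 0 = clifford" by (auto simp: \<phi>_def twist_def clifford_def)
  qed
  have "lagrangian_variation clifford \<phi>"
    by (rule lagrangian_variation_twist[OF tv \<phi>_def])
  moreover have "deriv (deriv (\<lambda>s. Ffun (x s) (t s) (\<phi> s))) 0 < 0"
    if "smooth_map x" "smooth_map t" "x 0 = 0" "t 0 = 1" for x and t :: "real \<Rightarrow> real"
    by (rule lagrangian_unstable[OF tv \<phi>_def, of k]) (use kl that in \<open>auto simp: a_def sum_subtractf\<close>)
  ultimately show ?thesis
    unfolding lagrangian_F_stable_def F_stable_wrt_def using tv by (meson not_le)
qed

theorem theorem4p2:
  assumes "CARD('n::finite) \<ge> 2"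
  shows "hamiltonian_F_stable (clifford :: real^'n \<Rightarrow> complex^'n) \<and>
         \<not> lagrangian_F_stable (clifford :: real^'n \<Rightarrow> complex^'n)"
  using clifford_hamiltonian_F_stable clifford_not_lagrangian_F_stable[OF assms] by (rule conjI)

end
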